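(* Let $k\geq 3$ be an integer and let $\Lambda_{u,w}\in\mathbb{R}$ be given for all integers $u,w\geq 0$ with $u+w=k$. Put $$V(x,y)=\sum_{\substack{u,w\geq 0\\ u+w=k}}\Lambda_{u,w}\frac{x^u y^w}{u!\,w!},\qquad g(x,y)=-\frac{x^2}{2}-\frac{y^2}{2}+V(x,y).$$ For each integer $n\geq 0$ let $$A_n=\sum_{G\in\mathcal{G}^k_{-n}}\frac{1}{|\mathrm{Aut}(G)|}\prod_{v\in V^G}\Lambda_{\deg(v)},$$ where $\mathcal{G}^k_{-n}$ is the set of isomorphism classes of edge-bicolored graphs in which every vertex has vertex degree $k$ and whose Euler characteristic equals $-n$. Let $\mathbb{C}\cdot\mathbb{R}^2$ denote the set of points $(w,z)\in\mathbb{C}^2$ whose ratio (when well-defined) is real, let $\mathrm{crit}(g)$ be the set of points $(w,z)\in\mathbb{C}\cdot\mathbb{R}^2$ at which both partial derivatives of the polynomial $g$ vanish, and let $$\Psi=\bigl\{(w,z)\in\mathrm{crit}(g)\setminus\{\mathbf 0\}\;:\;\|(w,z)\|\leq\|(w',z')\|\ \text{for all }(w',z')\in\mathrm{crit}(g)\setminus\{\mathbf 0\}\bigr\},$$ with $\|(w,z)\|=\sqrt{|w|^2+|z|^2}$. Assume that every point of $\Psi$ is non-degenerate, i.e. the Hessian matrix $H_g$ of second partial derivatives of $g$ has full rank there. Then, as $n\to\infty$, $$A_n\sim\frac{1}{2\pi}\,\Gamma(n)\sum_{(w,z)\in\Psi}\frac{(-g(w,z))^{-n}}{\sqrt{-\det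 H_g(w,z)}}.$$
   Context: Edge-bicolored graphs are encoded combinatorially: given two disjoint finite sets $S$ (red half-edge labels) and $T$ (yellow half-edge labels), an $[S,T]$-labeled edge-bicolored graph is a triple $\Gamma=(V,E_S,E_T)$ where $V$ is a set partition of $S\sqcup T$ into non-empty blocks (the vertices), $E_S$ is a partition of $S$ into blocks of size 2 (red edges) and $E_T$ is a partition of $T$ into blocks of size 2 (yellow edges). An isomorphism from an $[S_1,T_1]$-labeled graph $(V^1,E^1_S,E^1_T)$ to an $[S_2,T_2]$-labeled graph $(V^2,E^2_S,E^2_T)$ is a pair of bijections $j_S:S_1\to S_2$, $j_T:T_1\to T_2$ such that the map $j$ they induce on subsets of $S_1\sqcup T_1$ satisfies $j(V^1)=V^2$, $j(E^1_S)=E^2_S$, $j(E^1_T)=E^2_T$; automorphisms of $\Gamma$ (isomorphisms to itself) form the group $\mathrm{Aut}(\Gamma)$. For an isomorphism class $G$, $V^G$, $E^G=E^G_S\sqcup E^G_T$ and $\mathrm{Aut}(G)$ denote the corresponding objects of a representative. The Euler characteristic is $\chi(G)=|V^G|-|E^G|$. The bidegree of a vertex $v$ is $\deg(v)=(u,w)$ with $u=|v\cap S|$, $w=|v\cap T|$, and its vertex degree is $u+w$. The symbol $\sim$ denotes asymptotic equivalence as $n\to\infty$.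
   Formalization: The right-hand side R_n can vanish for infinitely many n where A_n is nonzero (e.g. k=8), so A_n ~ R_n is proved along those n with R_n ≠ 0, and for all n one has |A_n − R_n| = o of Γ(n)/(2π) times the sum over Ψ of the absolute values of the terms. *)

theory Defs
  imports "HOL-Analysis.Analysis" "HOL-Library.Landau_Symbols"
begin

section \<open>Edge-bicolored graphs\<close>

text \<open>The label sets are stored with the graph, although they can be recovered
  from the edges.\<close>

record 'h bigraph =
  red_labels :: "'h set"
  yellow_labels :: "'h set"
  verts :: "'h set set"
  red_edges :: "'h set set"
  yellow_edges :: "'h set set"

definition bigraph :: "'h bigraph \<Rightarrow> bool" where
  "bigraph \<Gamma> \<longleftrightarrow>
     finite (red_labels \<Gamma>) \<and> finite (yellow_labels \<Gamma>) \<and>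
     red_labels \<Gamma> \<inter> yellow_labels \<Gamma> = {} \<and>
     partition_on (red_labels \<Gamma> \<union> yellow_labels \<Gamma>) (verts \<Gamma>) \<and>
     partition_on (red_labels \<Gamma>) (red_edges \<Gamma>) \<and> (\<forall>e\<in>red_edges \<Gamma>. card e = 2) \<and>
     partition_on (yellow_labels \<Gamma>) (yellow_edges \<Gamma>) \<and> (\<forall>e\<in>yellow_edges \<Gamma>. card e = 2)"

definition euler_char :: "'h bigraph \<Rightarrow> int" where
  "euler_char \<Gamma> =
     int (card (verts \<Gamma>)) - (int (card (red_edges \<Gamma>)) + int (card (yellow_edges \<Gamma>)))"

definition bidegree :: "'h bigraph \<Rightarrow> 'h set \<Rightarrow> nat \<times> nat" where
  "bidegree \<Gamma> v = (card (v \<inter> red_labels \<Gamma>), card (v \<inter> yellow_labels \<Gamma>))"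

definition vertex_degree :: "'h bigraph \<Rightarrow> 'h set \<Rightarrow> nat" where
  "vertex_degree \<Gamma> v = fst (bidegree \<Gamma> v) + snd (bidegree \<Gamma> v)"

text \<open>The map on label subsets induced by a pair of maps on red and on yellow labels.\<close>

definition induced_map ::
    "'h bigraph \<Rightarrow> ('h \<Rightarrow> 'i) \<Rightarrow> ('h \<Rightarrow> 'i) \<Rightarrow> 'h set \<Rightarrow> 'i set" where
  "induced_map \<Gamma> jS jT X = jS ` (X \<inter> red_labels \<Gamma>) \<union> jT ` (X \<inter> yellow_labels \<Gamma>)"

text \<open>The bijections are taken to be extensional (undefined outside the label set), so that
  each pair of bijections is counted exactly once.\<close>

definition isos :: "'h bigraph \<Rightarrow> 'i bigraph \<Rightarrow> (('h \<Rightarrow> 'i) \<times> ('h \<Rightarrow> 'i)) set" where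
  "isos \<Gamma>1 \<Gamma>2 = {(jS, jT).
     jS \<in> extensional (red_labels \<Gamma>1) \<and> bij_betw jS (red_labels \<Gamma>1) (red_labels \<Gamma>2) \<and>
     jT \<in> extensional (yellow_labels \<Gamma>1) \<and> bij_betw jT (yellow_labels \<Gamma>1) (yellow_labels \<Gamma>2) \<and>
     induced_map \<Gamma>1 jS jT ` verts \<Gamma>1 = verts \<Gamma>2 \<and>
     induced_map \<Gamma>1 jS jT ` red_edges \<Gamma>1 = red_edges \<Gamma>2 \<and>
     induced_map \<Gamma>1 jS jT ` yellow_edges \<Gamma>1 = yellow_edges \<Gamma>2}"

abbreviation automorphisms :: "'h bigraph \<Rightarrow> (('h \<Rightarrow> 'h) \<times> ('h \<Rightarrow> 'h)) set" where
  "automorphisms \<Gamma> \<equiv> isos \<Gamma> \<Gamma>"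

definition iso_rel :: "('h bigraph \<times> 'h bigraph) set" where
  "iso_rel = {(\<Gamma>1, \<Gamma>2). bigraph \<Gamma>1 \<and> bigraph \<Gamma>2 \<and> isos \<Gamma>1 \<Gamma>2 \<noteq> {}}"

text \<open>Every pair of disjoint finite label sets embeds into the natural numbers, so natural
  number labels represent all isomorphism classes.\<close>

definition graph_classes :: "nat \<Rightarrow> int \<Rightarrow> nat bigraph set set" where
  "graph_classes k c =
     {\<Gamma>. bigraph \<Gamma> \<and> (\<forall>v\<in>verts \<Gamma>. vertex_degree \<Gamma> v = k) \<and> euler_char \<Gamma> = c} // iso_rel"

definition representative :: "nat bigraph set \<Rightarrow> nat bigraph" where
  "representative G = (SOME \<Gamma>. \<Gamma> \<in> G)"

text \<open>Here and below only the values \<open>\<Lambda> u w\<close> with \<open>u + w = k\<close> matter.\<close>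

definition graph_sum :: "nat \<Rightarrow> (nat \<Rightarrow> nat \<Rightarrow> real) \<Rightarrow> nat \<Rightarrow> real" where
  "graph_sum k \<Lambda> n = (\<Sum>G\<in>graph_classes k (- int n).
     1 / real (card (automorphisms (representative G))) *
     (\<Prod>v\<in>verts (representative G). case bidegree (representative G) v of (u, w) \<Rightarrow> \<Lambda> u w))"


section \<open>Critical points\<close>

definition potential :: "nat \<Rightarrow> (nat \<Rightarrow> nat \<Rightarrow> real) \<Rightarrow> complex \<Rightarrow> complex \<Rightarrow> complex" where
  "potential k \<Lambda> x y =
     (\<Sum>(u, w)\<in>{(u, w). u + w = k}. of_real (\<Lambda> u w) * (x ^ u * y ^ w) / (fact u * fact w))"

definition action :: "nat \<Rightarrow> (nat \<Rightarrow> nat \<Rightarrow> real) \<Rightarrow> complex \<Rightarrow> complex \<Rightarrow> complex" where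
  "action k \<Lambda> x y = - (x\<^sup>2 / 2) - y\<^sup>2 / 2 + potential k \<Lambda> x y"

definition partial1 :: "(complex \<Rightarrow> complex \<Rightarrow> complex) \<Rightarrow> complex \<Rightarrow> complex \<Rightarrow> complex" where
  "partial1 f x y = deriv (\<lambda>t. f t y) x"

definition partial2 :: "(complex \<Rightarrow> complex \<Rightarrow> complex) \<Rightarrow> complex \<Rightarrow> complex \<Rightarrow> complex" where
  "partial2 f x y = deriv (\<lambda>t. f x t) y"

definition hessian ::
    "(complex \<Rightarrow> complex \<Rightarrow> complex) \<Rightarrow> complex \<Rightarrow> complex \<Rightarrow> complex^2^2" where
  "hessian f x y =
     vector [vector [partial1 (partial1 f) x y, partial1 (partial2 f) x y],
             vector [partial2 (partial1 f) x y, partial2 (partial2 f) x y]]"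

definition real_ratio_points :: "(complex \<times> complex) set" where
  "real_ratio_points = {(w, z). z \<noteq> 0 \<longrightarrow> w / z \<in> \<real>}"

definition crit :: "(complex \<Rightarrow> complex \<Rightarrow> complex) \<Rightarrow> (complex \<times> complex) set" where
  "crit f = {(w, z) \<in> real_ratio_points. partial1 f w z = 0 \<and> partial2 f w z = 0}"

text \<open>The norm of the product type is \<open>sqrt (\<bar>w\<bar>\<^sup>2 + \<bar>z\<bar>\<^sup>2)\<close>.\<close>

definition minimal_crit :: "(complex \<Rightarrow> complex \<Rightarrow> complex) \<Rightarrow> (complex \<times> complex) set" where
  "minimal_crit f = {p \<in> crit f - {0}. \<forall>q \<in> crit f - {0}. norm p \<le> norm q}"

text \<open>At non-degenerate minimal critical points of \<^const>\<open>action\<close>, the negated Hessian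
  determinant turns out to be a positive real, so that the principal branch \<^const>\<open>csqrt\<close> is
  its positive square root.\<close>

definition saddle_term ::
    "(complex \<Rightarrow> complex \<Rightarrow> complex) \<Rightarrow> nat \<Rightarrow> complex \<Rightarrow> complex \<Rightarrow> complex" where
  "saddle_term f n w z = (- f w z) powi (- int n) / csqrt (- det (hessian f w z))"

definition saddle_sum :: "(complex \<Rightarrow> complex \<Rightarrow> complex) \<Rightarrow> nat \<Rightarrow> complex" where
  "saddle_sum f n =
     1 / (2 * of_real pi) * Gamma (of_nat n) * (\<Sum>(w, z)\<in>minimal_crit f. saddle_term f n w z)"

text \<open>The same expression with every summand replaced by its absolute value.\<close>

definition saddle_scale :: "(complex \<Rightarrow> complex \<Rightarrow> complex) \<Rightarrow> nat \<Rightarrow> real" where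
  "saddle_scale f n =
     1 / (2 * pi) * Gamma (of_nat n) * (\<Sum>(w, z)\<in>minimal_crit f. norm (saddle_term f n w z))"

text \<open>The summands of \<^const>\<open>saddle_sum\<close> can cancel exactly at infinitely many \<open>n\<close>
  (for \<open>k \<ge> 5\<close> they do whenever \<open>2 * n\<close> is not divisible by \<open>k - 2\<close>), so that the quotient
  of \<^const>\<open>graph_sum\<close> and \<^const>\<open>saddle_sum\<close> is undefined there. Accidental cancellation
  is possible at further \<open>n\<close> where \<^const>\<open>graph_sum\<close> does not vanish: for \<open>k = 8\<close> and
  \<open>V = (x\<^sup>2 - y\<^sup>2) * (x\<^sup>2 + y\<^sup>2)^3 + 2 * x^4 * y^4\<close> this happens at every odd multiple of 3.
  Asymptotic equivalence is therefore to be stated along the following filter, and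
  complemented by an error bound relative to \<^const>\<open>saddle_scale\<close> at all \<open>n\<close>.\<close>

definition nonzero_at_top :: "(nat \<Rightarrow> complex) \<Rightarrow> nat filter" where
  "nonzero_at_top b = inf sequentially (principal {n. b n \<noteq> 0})"

end

theory Submission
  imports Defs "HOL-Probability.Distributions" "HOL-Combinatorics.Permutations"
    "HOL-Real_Asymp.Real_Asymp"
begin

text \<open>Counting labelled graphs turns \<^const>\<open>graph_sum\<close> into \<open>1 / m!\<close> times the \<open>m\<close>-th moment of
  \<open>V\<close> under the standard Gaussian measure on the plane, where \<open>m = 2 n / (k - 2)\<close> is the number of
  vertices. In polar coordinates the radial part is explicit, and an integral of \<open>v(\<theta>)^m\<close> over a half
  circle remains, where \<open>v(\<theta>) = V(cos \<theta>, sin \<theta>)\<close>; Laplace's method evaluates it through the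
  maximisers of \<open>\<bar>v\<bar>\<close>. A point \<open>r * (cos \<theta>, sin \<theta>)\<close> with complex \<open>r \<noteq> 0\<close> is critical for the
  action iff \<open>v'(\<theta>) = 0\<close> and \<open>k * r^(k-2) * v(\<theta>) = 1\<close>, so that minimal norm means maximal
  \<open>\<bar>v(\<theta>)\<bar>\<close>, and the sum over the \<open>k - 2\<close> roots \<open>r\<close> vanishes unless \<open>k - 2\<close> divides \<open>2 n\<close>,
  exactly when no graphs exist. The factorials are compared by applying Laplace's method to the
  Beta integral.\<close>

section \<open>Trigonometric moments and set partitions\<close>

text \<open>The obstacle is cancellation. At a maximiser v / max |v| is 1 or -1, so the leading sum
  in Laplace's method alternates with m; it need not converge and may vanish. Laplace's method is
  therefore stated as a difference tending to 0, and one explicit factor is split off from the graph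
  sum, the saddle sum and the sum of absolute values alike. The remaining sum of signs takes one
  value for even m and one for odd m, so where it is nonzero it stays away from 0. This turns an
  additive error into a relative one.

  Non-degeneracy enters through the Hessian determinant. With d = k - 2, at a nonzero critical point
  on a ray the radial eigenvalue of the Hessian is always d and the tangential one is v''/(k v).
  Full rank thus means v'' \<noteq> 0 at the maximisers of |v|, which makes them isolated, hence
  finite in number modulo pi, and supplies the quadratic decay that Laplace's method needs.

  The Beta integral has the factorials of m and n in it, and because 2 n = d m its integrand is the
  m-th power of one fixed function.\<close>

fun pairings :: "nat \<Rightarrow> nat" where
  "pairings 0 = 1"
| "pairings (Suc 0) = 0"
| "pairings (Suc (Suc n)) = Suc n * pairings n"

text \<open>\<open>pairings s\<close> is the s-th moment of a standard Gaussian variable. In polar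
  coordinates the moment of x^s y^t splits into a radial integral, 2^p p!, and an angular one, which
  is evaluated here. No improper integral is needed: the relation sin^2 + cos^2 = 1 and an
  integration by parts give the recursion. Since s + t is even, the integrand has period pi and
  every half circle gives the same value.\<close>

lemma trig_moments:
  assumes "s + t = 2 * p"
  shows "integral {c..c+pi} (\<lambda>x. cos x ^ s * sin x ^ t) * (2 ^ p * fact p)
           = pi * real (pairings s) * real (pairings t)"
  using assms
proof (induction p arbitrary: s t)
  case 0
  then show ?case by simp
next
  case (Suc p)
  let ?I = "\<lambda>s t. integral {c..c+pi} (\<lambda>x. cos x ^ s * sin x ^ t)"
  have int: "(\<lambda>x. cos x ^ s * sin x ^ t) integrable_on {c..c+pi}" for s t
    by (intro integrable_continuous_real continuous_intros)
  have R1: "?I (s + 2) t + ?I s (t + 2) = ?I s t" for s t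
  proof -
    have "?I (s + 2) t + ?I s (t + 2) =
        integral {c..c+pi} (\<lambda>x. cos x ^ (s + 2) * sin x ^ t + cos x ^ s * sin x ^ (t + 2))"
      by (rule Henstock_Kurzweil_Integration.integral_add[OF int int, symmetric])
    also have "\<dots> = ?I s t"
    proof (rule Henstock_Kurzweil_Integration.integral_cong)
      fix x :: real
      have "cos x ^ (s + 2) * sin x ^ t + cos x ^ s * sin x ^ (t + 2) =
          cos x ^ s * sin x ^ t * ((sin x)\<^sup>2 + (cos x)\<^sup>2)"
        unfolding power_add by (simp only: algebra_simps)
      then show "cos x ^ (s + 2) * sin x ^ t + cos x ^ s * sin x ^ (t + 2) = cos x ^ s * sin x ^ t"
        by simp
    qed
    finally show ?thesis .
  qed
  \<comment> \<open>Integration by parts. Over a half turn the boundary function is multiplied by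
    (-1)^(s+t), so for even s + t its boundary values cancel.\<close>
  have R2: "real (t + 1) * ?I (s + 2) t = real (s + 1) * ?I s (t + 2)" if "even (s + t)" for s t
  proof -
    let ?F = "\<lambda>x. cos x ^ (s + 1) * sin x ^ (t + 1) :: real"
    have "((\<lambda>x. real (t + 1) * (cos x ^ (s + 2) * sin x ^ t) - real (s + 1) * (cos x ^ s * sin x ^ (t + 2)))
        has_integral (?F (c + pi) - ?F c)) {c..c+pi}"
    proof (rule fundamental_theorem_of_calculus)
      fix x
      have "(?F has_real_derivative real (s + 1) * cos x ^ (s + 1 - 1) * - sin x * sin x ^ (t + 1)
          + real (t + 1) * sin x ^ (t + 1 - 1) * cos x * cos x ^ (s + 1)) (at x within {c..c+pi})"
        by (rule derivative_eq_intros refl)+ simp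
      also have "real (s + 1) * cos x ^ (s + 1 - 1) * - sin x * sin x ^ (t + 1)
          + real (t + 1) * sin x ^ (t + 1 - 1) * cos x * cos x ^ (s + 1) =
          real (t + 1) * (cos x ^ (s + 2) * sin x ^ t) - real (s + 1) * (cos x ^ s * sin x ^ (t + 2))"
        by (simp add: power_add power2_eq_square)
      finally show "(?F has_vector_derivative
          real (t + 1) * (cos x ^ (s + 2) * sin x ^ t) - real (s + 1) * (cos x ^ s * sin x ^ (t + 2)))
          (at x within {c..c+pi})"
        by (simp only: has_real_derivative_iff_has_vector_derivative)
    qed simp
    moreover have "?F (c + pi) = (-1) ^ (s + t + 2) * ?F c"
      by (simp add: power_minus[of "cos c"] power_minus[of "sin c"] power_add)
    then have "?F (c + pi) - ?F c = 0" using that by simp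
    ultimately have "((\<lambda>x. real (t + 1) * (cos x ^ (s + 2) * sin x ^ t) - real (s + 1) * (cos x ^ s * sin x ^ (t + 2)))
        has_integral 0) {c..c+pi}"
      by (simp only:)
    note integral_unique[OF this]
    also have "integral {c..c+pi} (\<lambda>x. real (t + 1) * (cos x ^ (s + 2) * sin x ^ t) - real (s + 1) * (cos x ^ s * sin x ^ (t + 2)))
        = real (t + 1) * ?I (s + 2) t - real (s + 1) * ?I s (t + 2)"
      unfolding integral_mult_right[symmetric]
      by (rule Henstock_Kurzweil_Integration.integral_diff)
        (intro integrable_continuous_real continuous_intros)+
    finally show ?thesis by simp
  qed
  have fct: "(2::real) ^ Suc p * fact (Suc p) = (2 ^ p * fact p) * (2 * real p + 2)"
    by (simp add: algebra_simps)
  \<comment> \<open>The exponents add up to at least 2, so one of them can be lowered by 2 unless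
    both are 1. In that last case the integral is 0, in agreement with
    \<open>pairings 1 = 0\<close>.\<close>
  consider s' where "s = Suc (Suc s')" | t' where "t = Suc (Suc t')" | "s = 1" "t = 1"
    using Suc.prems by (cases s; cases t; case_tac "s - 1"; case_tac "t - 1") auto
  then show ?case
  proof cases
    case 1
    then have p: "s' + t = 2 * p" using Suc.prems by simp
    then have "even (s' + t)" by simp
    have "(2 * real p + 2) * ?I s t = real (t + 1) * ?I (s' + 2) t + real (s' + 1) * ?I (s' + 2) t"
      unfolding 1 distrib_right[symmetric] using p[THEN arg_cong[of _ _ real]] by simp
    also have "\<dots> = real (s' + 1) * (?I (s' + 2) t + ?I s' (t + 2))"
      unfolding R2[OF \<open>even (s' + t)\<close>] by (simp only: algebra_simps)
    also note R1
    finally have "(2 ^ p * fact p) * ((2 * real p + 2) * ?I s t) = real (s' + 1) * (?I s' t * (2 ^ p * fact p))"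
      by (simp only: mult_ac)
    also note Suc.IH[OF p]
    finally show ?thesis unfolding fct 1 pairings.simps of_nat_mult by (simp only: mult_ac Suc_eq_plus1)
  next
    case 2
    then have p: "s + t' = 2 * p" using Suc.prems by simp
    then have "even (s + t')" by simp
    have "(2 * real p + 2) * ?I s t = real (t' + 1) * ?I s (t' + 2) + real (s + 1) * ?I s (t' + 2)"
      unfolding 2 distrib_right[symmetric] using p[THEN arg_cong[of _ _ real]] by simp
    also have "\<dots> = real (t' + 1) * (?I (s + 2) t' + ?I s (t' + 2))"
      unfolding R2[OF \<open>even (s + t')\<close>, symmetric] by (simp only: algebra_simps)
    also note R1
    finally have "(2 ^ p * fact p) * ((2 * real p + 2) * ?I s t) = real (t' + 1) * (?I s t' * (2 ^ p * fact p))"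
      by (simp only: mult_ac)
    also note Suc.IH[OF p]
    finally show ?thesis unfolding fct 2 pairings.simps of_nat_mult by (simp only: mult_ac Suc_eq_plus1)
  next
    case 3
    have "((\<lambda>x. cos x * sin x) has_integral ((sin (c + pi))\<^sup>2 / 2 - (sin c)\<^sup>2 / 2)) {c..c+pi}"
      by (rule fundamental_theorem_of_calculus)
        (auto intro!: derivative_eq_intros simp flip: has_real_derivative_iff_has_vector_derivative)
    from integral_unique[OF this] show ?thesis
      by (simp add: 3)
  qed
qed

text \<open>The homogenisation of \<open>p\<close> to degree \<open>n\<close>, which must be at least the degree of \<open>p\<close>: coefficients
  beyond \<open>n\<close> are dropped.\<close>

definition form :: "nat \<Rightarrow> real poly \<Rightarrow> 'a \<Rightarrow> 'a \<Rightarrow> 'a::real_normed_field" where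
  "form n p x y = (\<Sum>u\<le>n. of_real (coeff p u) * (x ^ u * y ^ (n - u)))"

lemma form_mult:
  assumes "degree p \<le> n" "degree q \<le> m"
  shows "form n p x y * form m q x y = form (n + m) (p * q) x y"
proof -
  let ?g = "\<lambda>i j. of_real (coeff p i * coeff q j) * (x ^ (i + j) * y ^ (n + m - (i + j)))"
  have "form n p x y * form m q x y = (\<Sum>i\<le>n. \<Sum>j\<le>m. ?g i j)"
    unfolding form_def sum_product
  proof (intro sum.cong refl)
    fix i j assume "i \<in> {..n}" "j \<in> {..m}"
    then have "n + m - (i + j) = (n - i) + (m - j)" by auto
    then show "of_real (coeff p i) * (x ^ i * y ^ (n - i)) * (of_real (coeff q j) * (x ^ j * y ^ (m - j))) = ?g i j"
      by (simp add: power_add mult_ac)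
  qed
  also have "\<dots> = (\<Sum>(i, j)\<in>{..n} \<times> {..m}. ?g i j)"
    by (simp add: sum.cartesian_product)
  also have "\<dots> = (\<Sum>(i, j)\<in>{(i, j). i + j \<le> n + m}. ?g i j)"
  \<comment> \<open>The rectangle of indices is enlarged to the triangle of the Cauchy product. Each
    added term has an index beyond one of the two degree bounds.\<close>
  proof (rule sum.mono_neutral_left)
    have "coeff p i = 0 \<or> coeff q j = 0" if "\<not> (i \<le> n \<and> j \<le> m)" for i j
      using that assms by (auto simp: not_le intro!: coeff_eq_0)
    then show "\<forall>z\<in>{(i, j). i + j \<le> n + m} - {..n} \<times> {..m}. (case z of (i, j) \<Rightarrow> ?g i j) = 0"
      by fastforce
    show "finite {(i, j). i + j \<le> n + m}"
      by (rule finite_subset[of _ "{..n+m} \<times> {..n+m}"]) auto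
  qed auto
  also have "\<dots> = (\<Sum>s\<le>n+m. \<Sum>i\<le>s. ?g i (s - i))"
    by (simp add: sum.triangle_reindex_eq)
  also have "\<dots> = form (n + m) (p * q) x y"
    unfolding form_def coeff_mult of_real_sum sum_distrib_right by (intro sum.cong) auto
  finally show ?thesis .
qed

lemma form_power:
  assumes "degree p \<le> n"
  shows "form n p x y ^ m = form (n * m) (p ^ m) x y"
proof (induction m)
  case 0
  then show ?case by (simp add: form_def)
next
  case (Suc m)
  have "degree (p ^ m) \<le> n * m"
    using degree_power_le[of p m] assms by (metis dual_order.trans mult_le_mono1)
  with Suc form_mult[OF assms this, of x y] show ?case by simp
qed

text \<open>Linear extension of \<open>trig_moments\<close>: replacing each monomial by its Gaussian
  moment amounts, up to the radial factor, to integrating over a half circle.\<close>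

lemma form_moments:
  "(\<Sum>s\<le>2*p. coeff f s * (real (pairings s) * real (pairings (2*p-s))))
     = 2 ^ p * fact p / pi * integral {c..c+pi} (\<lambda>x. form (2*p) f (cos x) (sin x))"
proof -
  have "integral {c..c+pi} (\<lambda>x. form (2*p) f (cos x) (sin x))
     = (\<Sum>s\<le>2*p. coeff f s * integral {c..c+pi} (\<lambda>x. cos x ^ s * sin x ^ (2*p-s)))"
    unfolding form_def of_real_eq_id id_def
    by (subst Henstock_Kurzweil_Integration.integral_sum)
      (auto intro!: integrable_continuous_real continuous_intros)
  moreover have "2 ^ p * fact p / pi * integral {c..c+pi} (\<lambda>x. cos x ^ s * sin x ^ (2*p-s))
     = real (pairings s) * real (pairings (2*p-s))" if "s \<le> 2*p" for s
    using trig_moments[of s "2*p-s" p c] that by (simp add: field_simps)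
  ultimately show ?thesis
    by (auto simp: sum_distrib_left mult_ac intro!: sum.cong)
qed

section \<open>Weighted sums over set partitions with blocks of equal size\<close>

definition uniform_partitions :: "nat \<Rightarrow> 'a set \<Rightarrow> 'a set set set" where
  "uniform_partitions k A = {P. partition_on A P \<and> (\<forall>B\<in>P. card B = k)}"

lemma finite_uniform_partitions: "finite A \<Longrightarrow> finite (uniform_partitions k A)"
  unfolding uniform_partitions_def by (rule finite_subset[OF _ finitely_many_partition_on]) auto

lemma card_uniform_partitions:
  assumes "finite A" "P \<in> uniform_partitions k A"
  shows "card A = k * card P"
proof -
  have "partition_on A P" using assms by (simp add: uniform_partitions_def)
  then have "A = \<Union>P" "disjoint P" by (auto dest: partition_onD1 partition_onD2)
  moreover from this have "\<And>B. B \<in> P \<Longrightarrow> finite B" using assms(1) by (auto intro: finite_subset)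
  ultimately have "card A = sum card P" by (simp add: card_Union_disjoint)
  also have "\<dots> = k * card P" using assms by (simp add: uniform_partitions_def)
  finally show ?thesis .
qed

lemma uniform_partitions_empty: "uniform_partitions k {} = {{}}"
  by (auto simp: uniform_partitions_def partition_on_empty)

lemma uniform_partitions_diff:
  assumes "P \<in> uniform_partitions k A" "B \<in> P"
  shows "B \<subseteq> A" "card B = k" "P - {B} \<in> uniform_partitions k (A - B)"
proof -
  have P: "\<Union>P = A" "\<And>C D. C \<in> P \<Longrightarrow> D \<in> P \<Longrightarrow> C \<noteq> D \<Longrightarrow> C \<inter> D = {}" "{} \<notin> P" "\<And>C. C \<in> P \<Longrightarrow> card C = k"
    using assms(1) by (auto simp: uniform_partitions_def partition_on_def disjoint_def)
  show "B \<subseteq> A" "card B = k" using P assms(2) by auto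
  have "\<Union>(P - {B}) = A - B"
  proof
    show "\<Union>(P - {B}) \<subseteq> A - B" using P(1) P(2)[OF _ assms(2)] by fast
    show "A - B \<subseteq> \<Union>(P - {B})" using P(1) by fast
  qed
  then show "P - {B} \<in> uniform_partitions k (A - B)"
    using P by (auto simp: uniform_partitions_def partition_on_def disjoint_def)
qed

lemma uniform_partitions_insert:
  assumes "Q \<in> uniform_partitions k (A - B)" "B \<subseteq> A" "card B = k" "k > 0"
  shows "insert B Q \<in> uniform_partitions k A" "B \<notin> Q"
proof -
  have "B \<noteq> {}" using assms by auto
  then show "B \<notin> Q" using assms(1) by (auto simp: uniform_partitions_def partition_on_def)
  have Q: "\<Union>Q = A - B" "\<And>C D. C \<in> Q \<Longrightarrow> D \<in> Q \<Longrightarrow> C \<noteq> D \<Longrightarrow> C \<inter> D = {}" "{} \<notin> Q" "\<And>C. C \<in> Q \<Longrightarrow> card C = k"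
    using assms(1) by (auto simp: uniform_partitions_def partition_on_def disjoint_def)
  then have "\<Union>(insert B Q) = A" "\<And>C. C \<in> Q \<Longrightarrow> B \<inter> C = {}" using assms(2) by auto
  with Q assms(3) \<open>B \<noteq> {}\<close> show "insert B Q \<in> uniform_partitions k A"
    by (auto simp: uniform_partitions_def partition_on_def disjoint_def)
qed

definition partition_sum :: "nat \<Rightarrow> ('a set \<Rightarrow> real) \<Rightarrow> 'a set \<Rightarrow> real" where
  "partition_sum k f A = (\<Sum>P\<in>uniform_partitions k A. \<Prod>B\<in>P. f B)"

lemma partition_sum_empty: "partition_sum k f {} = 1"
  by (simp add: partition_sum_def uniform_partitions_empty)

text \<open>Double counting of partitions with one marked block. A partition offers
  \<open>card A\<close> / k blocks to mark; marking the block first leaves a partition of the rest.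
  The same recursion serves edges (k = 2) and vertices.\<close>

lemma partition_sum_rec:
  assumes "finite A" "k > 0"
  shows "real (card A) * partition_sum k f A = real k * (\<Sum>B | B \<subseteq> A \<and> card B = k. f B * partition_sum k f (A - B))"
proof -
  have fin: "finite P" if "P \<in> uniform_partitions k A" for P
    using that assms(1) finite_elements by (auto simp: uniform_partitions_def)
  have "real (card A) * partition_sum k f A = (\<Sum>P\<in>uniform_partitions k A. real k * (\<Sum>B\<in>P. f B * (\<Prod>C\<in>P-{B}. f C)))"
    unfolding partition_sum_def sum_distrib_left[of "real (card A)"]
  proof (intro sum.cong refl)
    fix P assume P: "P \<in> uniform_partitions k A"
    have "(\<Sum>B\<in>P. f B * (\<Prod>C\<in>P-{B}. f C)) = (\<Sum>B\<in>P. \<Prod>C\<in>P. f C)"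
      using fin[OF P] by (intro sum.cong refl prod.remove[symmetric])
    then show "real (card A) * (\<Prod>B\<in>P. f B) = real k * (\<Sum>B\<in>P. f B * (\<Prod>C\<in>P-{B}. f C))"
      using card_uniform_partitions[OF assms(1) P] by simp
  qed
  also have "\<dots> = real k * (\<Sum>(P, B)\<in>Sigma (uniform_partitions k A) (\<lambda>P. P). f B * (\<Prod>C\<in>P-{B}. f C))"
    unfolding sum_distrib_left[symmetric] using fin finite_uniform_partitions[OF assms(1)]
    by (subst sum.Sigma) auto
  also have "(\<Sum>(P, B)\<in>Sigma (uniform_partitions k A) (\<lambda>P. P). f B * (\<Prod>C\<in>P-{B}. f C)) =
      (\<Sum>(B, Q)\<in>Sigma {B. B \<subseteq> A \<and> card B = k} (\<lambda>B. uniform_partitions k (A - B)). f B * (\<Prod>C\<in>Q. f C))"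
    \<comment> \<open>Removing the marked block and inserting it again are inverse to each other.
      Positivity of \<open>k\<close> makes the block nonempty, so that it cannot already belong to a
      partition of the rest.\<close>
    by (rule sum.reindex_bij_witness[where i = "\<lambda>(B, Q). (insert B Q, B)" and j = "\<lambda>(P, B). (B, P - {B})"])
      (use assms(2) in \<open>auto simp: insert_absorb uniform_partitions_insert(1) dest: uniform_partitions_diff uniform_partitions_insert(2) subsetD\<close>)
  also have "\<dots> = (\<Sum>B | B \<subseteq> A \<and> card B = k. f B * partition_sum k f (A - B))"
    unfolding partition_sum_def sum_distrib_left using assms(1)
    by (subst sum.Sigma) (auto intro!: finite_uniform_partitions)
  finally show ?thesis .
qed

text \<open>With unit weights the recursion reads N * c(N) = 2 * (N choose 2) * c(N - 2). Cancelling
  N leaves the recursion of \<open>pairings\<close>, which thus counts perfect matchings as well as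
  giving Gaussian moments.\<close>

lemma card_uniform_partitions_2:
  assumes "finite A"
  shows "card (uniform_partitions 2 A) = pairings (card A)"
proof -
  have "partition_sum 2 (\<lambda>_. 1) A = real (pairings (card A))"
    using assms
  proof (induction "card A" arbitrary: A rule: pairings.induct)
    case 1
    then show ?case by (simp add: partition_sum_empty)
  next
    case 2
    then have "card B \<noteq> 2" if "B \<subseteq> A" for B using card_mono[OF _ that] by auto
    then have e: "{B. B \<subseteq> A \<and> card B = 2} = {}" by auto
    show ?case using partition_sum_rec[OF 2(2), of 2 "\<lambda>_. 1"] 2(1)[symmetric] unfolding e by simp
  next
    case (3 n)
    have "partition_sum 2 (\<lambda>_. 1) (A - B) = real (pairings n)" if "B \<subseteq> A" "card B = 2" for B
    proof -
      have "card (A - B) = n" using 3(2,3) that by (simp add: card_Diff_subset finite_subset[OF that(1)])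
      with 3(1)[of "A - B"] 3(3) show ?thesis by simp
    qed
    then have "real (card A) * partition_sum 2 (\<lambda>_. 1) A = (2 * real (card A choose 2)) * real (pairings n)"
      using partition_sum_rec[OF 3(3), of 2 "\<lambda>_. 1"] n_subsets[OF 3(3), of 2] by simp
    also have "2 * real (card A choose 2) = real (card A) * real (Suc n)"
      unfolding 3(2)[symmetric] choose_two by (simp add: real_of_nat_div algebra_simps)
    finally show ?case using 3(2)[symmetric] by (simp, simp add: algebra_simps)
  qed
  then show ?thesis by (simp add: partition_sum_def)
qed

lemma sum_subsets_Un:
  fixes g :: "nat \<Rightarrow> nat \<Rightarrow> real"
  assumes "finite S" "finite T" "S \<inter> T = {}"
  shows "(\<Sum>B | B \<subseteq> S \<union> T \<and> card B = k. g (card (B \<inter> S)) (card (B \<inter> T)))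
    = (\<Sum>u\<le>k. real (card S choose u) * real (card T choose (k - u)) * g u (k - u))"
proof -
  let ?sub = "\<lambda>A j. {B. B \<subseteq> A \<and> card B = j}"
  have "(\<Sum>u\<le>k. real (card S choose u) * real (card T choose (k - u)) * g u (k - u))
      = (\<Sum>u\<le>k. \<Sum>(C, D)\<in>?sub S u \<times> ?sub T (k - u). g u (k - u))"
    using assms by (simp add: card_cartesian_product n_subsets)
  also have "\<dots> = (\<Sum>(u, C, D)\<in>Sigma {..k} (\<lambda>u. ?sub S u \<times> ?sub T (k - u)). g u (k - u))"
    using assms by (subst sum.Sigma) (auto simp: case_prod_unfold)
  also have "\<dots> = (\<Sum>B | B \<subseteq> S \<union> T \<and> card B = k. g (card (B \<inter> S)) (card (B \<inter> T)))"
  proof (rule sum.reindex_bij_witness[where i = "\<lambda>B. (card (B \<inter> S), B \<inter> S, B \<inter> T)" and j = "\<lambda>(u, C, D). C \<union> D"])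
    have c: "card (B \<inter> S) + card (B \<inter> T) = card B" if "B \<subseteq> S \<union> T" for B
    proof -
      have "B = (B \<inter> S) \<union> (B \<inter> T)" using that by auto
      moreover have "card ((B \<inter> S) \<union> (B \<inter> T)) = card (B \<inter> S) + card (B \<inter> T)"
        using assms by (intro card_Un_disjoint) auto
      ultimately show ?thesis by simp
    qed
    show "(card (B \<inter> S), B \<inter> S, B \<inter> T) \<in> Sigma {..k} (\<lambda>u. ?sub S u \<times> ?sub T (k - u))"
      if "B \<in> {B. B \<subseteq> S \<union> T \<and> card B = k}" for B
      using that c[of B] by auto
    fix a assume a: "a \<in> Sigma {..k} (\<lambda>u. ?sub S u \<times> ?sub T (k - u))"
    then obtain u C D where [simp]: "a = (u, C, D)" and CD: "u \<le> k" "C \<subseteq> S" "card C = u" "D \<subseteq> T" "card D = k - u"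
      by auto
    have [simp]: "(C \<union> D) \<inter> S = C" "(C \<union> D) \<inter> T = D" using CD assms by auto
    have "card (C \<union> D) = card C + card D"
      using CD assms finite_subset by (intro card_Un_disjoint) (blast intro: finite_subset)+
    then show "(case a of (u, C, D) \<Rightarrow> C \<union> D) \<in> {B. B \<subseteq> S \<union> T \<and> card B = k}"
      using CD by auto
    show "(case case a of (u, C, D) \<Rightarrow> C \<union> D of B \<Rightarrow> (card (B \<inter> S), B \<inter> S, B \<inter> T)) = a"
      using CD by simp
    show "g (card ((case a of (u, C, D) \<Rightarrow> C \<union> D) \<inter> S)) (card ((case a of (u, C, D) \<Rightarrow> C \<union> D) \<inter> T)) =
         (case a of (u, C, D) \<Rightarrow> g u (k - u))"
      using CD by simp
  next
    fix B assume "B \<in> {B. B \<subseteq> S \<union> T \<and> card B = k}"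
    then show "(case (card (B \<inter> S), B \<inter> S, B \<inter> T) of (u, C, D) \<Rightarrow> C \<union> D) = B" by auto
  qed
  finally show ?thesis by simp
qed

text \<open>Exponential formula in two colours: \<open>p\<close> is the exponential generating
  function of a single block, so m unordered blocks are generated by p^m / m!. One variable
  suffices, because the total \<open>k * m\<close> fixes the yellow exponent once the red one is
  known. In the induction, removing a block of bidegree (u, k - u) corresponds to splitting off one
  factor \<open>p\<close> in the Cauchy product.\<close>

lemma partition_sum_bidegree:
  fixes \<Lambda> :: "nat \<Rightarrow> nat \<Rightarrow> real"
  assumes "finite S" "finite T" "S \<inter> T = {}" "card S + card T = k * m" "k > 0"
    and p: "degree p \<le> k" "\<And>u. u \<le> k \<Longrightarrow> coeff p u = \<Lambda> u (k - u) / (fact u * fact (k - u))"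
  shows "fact m * partition_sum k (\<lambda>B. \<Lambda> (card (B \<inter> S)) (card (B \<inter> T))) (S \<union> T)
     = fact (card S) * fact (card T) * coeff (p ^ m) (card S)"
  using assms(1-4)
proof (induction m arbitrary: S T)
  case 0
  then show ?case by (simp add: partition_sum_empty)
next
  case (Suc m)
  let ?f = "\<lambda>B. \<Lambda> (card (B \<inter> S)) (card (B \<inter> T))"
  let ?s = "card S" and ?t = "card T"
  \<comment> \<open>No block has a bidegree exceeding (?s, ?t), but the sum over u to which this is
    applied also meets such bidegrees; there a binomial coefficient is 0, and the default 0 is
    harmless.\<close>
  let ?g = "\<lambda>u w. \<Lambda> u w * (if u \<le> ?s \<and> w \<le> ?t then fact (?s - u) * fact (?t - w) * coeff (p ^ m) (?s - u) else 0)"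
  have cU: "card (S \<union> T) = k * Suc m" using Suc.prems by (simp add: card_Un_disjoint)
  have 1: "fact m * (?f B * partition_sum k ?f (S \<union> T - B)) = ?g (card (B \<inter> S)) (card (B \<inter> T))"
    if B: "B \<subseteq> S \<union> T" "card B = k" for B
  proof -
    have fB: "finite B" using B Suc.prems finite_subset by blast
    have BU: "B = (B \<inter> S) \<union> (B \<inter> T)" using B by auto
    have cB: "card (B \<inter> S) + card (B \<inter> T) = k"
      unfolding B(2)[symmetric] using Suc.prems fB
      by (subst (3) BU, intro card_Un_disjoint[symmetric]) auto
    have cS: "card (S - B) = ?s - card (B \<inter> S)" "card (B \<inter> S) \<le> ?s"
      using Suc.prems by (simp_all add: card_Diff_subset_Int Int_commute card_mono)
    have cT: "card (T - B) = ?t - card (B \<inter> T)" "card (B \<inter> T) \<le> ?t"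
      using Suc.prems by (simp_all add: card_Diff_subset_Int Int_commute card_mono)
    have eq: "S \<union> T - B = (S - B) \<union> (T - B)" by auto
    have "partition_sum k ?f (S \<union> T - B) = partition_sum k (\<lambda>C. \<Lambda> (card (C \<inter> (S - B))) (card (C \<inter> (T - B)))) ((S - B) \<union> (T - B))"
      unfolding eq partition_sum_def
    \<comment> \<open>Blocks of the rest avoid \<open>B\<close>, so their bidegrees can be taken
      relative to the smaller label sets, as the induction hypothesis demands.\<close>
    proof (intro sum.cong prod.cong refl)
      fix P C assume "P \<in> uniform_partitions k (S - B \<union> (T - B))" "C \<in> P"
      then have "C \<subseteq> S - B \<union> (T - B)" by (auto simp: uniform_partitions_def partition_on_def)
      then have "C \<inter> (S - B) = C \<inter> S" "C \<inter> (T - B) = C \<inter> T" by auto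
      then show "?f C = \<Lambda> (card (C \<inter> (S - B))) (card (C \<inter> (T - B)))" by simp
    qed
    moreover have "fact m * partition_sum k (\<lambda>C. \<Lambda> (card (C \<inter> (S - B))) (card (C \<inter> (T - B)))) ((S - B) \<union> (T - B))
      = fact (card (S - B)) * fact (card (T - B)) * coeff (p ^ m) (card (S - B))"
      using Suc.prems cS cT cB by (intro Suc.IH) auto
    ultimately show ?thesis using cS cT by simp
  qed
  have "real (k * Suc m) * (fact m * partition_sum k ?f (S \<union> T))
      = real k * (\<Sum>B | B \<subseteq> S \<union> T \<and> card B = k. fact m * (?f B * partition_sum k ?f (S \<union> T - B)))"
    using partition_sum_rec[of "S \<union> T" k ?f] Suc.prems(1,2) assms(5) unfolding cU
    by (simp add: sum_distrib_left[symmetric] mult_ac)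
  also have "(\<Sum>B | B \<subseteq> S \<union> T \<and> card B = k. fact m * (?f B * partition_sum k ?f (S \<union> T - B)))
      = (\<Sum>B | B \<subseteq> S \<union> T \<and> card B = k. ?g (card (B \<inter> S)) (card (B \<inter> T)))"
    using 1 by (intro sum.cong) auto
  also have "\<dots> = (\<Sum>u\<le>k. real (?s choose u) * real (?t choose (k - u)) * ?g u (k - u))"
    by (rule sum_subsets_Un[OF Suc.prems(1-3)])
  also have "\<dots> = (\<Sum>u\<le>k. fact ?s * fact ?t * (if u \<le> ?s then coeff p u * coeff (p ^ m) (?s - u) else 0))"
  proof (intro sum.cong refl)
    fix u assume "u \<in> {..k}"
    then have u: "u \<le> k" by simp
    have deg: "degree (p ^ m) \<le> k * m"
      using degree_power_le[of p m] p(1) by (metis dual_order.trans mult_le_mono1)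
    show "real (?s choose u) * real (?t choose (k - u)) * ?g u (k - u)
        = fact ?s * fact ?t * (if u \<le> ?s then coeff p u * coeff (p ^ m) (?s - u) else 0)"
    proof (cases "u \<le> ?s \<and> k - u \<le> ?t")
      case True
      then have "real (?s choose u) * fact (?s - u) = fact ?s / fact u"
          "real (?t choose (k - u)) * fact (?t - (k - u)) = fact ?t / fact (k - u)"
        by (simp_all add: binomial_fact)
      then have "real (?s choose u) * real (?t choose (k - u)) * ?g u (k - u) =
          (fact ?s / fact u) * (fact ?t / fact (k - u)) * \<Lambda> u (k - u) * coeff (p ^ m) (?s - u)"
        using True by (simp del: times_divide_eq_left times_divide_eq_right) algebra
      then show ?thesis using True p(2)[OF u] by simp
    next
      case False
      \<comment> \<open>Here the yellow labels do not suffice: \<open>k - u > ?t\<close>. Since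
        \<open>?s + ?t = k * Suc m\<close>, the index \<open>?s - u\<close> then exceeds the degree
        bound \<open>k * m\<close>. This is why the sum above only has to test u \<le> ?s.\<close>
      have "coeff (p ^ m) (?s - u) = 0" if "u \<le> ?s"
      proof -
        have "?s - u > k * m" using that False Suc.prems(4) u by auto
        then show ?thesis using deg by (intro coeff_eq_0) auto
      qed
      then show ?thesis using False by auto
    qed
  qed
  also have "\<dots> = fact ?s * fact ?t * coeff (p ^ Suc m) ?s"
  proof -
    have "(\<Sum>u\<le>k. if u \<le> ?s then coeff p u * coeff (p ^ m) (?s - u) else 0) =
        (\<Sum>u\<in>{..k} \<inter> {..?s}. coeff p u * coeff (p ^ m) (?s - u))"
      by (simp only: sum.inter_restrict[OF finite_atMost] atMost_iff)
    also have "\<dots> = (\<Sum>u\<le>?s. coeff p u * coeff (p ^ m) (?s - u))"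
      using p(1) by (intro sum.mono_neutral_left) (auto intro!: coeff_eq_0)
    finally show ?thesis by (simp add: coeff_mult sum_distrib_left[symmetric])
  qed
  finally show ?case using assms(5) by (simp only: of_nat_mult mult.assoc fact_Suc) simp
qed

section \<open>Labelled graphs and isomorphism classes\<close>

definition ext_bijs :: "'a set \<Rightarrow> 'b set \<Rightarrow> ('a \<Rightarrow> 'b) set" where
  "ext_bijs A B = {f \<in> extensional A. bij_betw f A B}"

lemma ext_bijs_finite: "finite A \<Longrightarrow> finite B \<Longrightarrow> finite (ext_bijs A B)"
proof -
  assume "finite A" "finite B"
  then have "finite (A \<rightarrow>\<^sub>E B)" by (simp add: finite_PiE)
  moreover have "ext_bijs A B \<subseteq> A \<rightarrow>\<^sub>E B"
    by (auto simp: ext_bijs_def bij_betw_def PiE_def)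
  ultimately show ?thesis by (rule rev_finite_subset)
qed

text \<open>Composing one fixed bijection with all permutations of \<open>A\<close>, and cutting off
  outside \<open>A\<close>, produces each extensional bijection once.\<close>

lemma card_ext_bijs:
  assumes "finite A" "finite B" "card A = card B"
  shows "card (ext_bijs A B) = fact (card A)"
proof -
  obtain f where f: "bij_betw f A B"
    using finite_same_card_bij[OF assms] by blast
  have "bij_betw (\<lambda>p. restrict (f \<circ> p) A) {p. p permutes A} (ext_bijs A B)"
  proof (rule bij_betwI')
    fix p q assume pq: "p \<in> {p. p permutes A}" "q \<in> {p. p permutes A}"
    have "p = q" if eq: "restrict (f \<circ> p) A = restrict (f \<circ> q) A"
    proof
      fix x
      show "p x = q x"
      proof (cases "x \<in> A")
        case True
        then have "f (p x) = f (q x)" using fun_cong[OF eq, of x] by simp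
        moreover have "p x \<in> A" "q x \<in> A" using pq True by (auto simp: permutes_in_image)
        ultimately show ?thesis using f by (auto simp: bij_betw_def inj_on_def)
      qed (use pq in \<open>auto simp: permutes_def\<close>)
    qed
    then show "(restrict (f \<circ> p) A = restrict (f \<circ> q) A) = (p = q)" by blast
  next
    fix p assume "p \<in> {p. p permutes A}"
    then have "bij_betw (f \<circ> p) A B" using bij_betw_trans[OF permutes_imp_bij f] by auto
    then show "restrict (f \<circ> p) A \<in> ext_bijs A B"
      by (simp add: ext_bijs_def bij_betw_restrict_eq)
  next
    fix g assume g: "g \<in> ext_bijs A B"
    define p where "p = (\<lambda>x. if x \<in> A then inv_into A f (g x) else x)"
    have "bij_betw (inv_into A f \<circ> g) A A"
      using g bij_betw_trans[OF _ bij_betw_inv_into[OF f]] by (auto simp: ext_bijs_def)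
    then have "bij_betw p A A"
      by (rule bij_betw_cong[THEN iffD1, rotated]) (simp add: p_def)
    then have "p permutes A" by (rule bij_imp_permutes) (simp add: p_def)
    moreover have "g = restrict (f \<circ> p) A"
    proof
      fix x
      show "g x = restrict (f \<circ> p) A x"
        using g f by (cases "x \<in> A")
          (auto simp: ext_bijs_def p_def extensional_def bij_betw_def intro!: f_inv_into_f[symmetric])
    qed
    ultimately show "\<exists>p\<in>{p. p permutes A}. g = restrict (f \<circ> p) A" by blast
  qed
  then have "card (ext_bijs A B) = card {p. p permutes A}"
    by (simp add: bij_betw_same_card)
  then show ?thesis using card_permutations[OF refl assms(1)] by simp
qed

section \<open>Transport of graphs along relabellings\<close>

definition relabel :: "'h bigraph \<Rightarrow> ('h \<Rightarrow> 'i) \<Rightarrow> ('h \<Rightarrow> 'i) \<Rightarrow> 'i bigraph" where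
  "relabel \<Gamma> jS jT =
    \<lparr>red_labels = jS ` red_labels \<Gamma>, yellow_labels = jT ` yellow_labels \<Gamma>,
     verts = induced_map \<Gamma> jS jT ` verts \<Gamma>,
     red_edges = induced_map \<Gamma> jS jT ` red_edges \<Gamma>,
     yellow_edges = induced_map \<Gamma> jS jT ` yellow_edges \<Gamma>\<rparr>"

lemma relabel_simps [simp]:
  "red_labels (relabel \<Gamma> jS jT) = jS ` red_labels \<Gamma>"
  "yellow_labels (relabel \<Gamma> jS jT) = jT ` yellow_labels \<Gamma>"
  "verts (relabel \<Gamma> jS jT) = induced_map \<Gamma> jS jT ` verts \<Gamma>"
  "red_edges (relabel \<Gamma> jS jT) = induced_map \<Gamma> jS jT ` red_edges \<Gamma>"
  "yellow_edges (relabel \<Gamma> jS jT) = induced_map \<Gamma> jS jT ` yellow_edges \<Gamma>"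
  by (simp_all add: relabel_def)

text \<open>Makes isomorphism sets the fibres of a single map. Composition, inversion and the orbit
  count then reduce to equations between relabelled graphs.\<close>

lemma isos_eq_relabel:
  "isos \<Gamma>1 \<Gamma>2 = {(jS, jT). jS \<in> ext_bijs (red_labels \<Gamma>1) (red_labels \<Gamma>2) \<and>
     jT \<in> ext_bijs (yellow_labels \<Gamma>1) (yellow_labels \<Gamma>2) \<and> relabel \<Gamma>1 jS jT = \<Gamma>2}"
proof -
  have "relabel \<Gamma>1 jS jT = \<Gamma>2 \<longleftrightarrow> jS ` red_labels \<Gamma>1 = red_labels \<Gamma>2 \<and> jT ` yellow_labels \<Gamma>1 = yellow_labels \<Gamma>2 \<and>
     induced_map \<Gamma>1 jS jT ` verts \<Gamma>1 = verts \<Gamma>2 \<and>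
     induced_map \<Gamma>1 jS jT ` red_edges \<Gamma>1 = red_edges \<Gamma>2 \<and>
     induced_map \<Gamma>1 jS jT ` yellow_edges \<Gamma>1 = yellow_edges \<Gamma>2" for jS jT
    by (auto simp: relabel_def)
  then show ?thesis by (auto simp: isos_def ext_bijs_def bij_betw_def)
qed

lemma bigraphD:
  assumes "bigraph \<Gamma>"
  shows "finite (red_labels \<Gamma>)" "finite (yellow_labels \<Gamma>)" "red_labels \<Gamma> \<inter> yellow_labels \<Gamma> = {}"
    "verts \<Gamma> \<subseteq> Pow (red_labels \<Gamma> \<union> yellow_labels \<Gamma>)"
    "red_edges \<Gamma> \<subseteq> Pow (red_labels \<Gamma>)" "yellow_edges \<Gamma> \<subseteq> Pow (yellow_labels \<Gamma>)"
proof -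
  have sub: "P \<subseteq> Pow A" if "partition_on A P" for A :: "'a set" and P
    using partition_onD1[OF that] by auto
  show "finite (red_labels \<Gamma>)" "finite (yellow_labels \<Gamma>)" "red_labels \<Gamma> \<inter> yellow_labels \<Gamma> = {}"
    "verts \<Gamma> \<subseteq> Pow (red_labels \<Gamma> \<union> yellow_labels \<Gamma>)"
    "red_edges \<Gamma> \<subseteq> Pow (red_labels \<Gamma>)" "yellow_edges \<Gamma> \<subseteq> Pow (yellow_labels \<Gamma>)"
    using assms unfolding bigraph_def by (simp_all add: sub)
qed

text \<open>On disjoint label sets the two maps are one map on all labels, so general facts about
  images under injective functions apply to vertices and to edges of both colours.\<close>

lemma induced_map_glue:
  assumes "X \<subseteq> red_labels \<Gamma> \<union> yellow_labels \<Gamma>" "red_labels \<Gamma> \<inter> yellow_labels \<Gamma> = {}"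
  shows "induced_map \<Gamma> jS jT X = (\<lambda>x. if x \<in> red_labels \<Gamma> then jS x else jT x) ` X"
proof -
  let ?g = "\<lambda>x. if x \<in> red_labels \<Gamma> then jS x else jT x"
  have "X = (X \<inter> red_labels \<Gamma>) \<union> (X \<inter> yellow_labels \<Gamma>)" using assms(1) by blast
  then have "?g ` X = ?g ` (X \<inter> red_labels \<Gamma>) \<union> ?g ` (X \<inter> yellow_labels \<Gamma>)"
    by (metis image_Un)
  also have "?g ` (X \<inter> red_labels \<Gamma>) = jS ` (X \<inter> red_labels \<Gamma>)" by (intro image_cong) auto
  also have "?g ` (X \<inter> yellow_labels \<Gamma>) = jT ` (X \<inter> yellow_labels \<Gamma>)"
    using assms(2) by (intro image_cong) auto
  finally show ?thesis by (simp add: induced_map_def)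
qed

lemma glue_inj:
  assumes "inj_on jS R" "inj_on jT Y" "jS ` R \<inter> jT ` Y = {}"
  shows "inj_on (\<lambda>x. if x \<in> R then jS x else jT x) (R \<union> Y)"
proof (rule inj_onI)
  fix x y assume xy: "x \<in> R \<union> Y" "y \<in> R \<union> Y"
    and eq: "(if x \<in> R then jS x else jT x) = (if y \<in> R then jS y else jT y)"
  have disj: "jS a \<noteq> jT b" if "a \<in> R" "b \<in> Y" for a b using assms(3) that by blast
  show "x = y"
  proof (cases "x \<in> R"; cases "y \<in> R")
    assume "x \<in> R" "y \<in> R" then show ?thesis using eq inj_onD[OF assms(1)] by simp
  next
    assume "x \<in> R" "y \<notin> R" then show ?thesis using eq disj[of x y] xy by simp
  next
    assume "x \<notin> R" "y \<in> R" then show ?thesis using eq disj[of y x] xy by simp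
  next
    assume "x \<notin> R" "y \<notin> R" then show ?thesis using eq xy inj_onD[OF assms(2)] by simp
  qed
qed

lemma induced_map_inj:
  assumes "bigraph \<Gamma>" "inj_on jS (red_labels \<Gamma>)" "inj_on jT (yellow_labels \<Gamma>)"
    "jS ` red_labels \<Gamma> \<inter> jT ` yellow_labels \<Gamma> = {}"
  shows "inj_on (induced_map \<Gamma> jS jT) (Pow (red_labels \<Gamma> \<union> yellow_labels \<Gamma>))"
proof -
  let ?g = "\<lambda>x. if x \<in> red_labels \<Gamma> then jS x else jT x"
  have "inj_on ((`) ?g) (Pow (red_labels \<Gamma> \<union> yellow_labels \<Gamma>))"
    using glue_inj[OF assms(2-4)] by (rule inj_on_image_Pow)
  then show ?thesis
    by (rule inj_on_cong[THEN iffD1, rotated]) (simp add: induced_map_glue bigraphD(3)[OF assms(1)])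
qed

lemma partition_on_induced:
  assumes "bigraph \<Gamma>" "inj_on jS (red_labels \<Gamma>)" "inj_on jT (yellow_labels \<Gamma>)"
    "jS ` red_labels \<Gamma> \<inter> jT ` yellow_labels \<Gamma> = {}"
    and "partition_on A P" "A \<subseteq> red_labels \<Gamma> \<union> yellow_labels \<Gamma>"
  shows "partition_on (induced_map \<Gamma> jS jT A) (induced_map \<Gamma> jS jT ` P)"
    "B \<subseteq> A \<Longrightarrow> card (induced_map \<Gamma> jS jT B) = card B"
proof -
  define g where "g = (\<lambda>x. if x \<in> red_labels \<Gamma> then jS x else jT x)"
  have inj: "inj_on g A" unfolding g_def using glue_inj[OF assms(2-4)] assms(6) by (rule inj_on_subset)
  have eq: "induced_map \<Gamma> jS jT B = g ` B" if "B \<subseteq> A" for B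
    unfolding g_def using that assms(6) by (intro induced_map_glue bigraphD(3)[OF assms(1)]) auto
  have "\<And>B. B \<in> P \<Longrightarrow> B \<subseteq> A" using assms(5) by (auto simp: partition_on_def)
  then have "induced_map \<Gamma> jS jT ` P = (`) g ` P"
    using eq by (intro image_cong) auto
  moreover have "{} \<notin> (`) g ` P" using assms(5) by (auto simp: partition_on_def)
  ultimately show "partition_on (induced_map \<Gamma> jS jT A) (induced_map \<Gamma> jS jT ` P)"
    using partition_on_inj_image[OF assms(5) inj] unfolding eq[OF order_refl] by simp
  show "card (induced_map \<Gamma> jS jT B) = card B" if "B \<subseteq> A"
    unfolding eq[OF that] by (rule card_image[OF inj_on_subset[OF inj that]])
qed

lemma bigraph_relabel:
  assumes "bigraph \<Gamma>" "inj_on jS (red_labels \<Gamma>)" "inj_on jT (yellow_labels \<Gamma>)"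
    "jS ` red_labels \<Gamma> \<inter> jT ` yellow_labels \<Gamma> = {}"
  shows "bigraph (relabel \<Gamma> jS jT)"
proof -
  note part = partition_on_induced[OF assms]
  have R: "induced_map \<Gamma> jS jT (red_labels \<Gamma>) = jS ` red_labels \<Gamma>"
    and Y: "induced_map \<Gamma> jS jT (yellow_labels \<Gamma>) = jT ` yellow_labels \<Gamma>"
    and RY: "induced_map \<Gamma> jS jT (red_labels \<Gamma> \<union> yellow_labels \<Gamma>) = jS ` red_labels \<Gamma> \<union> jT ` yellow_labels \<Gamma>"
    using bigraphD(3)[OF assms(1)] by (auto simp: induced_map_def Int_commute Int_Un_distrib)
  have c: "\<forall>e\<in>induced_map \<Gamma> jS jT ` P. card e = 2" if "partition_on A P" "A \<subseteq> red_labels \<Gamma> \<union> yellow_labels \<Gamma>"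
    "\<forall>e\<in>P. card e = 2" for A P
  proof
    fix e assume "e \<in> induced_map \<Gamma> jS jT ` P"
    then obtain B where B: "B \<in> P" "e = induced_map \<Gamma> jS jT B" by auto
    then have "B \<subseteq> A" using that(1) by (auto simp: partition_on_def)
    then show "card e = 2" using part(2)[OF that(1,2)] B that(3) by simp
  qed
  have "partition_on (red_labels \<Gamma> \<union> yellow_labels \<Gamma>) (verts \<Gamma>)"
    "partition_on (red_labels \<Gamma>) (red_edges \<Gamma>)" "\<forall>e\<in>red_edges \<Gamma>. card e = 2"
    "partition_on (yellow_labels \<Gamma>) (yellow_edges \<Gamma>)" "\<forall>e\<in>yellow_edges \<Gamma>. card e = 2"
    using assms(1) by (auto simp: bigraph_def)
  note P = this
  have "partition_on (jS ` red_labels \<Gamma> \<union> jT ` yellow_labels \<Gamma>) (induced_map \<Gamma> jS jT ` verts \<Gamma>)"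
    using part(1)[OF P(1)] by (simp add: RY)
  moreover have "partition_on (jS ` red_labels \<Gamma>) (induced_map \<Gamma> jS jT ` red_edges \<Gamma>)"
    using part(1)[OF P(2)] by (simp add: R)
  moreover have "partition_on (jT ` yellow_labels \<Gamma>) (induced_map \<Gamma> jS jT ` yellow_edges \<Gamma>)"
    using part(1)[OF P(4)] by (simp add: Y)
  ultimately show ?thesis
    using assms(4) bigraphD(1,2)[OF assms(1)] c[OF P(2) _ P(3)] c[OF P(4) _ P(5)]
    unfolding bigraph_def relabel_simps by (intro conjI finite_imageI) auto
qed

lemma relabel_invariants:
  assumes "bigraph \<Gamma>" "inj_on jS (red_labels \<Gamma>)" "inj_on jT (yellow_labels \<Gamma>)"
    "jS ` red_labels \<Gamma> \<inter> jT ` yellow_labels \<Gamma> = {}"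
  shows "euler_char (relabel \<Gamma> jS jT) = euler_char \<Gamma>"
    and "\<And>v. v \<in> verts \<Gamma> \<Longrightarrow> bidegree (relabel \<Gamma> jS jT) (induced_map \<Gamma> jS jT v) = bidegree \<Gamma> v"
    and "(\<Prod>v\<in>verts (relabel \<Gamma> jS jT). f (bidegree (relabel \<Gamma> jS jT) v)) = (\<Prod>v\<in>verts \<Gamma>. f (bidegree \<Gamma> v))"
proof -
  note inj = induced_map_inj[OF assms]
  have sub: "P \<subseteq> Pow (red_labels \<Gamma> \<union> yellow_labels \<Gamma>)" if "P \<in> {verts \<Gamma>, red_edges \<Gamma>, yellow_edges \<Gamma>}" for P
    using that bigraphD(4-6)[OF assms(1)] by auto
  have "card (induced_map \<Gamma> jS jT ` P) = card P" if "P \<in> {verts \<Gamma>, red_edges \<Gamma>, yellow_edges \<Gamma>}" for P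
    by (rule card_image[OF inj_on_subset[OF inj sub[OF that]]])
  then show "euler_char (relabel \<Gamma> jS jT) = euler_char \<Gamma>"
    by (simp add: euler_char_def)
  show bd: "bidegree (relabel \<Gamma> jS jT) (induced_map \<Gamma> jS jT v) = bidegree \<Gamma> v" for v
  proof -
    have "induced_map \<Gamma> jS jT v \<inter> jS ` red_labels \<Gamma> = jS ` (v \<inter> red_labels \<Gamma>)"
      "induced_map \<Gamma> jS jT v \<inter> jT ` yellow_labels \<Gamma> = jT ` (v \<inter> yellow_labels \<Gamma>)"
      using assms(4) by (auto simp: induced_map_def)
    moreover have "card (jS ` (v \<inter> red_labels \<Gamma>)) = card (v \<inter> red_labels \<Gamma>)"
      "card (jT ` (v \<inter> yellow_labels \<Gamma>)) = card (v \<inter> yellow_labels \<Gamma>)"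
      using assms(2,3) by (auto intro!: card_image intro: inj_on_subset)
    ultimately show ?thesis by (simp add: bidegree_def)
  qed
  show "(\<Prod>v\<in>verts (relabel \<Gamma> jS jT). f (bidegree (relabel \<Gamma> jS jT) v)) = (\<Prod>v\<in>verts \<Gamma>. f (bidegree \<Gamma> v))"
    by (simp add: prod.reindex[OF inj_on_subset[OF inj sub]] bd)
qed

lemma relabel_comp:
  assumes "jS ` red_labels \<Gamma> \<inter> jT ` yellow_labels \<Gamma> = {}"
  shows "relabel (relabel \<Gamma> jS jT) gS gT = relabel \<Gamma> (gS \<circ> jS) (gT \<circ> jT)"
proof -
  have "induced_map (relabel \<Gamma> jS jT) gS gT (induced_map \<Gamma> jS jT X) = induced_map \<Gamma> (gS \<circ> jS) (gT \<circ> jT) X" for X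
  proof -
    have "induced_map \<Gamma> jS jT X \<inter> jS ` red_labels \<Gamma> = jS ` (X \<inter> red_labels \<Gamma>)"
      "induced_map \<Gamma> jS jT X \<inter> jT ` yellow_labels \<Gamma> = jT ` (X \<inter> yellow_labels \<Gamma>)"
      using assms by (auto simp: induced_map_def)
    then show ?thesis by (simp add: induced_map_def[of "relabel \<Gamma> jS jT"] image_comp induced_map_def[of \<Gamma> "gS \<circ> jS"])
  qed
  then show ?thesis
    unfolding relabel_def[of "relabel \<Gamma> jS jT"] relabel_def[of \<Gamma> "gS \<circ> jS"] by (simp add: image_image)
qed

lemma relabel_cong:
  assumes "\<And>x. x \<in> red_labels \<Gamma> \<Longrightarrow> jS x = gS x" "\<And>x. x \<in> yellow_labels \<Gamma> \<Longrightarrow> jT x = gT x"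
  shows "relabel \<Gamma> jS jT = relabel \<Gamma> gS gT"
proof -
  have "induced_map \<Gamma> jS jT X = induced_map \<Gamma> gS gT X" for X
    unfolding induced_map_def using assms by (intro arg_cong2[of _ _ _ _ "(\<union>)"] image_cong) auto
  moreover have "jS ` red_labels \<Gamma> = gS ` red_labels \<Gamma>" "jT ` yellow_labels \<Gamma> = gT ` yellow_labels \<Gamma>"
    using assms by (auto intro!: image_cong)
  ultimately show ?thesis by (simp add: relabel_def)
qed

lemma relabel_ident:
  assumes "bigraph \<Gamma>"
  shows "relabel \<Gamma> (\<lambda>x. x) (\<lambda>x. x) = \<Gamma>"
proof -
  have "induced_map \<Gamma> (\<lambda>x. x) (\<lambda>x. x) X = X" if "X \<subseteq> red_labels \<Gamma> \<union> yellow_labels \<Gamma>" for X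
    using that by (auto simp: induced_map_def)
  then have "induced_map \<Gamma> (\<lambda>x. x) (\<lambda>x. x) ` P = P" if "P \<subseteq> Pow (red_labels \<Gamma> \<union> yellow_labels \<Gamma>)" for P
    using that by (subst image_cong[of P P _ "\<lambda>x. x"]) auto
  then show ?thesis using bigraphD(4-6)[OF assms] by (simp add: relabel_def le_supI1 le_supI2 Pow_mono subset_trans)
qed

lemma isosE:
  assumes "(jS, jT) \<in> isos \<Gamma>1 \<Gamma>2" "bigraph \<Gamma>2"
  shows "inj_on jS (red_labels \<Gamma>1)" "inj_on jT (yellow_labels \<Gamma>1)"
    "jS ` red_labels \<Gamma>1 = red_labels \<Gamma>2" "jT ` yellow_labels \<Gamma>1 = yellow_labels \<Gamma>2"
    "jS ` red_labels \<Gamma>1 \<inter> jT ` yellow_labels \<Gamma>1 = {}" "relabel \<Gamma>1 jS jT = \<Gamma>2"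
proof -
  have j: "jS \<in> ext_bijs (red_labels \<Gamma>1) (red_labels \<Gamma>2)" "jT \<in> ext_bijs (yellow_labels \<Gamma>1) (yellow_labels \<Gamma>2)"
    and "relabel \<Gamma>1 jS jT = \<Gamma>2"
    using assms(1) unfolding isos_eq_relabel by blast+
  then show "relabel \<Gamma>1 jS jT = \<Gamma>2" by blast
  show "inj_on jS (red_labels \<Gamma>1)" "inj_on jT (yellow_labels \<Gamma>1)"
    and im: "jS ` red_labels \<Gamma>1 = red_labels \<Gamma>2" "jT ` yellow_labels \<Gamma>1 = yellow_labels \<Gamma>2"
    using j by (simp_all add: ext_bijs_def bij_betw_def)
  show "jS ` red_labels \<Gamma>1 \<inter> jT ` yellow_labels \<Gamma>1 = {}"
    unfolding im by (rule bigraphD(3)[OF assms(2)])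
qed

lemma isos_comp:
  assumes "bigraph \<Gamma>2" "(jS, jT) \<in> isos \<Gamma>1 \<Gamma>2" "(gS, gT) \<in> isos \<Gamma>2 \<Gamma>3"
  shows "(compose (red_labels \<Gamma>1) gS jS, compose (yellow_labels \<Gamma>1) gT jT) \<in> isos \<Gamma>1 \<Gamma>3"
proof -
  have "relabel \<Gamma>1 (compose (red_labels \<Gamma>1) gS jS) (compose (yellow_labels \<Gamma>1) gT jT)
      = relabel \<Gamma>1 (gS \<circ> jS) (gT \<circ> jT)"
    by (rule relabel_cong) (auto simp: compose_def)
  also have "\<dots> = relabel \<Gamma>2 gS gT"
    using relabel_comp[OF isosE(5)[OF assms(2,1)], of gS gT] isosE(6)[OF assms(2,1)] by simp
  also have "\<dots> = \<Gamma>3" using assms(3) by (simp add: isos_eq_relabel)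
  finally show ?thesis
    using assms(2,3) by (auto simp: isos_eq_relabel ext_bijs_def intro: bij_betw_compose)
qed

lemma isos_inverse:
  assumes "bigraph \<Gamma>1" "bigraph \<Gamma>2" "(jS, jT) \<in> isos \<Gamma>1 \<Gamma>2"
  shows "isos \<Gamma>2 \<Gamma>1 \<noteq> {}"
proof -
  let ?iS = "restrict (inv_into (red_labels \<Gamma>1) jS) (red_labels \<Gamma>2)"
  let ?iT = "restrict (inv_into (yellow_labels \<Gamma>1) jT) (yellow_labels \<Gamma>2)"
  note E = isosE[OF assms(3,2)]
  have "relabel \<Gamma>2 ?iS ?iT = relabel \<Gamma>1 (?iS \<circ> jS) (?iT \<circ> jT)"
    using relabel_comp[OF E(5), of ?iS ?iT] unfolding E(6) .
  also have "\<dots> = relabel \<Gamma>1 (\<lambda>x. x) (\<lambda>x. x)"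
    using E(1-4) by (intro relabel_cong) auto
  also have "\<dots> = \<Gamma>1" by (rule relabel_ident[OF assms(1)])
  finally have "(?iS, ?iT) \<in> isos \<Gamma>2 \<Gamma>1"
    using assms(3) by (auto simp: isos_eq_relabel ext_bijs_def bij_betw_restrict_eq intro: bij_betw_inv_into)
  then show ?thesis by blast
qed

lemma isos_finite: "bigraph \<Gamma>1 \<Longrightarrow> bigraph \<Gamma>2 \<Longrightarrow> finite (isos \<Gamma>1 \<Gamma>2)"
proof -
  assume b: "bigraph \<Gamma>1" "bigraph \<Gamma>2"
  have "isos \<Gamma>1 \<Gamma>2 \<subseteq> ext_bijs (red_labels \<Gamma>1) (red_labels \<Gamma>2) \<times> ext_bijs (yellow_labels \<Gamma>1) (yellow_labels \<Gamma>2)"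
    unfolding isos_eq_relabel by blast
  moreover have "finite (ext_bijs (red_labels \<Gamma>1) (red_labels \<Gamma>2) \<times> ext_bijs (yellow_labels \<Gamma>1) (yellow_labels \<Gamma>2))"
    by (intro finite_cartesian_product ext_bijs_finite bigraphD b)
  ultimately show ?thesis by (rule finite_subset)
qed

text \<open>Composition with a fixed isomorphism is injective. Used once with an isomorphism and
  once with one in the opposite direction, this shows that every nonempty isomorphism set out of a
  graph is as large as its automorphism group, without any group theory.\<close>

lemma card_isos_le:
  assumes "bigraph \<Gamma>1" "bigraph \<Gamma>2" "bigraph \<Gamma>3" "(gS, gT) \<in> isos \<Gamma>2 \<Gamma>3"
  shows "card (isos \<Gamma>1 \<Gamma>2) \<le> card (isos \<Gamma>1 \<Gamma>3)"
proof (rule card_inj_on_le)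
  let ?c = "\<lambda>(jS, jT). (compose (red_labels \<Gamma>1) gS jS, compose (yellow_labels \<Gamma>1) gT jT)"
  show "?c ` isos \<Gamma>1 \<Gamma>2 \<subseteq> isos \<Gamma>1 \<Gamma>3"
    using isos_comp[OF assms(2) _ assms(4)] by auto
  have *: "f = f'" if "f \<in> ext_bijs A B" "f' \<in> ext_bijs A B" "inj_on g B" "compose A g f = compose A g f'"
    for f f' :: "'a \<Rightarrow> 'b" and g :: "'b \<Rightarrow> 'c" and A B
  proof (rule extensionalityI)
    show "f \<in> extensional A" "f' \<in> extensional A" using that by (auto simp: ext_bijs_def)
    fix x assume x: "x \<in> A"
    then have "g (f x) = g (f' x)" using fun_cong[OF that(4), of x] by (simp add: compose_def)
    moreover have "f x \<in> B" "f' x \<in> B" using that x by (auto simp: ext_bijs_def bij_betw_def)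
    ultimately show "f x = f' x" using that(3) by (auto simp: inj_on_def)
  qed
  show "inj_on ?c (isos \<Gamma>1 \<Gamma>2)"
    using isosE(1,2)[OF assms(4,3)] by (auto simp: inj_on_def[of ?c] isos_eq_relabel intro: *)
  show "finite (isos \<Gamma>1 \<Gamma>3)" by (rule isos_finite[OF assms(1,3)])
qed

lemma iso_rel_sym: "(\<Gamma>1, \<Gamma>2) \<in> iso_rel \<Longrightarrow> (\<Gamma>2, \<Gamma>1) \<in> iso_rel"
proof -
  assume "(\<Gamma>1, \<Gamma>2) \<in> iso_rel"
  then obtain jS jT where b: "bigraph \<Gamma>1" "bigraph \<Gamma>2" "(jS, jT) \<in> isos \<Gamma>1 \<Gamma>2"
    by (auto simp: iso_rel_def)
  with isos_inverse[OF b] show "(\<Gamma>2, \<Gamma>1) \<in> iso_rel" by (simp add: iso_rel_def)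
qed

lemma iso_rel_trans: "(\<Gamma>1, \<Gamma>2) \<in> iso_rel \<Longrightarrow> (\<Gamma>2, \<Gamma>3) \<in> iso_rel \<Longrightarrow> (\<Gamma>1, \<Gamma>3) \<in> iso_rel"
proof -
  assume "(\<Gamma>1, \<Gamma>2) \<in> iso_rel" "(\<Gamma>2, \<Gamma>3) \<in> iso_rel"
  then obtain jS jT gS gT where "bigraph \<Gamma>1" "bigraph \<Gamma>2" "bigraph \<Gamma>3" "(jS, jT) \<in> isos \<Gamma>1 \<Gamma>2" "(gS, gT) \<in> isos \<Gamma>2 \<Gamma>3"
    by (auto simp: iso_rel_def)
  with isos_comp[OF this(2,4,5)] show "(\<Gamma>1, \<Gamma>3) \<in> iso_rel" by (auto simp: iso_rel_def)
qed

lemma iso_rel_refl: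
  assumes "bigraph \<Gamma>"
  shows "(\<Gamma>, \<Gamma>) \<in> iso_rel"
proof -
  have "relabel \<Gamma> (restrict (\<lambda>x. x) (red_labels \<Gamma>)) (restrict (\<lambda>x. x) (yellow_labels \<Gamma>)) = relabel \<Gamma> (\<lambda>x. x) (\<lambda>x. x)"
    by (rule relabel_cong) auto
  with relabel_ident[OF assms]
  have "(restrict (\<lambda>x. x) (red_labels \<Gamma>), restrict (\<lambda>x. x) (yellow_labels \<Gamma>)) \<in> isos \<Gamma> \<Gamma>"
    by (auto simp: isos_eq_relabel ext_bijs_def bij_betw_def inj_on_def)
  then show ?thesis using assms by (auto simp: iso_rel_def)
qed

lemma card_isos_eq:
  assumes "(\<Gamma>, \<Gamma>') \<in> iso_rel"
  shows "card (isos \<Gamma> \<Gamma>') = card (automorphisms \<Gamma>)"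
proof -
  obtain jS jT gS gT where "bigraph \<Gamma>" "bigraph \<Gamma>'" "(jS, jT) \<in> isos \<Gamma> \<Gamma>'" "(gS, gT) \<in> isos \<Gamma>' \<Gamma>"
    using assms iso_rel_sym[OF assms] by (auto simp: iso_rel_def)
  then show ?thesis by (intro antisym card_isos_le)
qed

text \<open>Orbit-stabiliser theorem. The s! t! pairs of bijections onto \<open>S\<close> and
  \<open>T\<close> are distributed by \<open>relabel\<close> over the graphs in \<open>Y\<close>,
  and the fibre over each of them is an isomorphism set, of the size of the automorphism
  group.\<close>

lemma orbit_count:
  assumes "bigraph \<Gamma>" and S: "finite S" "card S = card (red_labels \<Gamma>)"
    and T: "finite T" "card T = card (yellow_labels \<Gamma>)" and "S \<inter> T = {}"
  defines "Y \<equiv> {\<Gamma>'. (\<Gamma>, \<Gamma>') \<in> iso_rel \<and> red_labels \<Gamma>' = S \<and> yellow_labels \<Gamma>' = T}"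
  shows "finite Y" "card Y * card (automorphisms \<Gamma>) = fact (card S) * fact (card T)"
proof -
  let ?B = "ext_bijs (red_labels \<Gamma>) S \<times> ext_bijs (yellow_labels \<Gamma>) T"
  let ?r = "\<lambda>(jS, jT). relabel \<Gamma> jS jT"
  note fin = bigraphD(1,2)[OF assms(1)]
  have finB: "finite ?B" using fin S T by (intro finite_cartesian_product ext_bijs_finite)
  have fib: "{x \<in> ?B. ?r x = \<Gamma>'} = isos \<Gamma> \<Gamma>'" if "\<Gamma>' \<in> Y" for \<Gamma>'
    using that by (auto simp: isos_eq_relabel Y_def)
  have sub: "?r ` ?B \<subseteq> Y"
  proof safe
    fix jS jT assume j: "jS \<in> ext_bijs (red_labels \<Gamma>) S" "jT \<in> ext_bijs (yellow_labels \<Gamma>) T"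
    then have "bigraph (relabel \<Gamma> jS jT)"
      using assms(1,6) by (intro bigraph_relabel) (auto simp: ext_bijs_def bij_betw_def)
    moreover have "(jS, jT) \<in> isos \<Gamma> (relabel \<Gamma> jS jT)"
      using j by (auto simp: isos_eq_relabel ext_bijs_def bij_betw_def)
    ultimately show "relabel \<Gamma> jS jT \<in> Y"
      using j assms(1) by (auto simp: Y_def iso_rel_def ext_bijs_def bij_betw_def)
  qed
  have "Y \<subseteq> ?r ` ?B"
  proof
    fix \<Gamma>' assume Y: "\<Gamma>' \<in> Y"
    then obtain x where "x \<in> isos \<Gamma> \<Gamma>'" by (auto simp: Y_def iso_rel_def)
    then have "x \<in> ?B" "?r x = \<Gamma>'" using fib[OF Y] by blast+
    then show "\<Gamma>' \<in> ?r ` ?B" by blast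
  qed
  then show finY: "finite Y" using finB finite_surj by blast
  have "card ?B = (\<Sum>\<Gamma>'\<in>Y. card {x \<in> ?B. ?r x = \<Gamma>'})"
    using sum.group[OF finB finY sub, of "\<lambda>_. 1::nat"] by simp
  also have "\<dots> = (\<Sum>\<Gamma>'\<in>Y. card (automorphisms \<Gamma>))"
    using fib by (intro sum.cong) (auto simp: card_isos_eq Y_def)
  finally have "card Y * card (automorphisms \<Gamma>) = card ?B" by simp
  also have "\<dots> = fact (card S) * fact (card T)"
    unfolding card_cartesian_product using fin S T by (simp add: card_ext_bijs)
  finally show "card Y * card (automorphisms \<Gamma>) = fact (card S) * fact (card T)" .
qed

definition weight :: "(nat \<Rightarrow> nat \<Rightarrow> real) \<Rightarrow> 'h bigraph \<Rightarrow> real" where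
  "weight \<Lambda> \<Gamma> = (\<Prod>v\<in>verts \<Gamma>. case bidegree \<Gamma> v of (u, w) \<Rightarrow> \<Lambda> u w)"

lemma iso_rel_invariants:
  assumes "(\<Gamma>, \<Gamma>') \<in> iso_rel"
  shows "weight \<Lambda> \<Gamma>' = weight \<Lambda> \<Gamma>" "euler_char \<Gamma>' = euler_char \<Gamma>"
    "(\<forall>v\<in>verts \<Gamma>'. vertex_degree \<Gamma>' v = k) \<longleftrightarrow> (\<forall>v\<in>verts \<Gamma>. vertex_degree \<Gamma> v = k)"
    "card (red_labels \<Gamma>') = card (red_labels \<Gamma>)" "card (yellow_labels \<Gamma>') = card (yellow_labels \<Gamma>)"
proof -
  obtain jS jT where b: "bigraph \<Gamma>" "bigraph \<Gamma>'" and j: "(jS, jT) \<in> isos \<Gamma> \<Gamma>'"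
    using assms by (auto simp: iso_rel_def)
  note E = isosE[OF j b(2)]
  show "weight \<Lambda> \<Gamma>' = weight \<Lambda> \<Gamma>"
    using relabel_invariants(3)[OF b(1) E(1,2,5), of "\<lambda>(u, w). \<Lambda> u w"] unfolding E(6) weight_def .
  show "euler_char \<Gamma>' = euler_char \<Gamma>"
    using relabel_invariants(1)[OF b(1) E(1,2,5)] unfolding E(6) .
  have "verts \<Gamma>' = induced_map \<Gamma> jS jT ` verts \<Gamma>" by (simp flip: E(6))
  moreover have "bidegree \<Gamma>' (induced_map \<Gamma> jS jT v) = bidegree \<Gamma> v" if "v \<in> verts \<Gamma>" for v
    using relabel_invariants(2)[OF b(1) E(1,2,5) that] unfolding E(6) .
  ultimately show "(\<forall>v\<in>verts \<Gamma>'. vertex_degree \<Gamma>' v = k) \<longleftrightarrow> (\<forall>v\<in>verts \<Gamma>. vertex_degree \<Gamma> v = k)"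
    by (simp add: vertex_degree_def)
  show "card (red_labels \<Gamma>') = card (red_labels \<Gamma>)" "card (yellow_labels \<Gamma>') = card (yellow_labels \<Gamma>)"
    using card_image[OF E(1)] card_image[OF E(2)] unfolding E(3,4) by simp_all
qed

section \<open>Regular graphs on canonical label sets\<close>

definition regular_graphs :: "nat \<Rightarrow> int \<Rightarrow> 'h bigraph set" where
  "regular_graphs k c = {\<Gamma>. bigraph \<Gamma> \<and> (\<forall>v\<in>verts \<Gamma>. vertex_degree \<Gamma> v = k) \<and> euler_char \<Gamma> = c}"

lemma bigraph_uniform_partitions:
  "bigraph \<Gamma> \<and> (\<forall>v\<in>verts \<Gamma>. vertex_degree \<Gamma> v = k) \<longleftrightarrow>
    finite (red_labels \<Gamma>) \<and> finite (yellow_labels \<Gamma>) \<and> red_labels \<Gamma> \<inter> yellow_labels \<Gamma> = {} \<and>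
    verts \<Gamma> \<in> uniform_partitions k (red_labels \<Gamma> \<union> yellow_labels \<Gamma>) \<and>
    red_edges \<Gamma> \<in> uniform_partitions 2 (red_labels \<Gamma>) \<and> yellow_edges \<Gamma> \<in> uniform_partitions 2 (yellow_labels \<Gamma>)"
proof -
  have "vertex_degree \<Gamma> v = card v"
    if "finite (red_labels \<Gamma>)" "finite (yellow_labels \<Gamma>)" "red_labels \<Gamma> \<inter> yellow_labels \<Gamma> = {}"
      "v \<subseteq> red_labels \<Gamma> \<union> yellow_labels \<Gamma>" for v
  proof -
    have "v = (v \<inter> red_labels \<Gamma>) \<union> (v \<inter> yellow_labels \<Gamma>)" using that(4) by auto
    moreover have "card ((v \<inter> red_labels \<Gamma>) \<union> (v \<inter> yellow_labels \<Gamma>)) = vertex_degree \<Gamma> v"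
      unfolding vertex_degree_def bidegree_def fst_conv snd_conv
      using that(1-3) by (intro card_Un_disjoint) auto
    ultimately show ?thesis by simp
  qed
  moreover have "v \<subseteq> A" if "partition_on A P" "v \<in> P" for v P and A :: "'a set"
    using partition_onD1[OF that(1)] that(2) by blast
  ultimately have "(\<forall>v\<in>verts \<Gamma>. vertex_degree \<Gamma> v = k) \<longleftrightarrow> (\<forall>v\<in>verts \<Gamma>. card v = k)"
    if "finite (red_labels \<Gamma>)" "finite (yellow_labels \<Gamma>)" "red_labels \<Gamma> \<inter> yellow_labels \<Gamma> = {}"
      "partition_on (red_labels \<Gamma> \<union> yellow_labels \<Gamma>) (verts \<Gamma>)"
    using that by (intro ball_cong refl) simp
  then show ?thesis
    unfolding bigraph_def uniform_partitions_def mem_Collect_eq by meson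
qed

text \<open>Handshake count: the number of labels is both k |V| and 2 |E|, and |V| - |E| =
  -n.\<close>

lemma regular_graphs_card:
  assumes "\<Gamma> \<in> regular_graphs k (- int n)" "k \<ge> 2"
  shows "card (red_labels \<Gamma>) + card (yellow_labels \<Gamma>) = k * card (verts \<Gamma>)"
    "(k - 2) * card (verts \<Gamma>) = 2 * n"
proof -
  have g: "finite (red_labels \<Gamma>)" "finite (yellow_labels \<Gamma>)" "red_labels \<Gamma> \<inter> yellow_labels \<Gamma> = {}"
    "verts \<Gamma> \<in> uniform_partitions k (red_labels \<Gamma> \<union> yellow_labels \<Gamma>)"
    "red_edges \<Gamma> \<in> uniform_partitions 2 (red_labels \<Gamma>)" "yellow_edges \<Gamma> \<in> uniform_partitions 2 (yellow_labels \<Gamma>)"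
    using assms(1) bigraph_uniform_partitions[of \<Gamma> k] unfolding regular_graphs_def by auto
  show 1: "card (red_labels \<Gamma>) + card (yellow_labels \<Gamma>) = k * card (verts \<Gamma>)"
    using card_uniform_partitions[OF _ g(4)] g(1-3) by (simp add: card_Un_disjoint)
  have "euler_char \<Gamma> = - int n" using assms(1) by (simp add: regular_graphs_def)
  moreover have "2 * euler_char \<Gamma> = 2 * int (card (verts \<Gamma>)) - int (k * card (verts \<Gamma>))"
    unfolding 1[symmetric] euler_char_def using card_uniform_partitions[OF g(1,5)] card_uniform_partitions[OF g(2,6)] by simp
  ultimately have "int ((k - 2) * card (verts \<Gamma>)) = int (2 * n)"
    using assms(2) by (simp add: of_nat_diff algebra_simps)
  then show "(k - 2) * card (verts \<Gamma>) = 2 * n" by (simp only: of_nat_eq_iff)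
qed

text \<open>One choice of label sets for each number \<open>s\<close> of red labels. A class whose
  graphs have N labels in all meets exactly one of these choices, which makes the sum over classes a
  finite sum over labelled graphs.\<close>

definition canonical_graphs :: "nat \<Rightarrow> nat \<Rightarrow> nat \<Rightarrow> nat bigraph set" where
  "canonical_graphs k N s =
    (\<lambda>(P, E, F). \<lparr>red_labels = {..<s}, yellow_labels = {s..<N}, verts = P, red_edges = E, yellow_edges = F\<rparr>)
      ` (uniform_partitions k {..<N} \<times> uniform_partitions 2 {..<s} \<times> uniform_partitions 2 {s..<N})"

lemma canonical_graphs_eq:
  assumes "k \<ge> 3" "(k - 2) * m = 2 * n" "s \<le> k * m"
  shows "canonical_graphs k (k * m) s =
    {\<Gamma> \<in> regular_graphs k (- int n). red_labels \<Gamma> = {..<s} \<and> yellow_labels \<Gamma> = {s..<k * m}}"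
proof -
  have U: "{..<s} \<union> {s..<k * m} = {..<k * m}" using assms(3) by auto
  have 1: "\<Gamma> \<in> canonical_graphs k (k * m) s \<longleftrightarrow>
      verts \<Gamma> \<in> uniform_partitions k {..<k * m} \<and> red_edges \<Gamma> \<in> uniform_partitions 2 {..<s} \<and> yellow_edges \<Gamma> \<in> uniform_partitions 2 {s..<k * m} \<and>
      red_labels \<Gamma> = {..<s} \<and> yellow_labels \<Gamma> = {s..<k * m}" for \<Gamma>
    unfolding canonical_graphs_def by (cases \<Gamma>) (auto simp: image_iff)
  have 2: "euler_char \<Gamma> = - int n"
    if "verts \<Gamma> \<in> uniform_partitions k {..<k * m}" "red_edges \<Gamma> \<in> uniform_partitions 2 {..<s}" "yellow_edges \<Gamma> \<in> uniform_partitions 2 {s..<k * m}" for \<Gamma> :: "nat bigraph"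
  proof -
    have "k * m = k * card (verts \<Gamma>)" "s = 2 * card (red_edges \<Gamma>)" "k * m - s = 2 * card (yellow_edges \<Gamma>)"
      using card_uniform_partitions[OF _ that(1)] card_uniform_partitions[OF _ that(2)] card_uniform_partitions[OF _ that(3)] by simp_all
    then have c: "card (verts \<Gamma>) = m" "2 * (card (red_edges \<Gamma>) + card (yellow_edges \<Gamma>)) = k * m"
      using assms by auto
    have "int (k - 2) * int m = 2 * int n" unfolding of_nat_mult[symmetric] assms(2) by simp
    then have "int k * int m - 2 * int m = 2 * int n" using assms(1) by (simp add: of_nat_diff algebra_simps)
    moreover have "2 * (int (card (red_edges \<Gamma>)) + int (card (yellow_edges \<Gamma>))) = int k * int m"
      using arg_cong[OF c(2), of int] by simp
    ultimately show ?thesis unfolding euler_char_def c(1) by simp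
  qed
  have 3: "bigraph \<Gamma> \<and> (\<forall>v\<in>verts \<Gamma>. vertex_degree \<Gamma> v = k) \<longleftrightarrow>
      verts \<Gamma> \<in> uniform_partitions k {..<k * m} \<and> red_edges \<Gamma> \<in> uniform_partitions 2 {..<s} \<and> yellow_edges \<Gamma> \<in> uniform_partitions 2 {s..<k * m}"
    if "red_labels \<Gamma> = {..<s}" "yellow_labels \<Gamma> = {s..<k * m}" for \<Gamma>
    unfolding bigraph_uniform_partitions that U by auto
  show ?thesis
  proof (rule set_eqI)
    fix \<Gamma> :: "nat bigraph"
    show "\<Gamma> \<in> canonical_graphs k (k * m) s \<longleftrightarrow>
        \<Gamma> \<in> {\<Gamma> \<in> regular_graphs k (- int n). red_labels \<Gamma> = {..<s} \<and> yellow_labels \<Gamma> = {s..<k * m}}"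
      using 1[of \<Gamma>] 2[of \<Gamma>] 3[of \<Gamma>] unfolding regular_graphs_def mem_Collect_eq by blast
  qed
qed

lemma canonical_graphs_sum:
  assumes "s \<le> N"
  shows "finite (canonical_graphs k N s)"
    "(\<Sum>\<Gamma>\<in>canonical_graphs k N s. weight \<Lambda> \<Gamma>) = real (pairings s) * real (pairings (N - s)) *
       partition_sum k (\<lambda>B. \<Lambda> (card (B \<inter> {..<s})) (card (B \<inter> {s..<N}))) ({..<s} \<union> {s..<N})"
proof -
  show "finite (canonical_graphs k N s)"
    unfolding canonical_graphs_def by (intro finite_imageI finite_cartesian_product finite_uniform_partitions) auto
  have U: "{..<s} \<union> {s..<N} = {..<N}" using assms by auto
  have "(\<Sum>\<Gamma>\<in>canonical_graphs k N s. weight \<Lambda> \<Gamma>) =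
      (\<Sum>(P, E, F)\<in>uniform_partitions k {..<N} \<times> uniform_partitions 2 {..<s} \<times> uniform_partitions 2 {s..<N}.
        \<Prod>B\<in>P. \<Lambda> (card (B \<inter> {..<s})) (card (B \<inter> {s..<N})))"
    unfolding canonical_graphs_def
    by (subst sum.reindex) (auto simp: inj_on_def weight_def bidegree_def intro!: sum.cong)
  also have "\<dots> = (\<Sum>P\<in>uniform_partitions k {..<N}. \<Sum>(E, F)\<in>uniform_partitions 2 {..<s} \<times> uniform_partitions 2 {s..<N}.
        \<Prod>B\<in>P. \<Lambda> (card (B \<inter> {..<s})) (card (B \<inter> {s..<N})))"
    by (subst sum.cartesian_product) (simp add: case_prod_unfold)
  also have "\<dots> = real (pairings s) * real (pairings (N - s)) *
       partition_sum k (\<lambda>B. \<Lambda> (card (B \<inter> {..<s})) (card (B \<inter> {s..<N}))) {..<N}"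
    by (simp add: case_prod_unfold card_cartesian_product card_uniform_partitions_2 partition_sum_def sum_distrib_left)
  finally show "(\<Sum>\<Gamma>\<in>canonical_graphs k N s. weight \<Lambda> \<Gamma>) = real (pairings s) * real (pairings (N - s)) *
       partition_sum k (\<lambda>B. \<Lambda> (card (B \<inter> {..<s})) (card (B \<inter> {s..<N}))) ({..<s} \<union> {s..<N})"
    unfolding U .
qed

lemma graph_sum_eq_0:
  assumes "k \<ge> 3" "\<not> (k - 2) dvd 2 * n"
  shows "graph_sum k \<Lambda> n = 0"
proof -
  have "(regular_graphs k (- int n) :: nat bigraph set) = {}"
  proof (rule equals0I)
    fix \<Gamma> :: "nat bigraph" assume "\<Gamma> \<in> regular_graphs k (- int n)"
    then have "(k - 2) * card (verts \<Gamma>) = 2 * n" using assms(1) by (intro regular_graphs_card(2)) auto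
    then show False using assms(2) by (metis dvd_triv_left)
  qed
  then have "graph_classes k (- int n) = {}"
    by (simp add: graph_classes_def regular_graphs_def quotient_def)
  then show ?thesis by (simp add: graph_sum_def)
qed

text \<open>By \<open>orbit_count\<close> a class with s red and t yellow labels has s! t! / |Aut|
  members on the canonical label sets. Giving each of them the weight 1 / (s! t!) restores the
  factor 1 / |Aut| of the class.\<close>

lemma graph_sum_labelled:
  assumes "k \<ge> 3" "(k - 2) * m = 2 * n"
  shows "graph_sum k \<Lambda> n = (\<Sum>s\<le>k*m. (\<Sum>\<Gamma>\<in>canonical_graphs k (k*m) s. weight \<Lambda> \<Gamma>) / (fact s * fact (k*m-s)))"
proof -
  let ?N = "k * m" and ?A = "regular_graphs k (- int n) :: nat bigraph set"
  define X where "X = (\<Union>s\<le>?N. canonical_graphs k ?N s)"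
  let ?h = "\<lambda>\<Gamma>. weight \<Lambda> \<Gamma> / (fact (card (red_labels \<Gamma>)) * fact (card (yellow_labels \<Gamma>)))"
  let ?cls = "\<lambda>\<Gamma>. iso_rel `` {\<Gamma>} :: nat bigraph set"
  have can: "canonical_graphs k ?N s = {\<Gamma> \<in> ?A. red_labels \<Gamma> = {..<s} \<and> yellow_labels \<Gamma> = {s..<?N}}"
    if "s \<le> ?N" for s by (rule canonical_graphs_eq[OF assms that])
  have finX: "finite X" unfolding X_def using canonical_graphs_sum(1) by auto
  have tot: "card (red_labels \<Gamma>) + card (yellow_labels \<Gamma>) = ?N" if "\<Gamma> \<in> ?A" for \<Gamma>
  proof -
    have "(k - 2) * card (verts \<Gamma>) = (k - 2) * m"
      using regular_graphs_card(2)[OF that] assms by simp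
    then have "card (verts \<Gamma>) = m" using assms(1) by simp
    then show ?thesis using regular_graphs_card(1)[OF that] assms(1) by simp
  qed
  have Xiff: "\<Gamma> \<in> X \<longleftrightarrow> \<Gamma> \<in> ?A \<and> red_labels \<Gamma> = {..<card (red_labels \<Gamma>)} \<and> yellow_labels \<Gamma> = {card (red_labels \<Gamma>)..<?N}" for \<Gamma>
  proof
    assume "\<Gamma> \<in> X"
    then obtain s where "s \<le> ?N" "\<Gamma> \<in> canonical_graphs k ?N s" by (auto simp: X_def)
    then show "\<Gamma> \<in> ?A \<and> red_labels \<Gamma> = {..<card (red_labels \<Gamma>)} \<and> yellow_labels \<Gamma> = {card (red_labels \<Gamma>)..<?N}"
      by (simp add: can)
  next
    assume a: "\<Gamma> \<in> ?A \<and> red_labels \<Gamma> = {..<card (red_labels \<Gamma>)} \<and> yellow_labels \<Gamma> = {card (red_labels \<Gamma>)..<?N}"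
    then have "card (red_labels \<Gamma>) \<le> ?N" using tot[of \<Gamma>] by linarith
    with a show "\<Gamma> \<in> X" unfolding X_def by (intro UN_I[of "card (red_labels \<Gamma>)"]) (auto simp: can)
  qed
  have clsA: "?cls \<Gamma> \<subseteq> ?A" if "\<Gamma> \<in> ?A" for \<Gamma>
  proof
    fix \<Gamma>' assume "\<Gamma>' \<in> ?cls \<Gamma>"
    then have "(\<Gamma>, \<Gamma>') \<in> iso_rel" by simp
    moreover from this have "bigraph \<Gamma>'" by (simp add: iso_rel_def)
    ultimately show "\<Gamma>' \<in> ?A"
      using that iso_rel_invariants(2,3)[of \<Gamma> \<Gamma>'] by (simp add: regular_graphs_def)
  qed
  have main: "1 / real (card (automorphisms \<Gamma>)) * weight \<Lambda> \<Gamma> = (\<Sum>\<Gamma>' | \<Gamma>' \<in> X \<and> (\<Gamma>, \<Gamma>') \<in> iso_rel. ?h \<Gamma>')"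
    and ne: "\<exists>\<Gamma>'. \<Gamma>' \<in> X \<and> (\<Gamma>, \<Gamma>') \<in> iso_rel"
    if A: "\<Gamma> \<in> ?A" for \<Gamma>
  proof -
    let ?s = "card (red_labels \<Gamma>)" and ?t = "card (yellow_labels \<Gamma>)"
    have b: "bigraph \<Gamma>" using A by (simp add: regular_graphs_def)
    let ?Y = "{\<Gamma>'. (\<Gamma>, \<Gamma>') \<in> iso_rel \<and> red_labels \<Gamma>' = {..<?s} \<and> yellow_labels \<Gamma>' = {?s..<?N}}"
    have "card {?s..<?N} = ?t" using tot[OF A] by simp
    then have Y: "card ?Y * card (automorphisms \<Gamma>) = fact ?s * fact ?t" "finite ?Y"
      using orbit_count[OF b, of "{..<?s}" "{?s..<?N}"] by (simp_all add: ivl_disj_int)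
    \<comment> \<open>Isomorphic graphs have equally many red labels, so within \<open>X\<close> the
      class meets only the label sets belonging to ?s.\<close>
    have XY: "{\<Gamma>'. \<Gamma>' \<in> X \<and> (\<Gamma>, \<Gamma>') \<in> iso_rel} = ?Y"
    proof (rule set_eqI)
      fix \<Gamma>'
      have "\<Gamma>' \<in> X \<longleftrightarrow> red_labels \<Gamma>' = {..<?s} \<and> yellow_labels \<Gamma>' = {?s..<?N}" if "(\<Gamma>, \<Gamma>') \<in> iso_rel"
        using clsA[OF A] that unfolding Xiff iso_rel_invariants(4)[OF that] by blast
      then show "\<Gamma>' \<in> {\<Gamma>'. \<Gamma>' \<in> X \<and> (\<Gamma>, \<Gamma>') \<in> iso_rel} \<longleftrightarrow> \<Gamma>' \<in> ?Y" by auto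
    qed
    have "(\<Sum>\<Gamma>' | \<Gamma>' \<in> X \<and> (\<Gamma>, \<Gamma>') \<in> iso_rel. ?h \<Gamma>') = (\<Sum>\<Gamma>'\<in>?Y. ?h \<Gamma>)"
      unfolding XY
    proof (intro sum.cong refl)
      fix \<Gamma>' assume "\<Gamma>' \<in> ?Y"
      then have "(\<Gamma>, \<Gamma>') \<in> iso_rel" by simp
      note iso_rel_invariants(1,4,5)[OF this]
      then show "?h \<Gamma>' = ?h \<Gamma>" by simp
    qed
    also have "\<dots> = real (card ?Y) * ?h \<Gamma>" by simp
    also have "\<dots> = 1 / real (card (automorphisms \<Gamma>)) * weight \<Lambda> \<Gamma>"
    proof -
      have "real (card ?Y) * real (card (automorphisms \<Gamma>)) = fact ?s * fact ?t"
        using arg_cong[OF Y(1), of real] by (simp only: of_nat_mult of_nat_fact)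
      note F = this[symmetric]
      have "real (card ?Y) * real (card (automorphisms \<Gamma>)) \<noteq> 0" unfolding F[symmetric] by simp
      then show ?thesis unfolding F by (simp del: of_nat_eq_0_iff)
    qed
    finally show "1 / real (card (automorphisms \<Gamma>)) * weight \<Lambda> \<Gamma> = (\<Sum>\<Gamma>' | \<Gamma>' \<in> X \<and> (\<Gamma>, \<Gamma>') \<in> iso_rel. ?h \<Gamma>')" by simp
    \<comment> \<open>A product of factorials is nonzero, so every class does have a member on
      canonical labels.\<close>
    have "card ?Y \<noteq> 0" using Y(1) by (metis fact_nonzero mult_eq_0_iff)
    then have "?Y \<noteq> {}" by (metis card.empty)
    then show "\<exists>\<Gamma>'. \<Gamma>' \<in> X \<and> (\<Gamma>, \<Gamma>') \<in> iso_rel" using XY by blast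
  qed
  have cls_eq: "?cls \<Gamma> = ?cls \<Gamma>' \<longleftrightarrow> (\<Gamma>, \<Gamma>') \<in> iso_rel" if "bigraph \<Gamma>'" for \<Gamma> \<Gamma>'
  proof
    assume "?cls \<Gamma> = ?cls \<Gamma>'"
    then show "(\<Gamma>, \<Gamma>') \<in> iso_rel" using iso_rel_refl[OF that] by blast
  next
    assume "(\<Gamma>, \<Gamma>') \<in> iso_rel"
    then show "?cls \<Gamma> = ?cls \<Gamma>'" using iso_rel_sym iso_rel_trans by blast
  qed
  have XA: "X \<subseteq> ?A" using Xiff by auto
  have classes: "graph_classes k (- int n) = ?cls ` X"
  proof -
    have "graph_classes k (- int n) = ?cls ` ?A"
      by (auto simp: graph_classes_def regular_graphs_def quotient_def)
    also have "\<dots> = ?cls ` X"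
    proof (rule equalityI[OF image_subsetI image_mono[OF XA]])
      fix \<Gamma> assume "\<Gamma> \<in> ?A"
      then obtain \<Gamma>' where "\<Gamma>' \<in> X" "(\<Gamma>, \<Gamma>') \<in> iso_rel" using ne by blast
      moreover from this have "?cls \<Gamma> = ?cls \<Gamma>'" by (subst cls_eq) (auto simp: iso_rel_def)
      ultimately show "?cls \<Gamma> \<in> ?cls ` X" by blast
    qed
    finally show ?thesis .
  qed
  have "graph_sum k \<Lambda> n = (\<Sum>G\<in>?cls ` X. \<Sum>\<Gamma>' | \<Gamma>' \<in> X \<and> ?cls \<Gamma>' = G. ?h \<Gamma>')"
    unfolding graph_sum_def classes
  proof (intro sum.cong refl)
    fix G assume "G \<in> ?cls ` X"
    then obtain \<Gamma> where G: "\<Gamma> \<in> ?A" "G = ?cls \<Gamma>" using XA by auto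
    then have "\<Gamma> \<in> G" using iso_rel_refl by (auto simp: regular_graphs_def)
    then have rG: "representative G \<in> G" unfolding representative_def by (rule someI)
    then have r: "(\<Gamma>, representative G) \<in> iso_rel" "representative G \<in> ?A" using G clsA by auto
    then have "G = ?cls (representative G)" unfolding G(2) by (subst cls_eq) (auto simp: regular_graphs_def)
    then have "(?cls \<Gamma>' = G) = ((representative G, \<Gamma>') \<in> iso_rel)" if "\<Gamma>' \<in> X" for \<Gamma>'
    proof -
      have "bigraph \<Gamma>'" using that XA by (auto simp: regular_graphs_def)
      note cls_eq[OF this, of "representative G"]
      with \<open>G = ?cls (representative G)\<close> show ?thesis by auto
    qed
    then have "{\<Gamma>'. \<Gamma>' \<in> X \<and> ?cls \<Gamma>' = G} = {\<Gamma>'. \<Gamma>' \<in> X \<and> (representative G, \<Gamma>') \<in> iso_rel}" by auto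
    with main[OF r(2)] show "1 / real (card (automorphisms (representative G))) *
        (\<Prod>v\<in>verts (representative G). case bidegree (representative G) v of (u, w) \<Rightarrow> \<Lambda> u w)
        = (\<Sum>\<Gamma>' | \<Gamma>' \<in> X \<and> ?cls \<Gamma>' = G. ?h \<Gamma>')"
      by (simp only: weight_def)
  qed
  also have "\<dots> = sum ?h X"
    by (rule sum.group[OF finX finite_imageI[OF finX] order_refl])
  also have "\<dots> = (\<Sum>s\<le>?N. sum ?h (canonical_graphs k ?N s))"
    unfolding X_def
  proof (intro sum.UNION_disjoint ballI impI)
    fix s s' assume "s \<in> {..?N}" "s' \<in> {..?N}" "s \<noteq> s'"
    then show "canonical_graphs k ?N s \<inter> canonical_graphs k ?N s' = {}" by (auto simp: can)
  qed (auto simp: canonical_graphs_sum(1))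
  also have "\<dots> = (\<Sum>s\<le>?N. (\<Sum>\<Gamma>\<in>canonical_graphs k ?N s. weight \<Lambda> \<Gamma>) / (fact s * fact (?N-s)))"
    unfolding sum_divide_distrib by (intro sum.cong refl) (simp add: can)
  finally show ?thesis .
qed

text \<open>The factorials from \<open>partition_sum_bidegree\<close> cancel those of the labelled
  count. What remains is the coefficient sequence of p^m paired with numbers of matchings, which are
  Gaussian moments. The start \<open>c\<close> of the half circle stays free, so that it can later
  be placed away from the maximisers.\<close>

theorem graph_sum_integral:
  assumes "k \<ge> 3" "(k - 2) * m = 2 * n"
    and p: "degree p \<le> k" "\<And>u. u \<le> k \<Longrightarrow> coeff p u = \<Lambda> u (k - u) / (fact u * fact (k - u))"
  shows "graph_sum k \<Lambda> n = 2 ^ (n + m) * fact (n + m) / (pi * fact m) *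
      integral {c..c+pi} (\<lambda>x. form k p (cos x) (sin x) ^ m)"
proof -
  \<comment> \<open>The number of edges is n + m, half the number of labels; this is the p of
    \<open>form_moments\<close>.\<close>
  have N: "k * m = 2 * (n + m)"
  proof -
    obtain d where "k = 3 + d" using le_Suc_ex[OF assms(1)] by blast
    then show ?thesis using assms(2) by (simp add: algebra_simps)
  qed
  have "graph_sum k \<Lambda> n = (\<Sum>s\<le>k*m. coeff (p ^ m) s * (real (pairings s) * real (pairings (k*m-s))) / fact m)"
    unfolding graph_sum_labelled[OF assms(1,2)]
  proof (intro sum.cong refl)
    fix s assume "s \<in> {..k*m}"
    then have s: "s \<le> k*m" by simp
    have "fact m * partition_sum k (\<lambda>B. \<Lambda> (card (B \<inter> {..<s})) (card (B \<inter> {s..<k*m}))) ({..<s} \<union> {s..<k*m})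
        = fact s * fact (k*m-s) * coeff (p ^ m) s"
      using partition_sum_bidegree[of "{..<s}" "{s..<k*m}" k m p \<Lambda>] s p assms(1) by (simp add: ivl_disj_int)
    then show "(\<Sum>\<Gamma>\<in>canonical_graphs k (k*m) s. weight \<Lambda> \<Gamma>) / (fact s * fact (k*m-s)) =
        coeff (p ^ m) s * (real (pairings s) * real (pairings (k*m-s))) / fact m"
      unfolding canonical_graphs_sum(2)[OF s] by (simp add: field_simps)
  qed
  also have "\<dots> = 2 ^ (n + m) * fact (n + m) / (pi * fact m) *
      integral {c..c+pi} (\<lambda>x. form (k*m) (p ^ m) (cos x) (sin x))"
    unfolding N sum_divide_distrib[symmetric] form_moments[of _ _ c] by simp
  finally show ?thesis by (simp add: form_power[OF p(1)])
qed

section \<open>Laplace's method\<close>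

lemma gaussian_integral:
  fixes \<alpha> :: real
  assumes "\<alpha> > 0"
  shows "has_bochner_integral lborel (\<lambda>y. exp (- (\<alpha> * y\<^sup>2 / 2))) (sqrt (2 * pi / \<alpha>))"
proof -
  define \<sigma> where "\<sigma> = 1 / sqrt \<alpha>"
  have s: "\<sigma> > 0" "\<sigma>\<^sup>2 = 1 / \<alpha>"
    using assms by (auto simp: \<sigma>_def power_divide)
  have "has_bochner_integral lborel (\<lambda>y. sqrt (2 * pi / \<alpha>) * normal_density 0 \<sigma> y) (sqrt (2 * pi / \<alpha>) * 1)"
    using s(1) by (intro has_bochner_integral_mult_right)
      (auto simp: has_bochner_integral_iff integrable_normal_density integral_normal_density)
  moreover have "sqrt (2 * pi / \<alpha>) * normal_density 0 \<sigma> y = exp (- (\<alpha> * y\<^sup>2 / 2))" for y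
    using assms by (auto simp: normal_density_def s(2) field_simps real_sqrt_divide real_sqrt_mult)
  ultimately show ?thesis by simp
qed

text \<open>The substitution u = y / sqrt m turns the integrand into a function of y converging to a
  Gaussian. \<open>bound\<close> gives g u \<le> 1 - \<alpha> u^2 / 4 \<le> exp (- \<alpha> u^2 /
  4), whose m-th power becomes a Gaussian independent of m, so dominated convergence applies. The
  second-order behaviour is expressed by a quotient to spare the users a twice differentiable
  \<open>g\<close>.\<close>

lemma laplace_peak:
  fixes g :: "real \<Rightarrow> real"
  assumes "\<alpha> > 0" "\<delta> > 0"
    and cont: "continuous_on {-\<delta>..\<delta>} g" and g0: "g 0 = 1"
    and lim: "((\<lambda>u. (g u - 1) / u\<^sup>2) \<longlongrightarrow> - \<alpha> / 2) (at 0)"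
    and bound: "\<And>u. \<bar>u\<bar> \<le> \<delta> \<Longrightarrow> u \<noteq> 0 \<Longrightarrow> 0 < g u \<and> (g u - 1) / u\<^sup>2 \<le> - \<alpha> / 4"
  shows "(\<lambda>m. sqrt (real m) * integral {-\<delta>..\<delta>} (\<lambda>u. g u ^ m)) \<longlonglongrightarrow> sqrt (2 * pi / \<alpha>)"
proof -
  \<comment> \<open>Extension by 0 makes the domain of the rescaled integral independent of
    m.\<close>
  define G where "G = (\<lambda>u. if u \<in> {-\<delta>..\<delta>} then g u else 0)"
  have G_meas [measurable]: "G \<in> borel_measurable lborel"
    using borel_measurable_continuous_on_if[OF _ cont, of "\<lambda>_. 0"]
    by (simp add: G_def)
  have G_bound: "0 \<le> G u \<and> G u \<le> exp (- (\<alpha> * u\<^sup>2 / 4))" for u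
  proof (cases "u \<in> {-\<delta>..\<delta>} \<and> u \<noteq> 0")
    case True
    then have "0 < g u" "g u \<le> 1 + - (\<alpha> * u\<^sup>2 / 4)"
      using bound[of u] by (auto simp: field_simps abs_le_iff)
    with exp_ge_add_one_self[of "- (\<alpha> * u\<^sup>2 / 4)"] True show ?thesis
      by (auto simp: G_def)
  next
    case False
    then show ?thesis using g0 by (auto simp: G_def)
  qed
  \<comment> \<open>ln g behaves like g - 1 near 1. The quotient ln g / (g - 1) is meaningful
    because \<open>bound\<close> keeps g u different from 1 for small u \<noteq> 0.\<close>
  have lnlim: "((\<lambda>u. ln (g u) / u\<^sup>2) \<longlongrightarrow> - \<alpha> / 2) (at 0)"
  proof -
    have near: "\<forall>\<^sub>F u in at 0. \<bar>u\<bar> \<le> \<delta> \<and> u \<noteq> 0"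
      using \<open>\<delta> > 0\<close> unfolding eventually_at by (intro exI[of _ \<delta>]) auto
    have "((\<lambda>u. (g u - 1) / u\<^sup>2 * u\<^sup>2) \<longlongrightarrow> - \<alpha> / 2 * 0\<^sup>2) (at 0)"
      by (intro tendsto_mult lim tendsto_power tendsto_ident_at)
    then have "((\<lambda>u. (g u - 1) / u\<^sup>2 * u\<^sup>2) \<longlongrightarrow> 0) (at 0)" by simp
    moreover have "\<forall>\<^sub>F u in at 0. (g u - 1) / u\<^sup>2 * u\<^sup>2 = g u - 1"
      using near by eventually_elim auto
    ultimately have "((\<lambda>u. g u - 1) \<longlongrightarrow> 0) (at 0)"
      by (rule Lim_transform_eventually)
    moreover have "\<forall>\<^sub>F u in at 0. g u - 1 \<noteq> 0"
      using near by eventually_elim (use bound \<open>\<alpha> > 0\<close> in force)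
    ultimately have w: "filterlim (\<lambda>u. g u - 1) (at 0) (at 0)"
      by (auto simp: filterlim_at)
    have "(ln has_field_derivative 1) (at (1::real))"
      by (auto intro!: derivative_eq_intros)
    then have "((\<lambda>w. ln (1 + w) / w) \<longlongrightarrow> (1::real)) (at 0)"
      by (simp add: DERIV_def)
    from filterlim_compose[OF this w]
    have "((\<lambda>u. ln (g u) / (g u - 1)) \<longlongrightarrow> 1) (at 0)" by simp
    from tendsto_mult[OF this lim]
    have "((\<lambda>u. ln (g u) / (g u - 1) * ((g u - 1) / u\<^sup>2)) \<longlongrightarrow> - \<alpha> / 2) (at 0)" by simp
    moreover have "\<forall>\<^sub>F u in at 0. ln (g u) / (g u - 1) * ((g u - 1) / u\<^sup>2) = ln (g u) / u\<^sup>2"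
      using \<open>\<forall>\<^sub>F u in at 0. g u - 1 \<noteq> 0\<close> by eventually_elim auto
    ultimately show ?thesis
      by (rule Lim_transform_eventually)
  qed
  \<comment> \<open>\<open>Suc m\<close> avoids dividing by sqrt 0; \<open>LIMSEQ_imp_Suc\<close>
    removes the shift at the end.\<close>
  define s where "s = (\<lambda>m y. G (y / sqrt (real (Suc m))) ^ Suc m)"
  have lim_s: "(\<lambda>m. s m y) \<longlonglongrightarrow> exp (- (\<alpha> * y\<^sup>2 / 2))" for y
  proof (cases "y = 0")
    case True
    then show ?thesis using \<open>\<delta> > 0\<close> g0 by (simp add: s_def G_def)
  next
    case False
    have "(\<lambda>m. y / sqrt (real (Suc m))) \<longlonglongrightarrow> 0"
      by real_asymp
    then have u: "filterlim (\<lambda>m. y / sqrt (real (Suc m))) (at 0) sequentially"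
      using False by (auto simp: filterlim_at)
    have "(\<lambda>m. exp (y\<^sup>2 * (ln (g (y / sqrt (real (Suc m)))) / (y / sqrt (real (Suc m)))\<^sup>2)))
        \<longlonglongrightarrow> exp (y\<^sup>2 * (- \<alpha> / 2))"
      by (intro tendsto_exp tendsto_mult tendsto_const filterlim_compose[OF lnlim u])
    moreover have "\<forall>\<^sub>F m in sequentially. exp (y\<^sup>2 * (ln (g (y / sqrt (real (Suc m)))) / (y / sqrt (real (Suc m)))\<^sup>2))
        = s m y"
    proof -
      have "\<forall>\<^sub>F m in sequentially. \<bar>y / sqrt (real (Suc m))\<bar> < \<delta>"
        using tendsto_rabs[OF \<open>(\<lambda>m. y / sqrt (real (Suc m))) \<longlonglongrightarrow> 0\<close>] \<open>\<delta> > 0\<close>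
        by (intro order_tendstoD(2)[of _ 0]) simp_all
      then show ?thesis
      proof eventually_elim
        case (elim m)
        define u where "u = y / sqrt (real (Suc m))"
        have "\<bar>u\<bar> \<le> \<delta>" "u \<noteq> 0" using elim False by (auto simp: u_def)
        then have "g u > 0" "G u = g u" using bound[of u] by (auto simp: G_def)
        moreover have "y\<^sup>2 * (ln (g u) / u\<^sup>2) = real (Suc m) * ln (g u)"
          using False by (simp add: u_def power_divide)
        ultimately show ?case
          by (simp add: s_def u_def[symmetric] exp_of_nat_mult del: of_nat_Suc power_Suc)
      qed
    qed
    ultimately show ?thesis
      by (auto intro: Lim_transform_eventually simp: mult.commute)
  qed
  have dom: "norm (s m y) \<le> exp (- (\<alpha> * y\<^sup>2 / 4))" for m y
  proof -
    have "s m y \<le> exp (- (\<alpha> * (y / sqrt (real (Suc m)))\<^sup>2 / 4)) ^ Suc m"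
      unfolding s_def by (intro power_mono) (use G_bound in auto)
    also have "\<dots> = exp (real (Suc m) * (- (\<alpha> * (y / sqrt (real (Suc m)))\<^sup>2 / 4)))"
      by (simp only: exp_of_nat_mult)
    also have "real (Suc m) * (- (\<alpha> * (y / sqrt (real (Suc m)))\<^sup>2 / 4)) = - (\<alpha> * y\<^sup>2 / 4)"
      by (simp add: power_divide field_simps)
    finally show ?thesis using G_bound by (simp add: s_def)
  qed
  have "(\<lambda>m. integral\<^sup>L lborel (s m)) \<longlonglongrightarrow> integral\<^sup>L lborel (\<lambda>y. exp (- (\<alpha> * y\<^sup>2 / 2)))"
  proof (rule integral_dominated_convergence)
    show "integrable lborel (\<lambda>y. exp (- (\<alpha> * y\<^sup>2 / 4)))"
      using gaussian_integral[of "\<alpha>/2"] \<open>\<alpha> > 0\<close> by (auto simp: has_bochner_integral_iff)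
  qed (use lim_s dom in \<open>auto simp: s_def\<close>)
  also have "integral\<^sup>L lborel (\<lambda>y. exp (- (\<alpha> * y\<^sup>2 / 2))) = sqrt (2 * pi / \<alpha>)"
    using gaussian_integral[OF \<open>\<alpha> > 0\<close>] by (auto simp: has_bochner_integral_iff)
  also have "(\<lambda>m. integral\<^sup>L lborel (s m)) =
      (\<lambda>m. sqrt (real (Suc m)) * integral {-\<delta>..\<delta>} (\<lambda>u. g u ^ Suc m))"
  proof
    fix m
    have "integral {-\<delta>..\<delta>} (\<lambda>u. g u ^ Suc m) = (LINT u:{-\<delta>..\<delta>}|lborel. g u ^ Suc m)"
      by (intro set_borel_integral_eq_integral(2)[symmetric] borel_integrable_atLeastAtMost'
          continuous_on_power cont)
    also have "\<dots> = integral\<^sup>L lborel (\<lambda>u. G u ^ Suc m)"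
      unfolding set_lebesgue_integral_def by (intro Bochner_Integration.integral_cong) (auto simp: G_def)
    also have "\<dots> = \<bar>1 / sqrt (real (Suc m))\<bar> *\<^sub>R integral\<^sup>L lborel (\<lambda>y. G (0 + 1 / sqrt (real (Suc m)) * y) ^ Suc m)"
      by (rule lborel_integral_real_affine) auto
    finally show "integral\<^sup>L lborel (s m) = sqrt (real (Suc m)) * integral {-\<delta>..\<delta>} (\<lambda>u. g u ^ Suc m)"
      by (simp add: s_def del: of_nat_Suc power_Suc)
  qed
  finally show ?thesis by (rule LIMSEQ_imp_Suc)
qed

text \<open>Each peak is normalised by dividing by its value h x, which is 1 or -1, and then falls
  under \<open>laplace_peak\<close>. The signs h x ^ m prevent convergence of the whole, hence the
  form as a difference tending to 0.\<close>

theorem laplace_method: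
  fixes h :: "real \<Rightarrow> real"
  assumes cont: "continuous_on {a..b} h" and X: "finite X" "X \<subseteq> {a<..<b}"
    and off: "\<And>x. x \<in> {a..b} - X \<Longrightarrow> \<bar>h x\<bar> < 1"
    and on: "\<And>x. x \<in> X \<Longrightarrow> \<bar>h x\<bar> = 1"
    and pos: "\<And>x. x \<in> X \<Longrightarrow> \<alpha> x > 0"
    and second: "\<And>x. x \<in> X \<Longrightarrow> ((\<lambda>u. (h (x + u) / h x - 1) / u\<^sup>2) \<longlongrightarrow> - \<alpha> x / 2) (at 0)"
  shows "(\<lambda>m. sqrt (real m) * integral {a..b} (\<lambda>x. h x ^ m)
            - (\<Sum>x\<in>X. h x ^ m * sqrt (2 * pi / \<alpha> x))) \<longlonglongrightarrow> 0"
proof -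
  \<comment> \<open>One radius has to work for all peaks: neighbourhoods inside the interval,
    pairwise disjoint, with the quadratic bound. Each requirement holds for all small radii, so
    finitely many hold together.\<close>
  have "\<forall>x\<in>X. \<forall>\<^sub>F \<delta> in at_right 0. {x-\<delta>..x+\<delta>} \<subseteq> {a<..<b} \<and>
      (\<forall>y\<in>X. y \<noteq> x \<longrightarrow> {x-\<delta>..x+\<delta>} \<inter> {y-\<delta>..y+\<delta>} = {}) \<and>
      (\<forall>u. \<bar>u\<bar> \<le> \<delta> \<longrightarrow> u \<noteq> 0 \<longrightarrow> 0 < h (x + u) / h x \<and> (h (x + u) / h x - 1) / u\<^sup>2 \<le> - \<alpha> x / 4)"
  proof
    fix x assume x: "x \<in> X"
    have [simp]: "\<forall>\<^sub>F \<delta> in at_right 0. (\<delta>::real) > 0" by (rule eventually_at_right_less)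
    have small: "\<forall>\<^sub>F \<delta> in at_right 0. \<delta> < c" if "c > 0" for c :: real
      using that by (rule eventually_at_right_real[THEN eventually_mono]) auto
    have 1: "\<forall>\<^sub>F \<delta> in at_right 0. {x-\<delta>..x+\<delta>} \<subseteq> {a<..<b}"
    proof -
      have "x - a > 0" "b - x > 0" using x X by auto
      from small[OF this(1)] small[OF this(2)] show ?thesis
        by eventually_elim auto
    qed
    have 2: "\<forall>\<^sub>F \<delta> in at_right 0. \<forall>y\<in>X. y \<noteq> x \<longrightarrow> {x-\<delta>..x+\<delta>} \<inter> {y-\<delta>..y+\<delta>} = {}"
    proof (intro eventually_ball_finite X ballI)
      fix y
      show "\<forall>\<^sub>F \<delta> in at_right 0. y \<noteq> x \<longrightarrow> {x-\<delta>..x+\<delta>} \<inter> {y-\<delta>..y+\<delta>} = {}"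
      proof (cases "y = x")
        case False
        then have "\<bar>x - y\<bar> / 2 > 0" by auto
        from small[OF this] show ?thesis by eventually_elim auto
      qed auto
    qed
    have 3: "\<forall>\<^sub>F \<delta> in at_right 0. \<forall>u. \<bar>u\<bar> \<le> \<delta> \<longrightarrow> u \<noteq> 0 \<longrightarrow>
        0 < h (x + u) / h x \<and> (h (x + u) / h x - 1) / u\<^sup>2 \<le> - \<alpha> x / 4"
    proof -
      let ?q = "\<lambda>u. (h (x + u) / h x - 1) / u\<^sup>2"
      \<comment> \<open>For u \<noteq> 0 the expression 1 + ?q u * u^2 is h (x + u) / h x, so its
        positivity near 0 also follows from \<open>second\<close>.\<close>
      have "((\<lambda>u. 1 + ?q u * u\<^sup>2) \<longlongrightarrow> 1 + - \<alpha> x / 2 * 0\<^sup>2) (at 0)"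
        by (intro tendsto_intros second x)
      then have "\<forall>\<^sub>F u in at 0. 0 < 1 + ?q u * u\<^sup>2"
        by (intro order_tendstoD(1)[where a = 0]) auto
      moreover have "\<forall>\<^sub>F u in at 0. ?q u < - \<alpha> x / 4"
        using pos[OF x] by (intro order_tendstoD(2)[OF second[OF x]]) auto
      ultimately have "\<forall>\<^sub>F u in at 0. 0 < 1 + ?q u * u\<^sup>2 \<and> ?q u < - \<alpha> x / 4"
        by eventually_elim auto
      then obtain d where d: "d > 0" "\<And>u. u \<noteq> 0 \<Longrightarrow> \<bar>u\<bar> < d \<Longrightarrow> 0 < 1 + ?q u * u\<^sup>2 \<and> ?q u < - \<alpha> x / 4"
        by (auto simp: eventually_at)
      from small[OF d(1)] show ?thesis
      proof eventually_elim
        case (elim \<delta>)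
        show ?case
        proof (intro allI impI)
          fix u :: real assume u: "\<bar>u\<bar> \<le> \<delta>" "u \<noteq> 0"
          then have "0 < 1 + ?q u * u\<^sup>2 \<and> ?q u < - \<alpha> x / 4" using d(2)[of u] elim by auto
          then show "0 < h (x + u) / h x \<and> ?q u \<le> - \<alpha> x / 4" using u by auto
        qed
      qed
    qed
    from 1 2 3 show "\<forall>\<^sub>F \<delta> in at_right 0. {x-\<delta>..x+\<delta>} \<subseteq> {a<..<b} \<and>
      (\<forall>y\<in>X. y \<noteq> x \<longrightarrow> {x-\<delta>..x+\<delta>} \<inter> {y-\<delta>..y+\<delta>} = {}) \<and>
      (\<forall>u. \<bar>u\<bar> \<le> \<delta> \<longrightarrow> u \<noteq> 0 \<longrightarrow> 0 < h (x + u) / h x \<and> (h (x + u) / h x - 1) / u\<^sup>2 \<le> - \<alpha> x / 4)"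
      by eventually_elim blast
  qed
  then have "\<forall>\<^sub>F \<delta> in at_right 0. \<forall>x\<in>X. {x-\<delta>..x+\<delta>} \<subseteq> {a<..<b} \<and>
      (\<forall>y\<in>X. y \<noteq> x \<longrightarrow> {x-\<delta>..x+\<delta>} \<inter> {y-\<delta>..y+\<delta>} = {}) \<and>
      (\<forall>u. \<bar>u\<bar> \<le> \<delta> \<longrightarrow> u \<noteq> 0 \<longrightarrow> 0 < h (x + u) / h x \<and> (h (x + u) / h x - 1) / u\<^sup>2 \<le> - \<alpha> x / 4)"
    using X(1) by (simp add: eventually_ball_finite)
  from eventually_happens[OF eventually_conj[OF eventually_at_right_less this]]
  obtain \<delta> :: real where \<delta>: "\<delta> > 0"
    and sub: "\<And>x. x \<in> X \<Longrightarrow> {x-\<delta>..x+\<delta>} \<subseteq> {a<..<b}"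
    and disj: "\<And>x y. x \<in> X \<Longrightarrow> y \<in> X \<Longrightarrow> y \<noteq> x \<Longrightarrow> {x-\<delta>..x+\<delta>} \<inter> {y-\<delta>..y+\<delta>} = {}"
    and bnd: "\<And>x u. x \<in> X \<Longrightarrow> \<bar>u\<bar> \<le> \<delta> \<Longrightarrow> u \<noteq> 0 \<Longrightarrow>
          0 < h (x + u) / h x \<and> (h (x + u) / h x - 1) / u\<^sup>2 \<le> - \<alpha> x / 4"
    by (auto simp: trivial_limit_at_right_real)
  \<comment> \<open>Removing open intervals leaves a compact set without maximisers, on which |h|
    has a uniform bound q < 1.\<close>
  define R where "R = {a..b} - (\<Union>x\<in>X. {x-\<delta><..<x+\<delta>})"
  have "compact R" unfolding R_def by (intro compact_diff open_UN) auto
  obtain q where q: "0 \<le> q" "q < 1" "\<And>x. x \<in> R \<Longrightarrow> \<bar>h x\<bar> \<le> q"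
  proof (cases "R = {}")
    case False
    have "continuous_on R (\<lambda>x. \<bar>h x\<bar>)"
      by (intro continuous_intros continuous_on_subset[OF cont]) (auto simp: R_def)
    from continuous_attains_sup[OF \<open>compact R\<close> False this]
    obtain z where z: "z \<in> R" "\<And>y. y \<in> R \<Longrightarrow> \<bar>h y\<bar> \<le> \<bar>h z\<bar>" by auto
    have "\<bar>h z\<bar> < 1" using z(1) \<delta> by (intro off) (auto simp: R_def)
    then show thesis using that[of "\<bar>h z\<bar>"] z by auto
  qed (use that[of 0] in auto)
  let ?I = "\<lambda>m x. integral {x-\<delta>..x+\<delta>} (\<lambda>t. h t ^ m)"
  have main: "(\<lambda>m. sqrt (real m) * ?I m x - h x ^ m * sqrt (2 * pi / \<alpha> x)) \<longlonglongrightarrow> 0" if x: "x \<in> X" for x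
  proof -
    define g where "g = (\<lambda>u. h (x + u) / h x)"
    have hx: "h x \<noteq> 0" using on[OF x] by auto
    have "a < x - \<delta>" "x + \<delta> < b" using sub[OF x] \<delta> by (auto simp: subset_iff)
    have "continuous_on {-\<delta>..\<delta>} (h \<circ> (\<lambda>u. x + u))"
      by (intro continuous_on_compose continuous_intros continuous_on_subset[OF cont])
        (use \<open>a < x - \<delta>\<close> \<open>x + \<delta> < b\<close> in auto)
    then have cg: "continuous_on {-\<delta>..\<delta>} g"
      unfolding g_def o_def using hx by (intro continuous_intros) auto
    have L: "(\<lambda>m. sqrt (real m) * integral {-\<delta>..\<delta>} (\<lambda>u. g u ^ m)) \<longlonglongrightarrow> sqrt (2 * pi / \<alpha> x)"
      using hx second[OF x] bnd[OF x]
      by (intro laplace_peak[OF pos[OF x] \<delta> cg]) (auto simp: g_def)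
    have I: "?I m x = h x ^ m * integral {-\<delta>..\<delta>} (\<lambda>u. g u ^ m)" for m
    proof -
      have "integral {-\<delta>..\<delta>} (\<lambda>u. g u ^ m) = integral {-\<delta>..\<delta>} ((\<lambda>u. (h u / h x) ^ m) \<circ> (+) x)"
        by (simp add: g_def o_def)
      also have "\<dots> = integral {-\<delta>+x..\<delta>+x} (\<lambda>u. (h u / h x) ^ m)"
        by (rule integral_shift_Icc_real)
      also have "\<dots> = integral {x-\<delta>..x+\<delta>} (\<lambda>u. h u ^ m / h x ^ m)"
        by (simp add: power_divide add.commute)
      also have "\<dots> = ?I m x / h x ^ m" by (simp add: integral_divide)
      finally show ?thesis using hx by simp
    qed
    have "(\<lambda>m. h x ^ m * (sqrt (real m) * integral {-\<delta>..\<delta>} (\<lambda>u. g u ^ m) - sqrt (2 * pi / \<alpha> x))) \<longlonglongrightarrow> 0"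
    proof (rule Lim_null_comparison)
      show "(\<lambda>m. \<bar>sqrt (real m) * integral {-\<delta>..\<delta>} (\<lambda>u. g u ^ m) - sqrt (2 * pi / \<alpha> x)\<bar>) \<longlonglongrightarrow> 0"
        using L by (simp add: LIM_zero_iff tendsto_rabs_zero_iff)
    qed (auto simp: abs_mult power_abs on[OF x])
    then show ?thesis unfolding I by (simp add: algebra_simps)
  qed
  \<comment> \<open>The contribution outside the peaks, of order q^m and thus negligible even after
    multiplication by sqrt m.\<close>
  define J where "J = (\<lambda>m. integral {a..b} (\<lambda>x. h x ^ m) - (\<Sum>x\<in>X. ?I m x))"
  have J: "\<bar>J m\<bar> \<le> (b - a) * q ^ m" if "a \<le> b" for m
  proof -
    have int: "(\<lambda>t. h t ^ m) integrable_on {a..b}"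
      by (intro integrable_continuous_real continuous_intros cont)
    let ?U = "\<Union>x\<in>X. {x-\<delta>..x+\<delta>}"
    have U: "((\<lambda>t. h t ^ m) has_integral (\<Sum>x\<in>X. ?I m x)) ?U"
    proof (rule has_integral_UN[OF X(1)])
      show "((\<lambda>t. h t ^ m) has_integral ?I m x) {x-\<delta>..x+\<delta>}" if "x \<in> X" for x
        using order_trans[OF sub[OF that] box_subset_cbox[of a b, unfolded box_real cbox_interval]] by (intro integrable_integral integrable_continuous_real continuous_intros
            continuous_on_subset[OF cont])
      show "pairwise (\<lambda>x y. negligible ({x-\<delta>..x+\<delta>} \<inter> {y-\<delta>..y+\<delta>})) X"
        using disj by (auto simp: pairwise_def)
    qed
    have "?U - {a..b} = {}" using sub by fastforce
    then have "((\<lambda>t. h t ^ m) has_integral J m) ({a..b} - ?U)"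
      unfolding J_def by (intro has_integral_setdiff integrable_integral U int) simp
    then have "((\<lambda>t. if t \<in> {a..b} - ?U then h t ^ m else 0) has_integral J m) {a..b}"
      by (subst has_integral_restrict) auto
    then have "norm (J m) \<le> q ^ m * measure lborel {a..b}"
    proof (intro has_integral_bound_real[where S = "{}"])
      show "norm (if t \<in> {a..b} - ?U then h t ^ m else 0) \<le> q ^ m" if "t \<in> {a..b} - {}" for t
      proof (cases "t \<in> {a..b} - ?U")
        case True
        then have "t \<in> R" by (force simp: R_def)
        then show ?thesis using q True by (auto simp: power_abs intro!: power_mono)
      qed (use q in auto)
    qed (use q in auto)
    then have "norm (J m) \<le> q ^ m * (b - a)" using that by simp
    then show ?thesis by (simp add: mult.commute)
  qed
  have J0: "(\<lambda>m. sqrt (real m) * J m) \<longlonglongrightarrow> 0"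
  proof (cases "a \<le> b")
    case True
    have "(\<lambda>m. (b - a) * (real m * q ^ m)) \<longlonglongrightarrow> (b - a) * 0"
      using powser_times_n_limit_0[of q] q by (intro tendsto_intros) auto
    then have "(\<lambda>m. (b - a) * (real m * q ^ m)) \<longlonglongrightarrow> 0" by simp
    then show ?thesis
    proof (rule Lim_null_comparison[rotated])
      have "sqrt (real m) * \<bar>J m\<bar> \<le> real m * ((b - a) * q ^ m)" for m
      proof (intro mult_mono)
        have "real m \<le> real (m\<^sup>2)" unfolding of_nat_le_iff by (cases m) (auto simp: power2_eq_square)
        then show "sqrt (real m) \<le> real m" by (intro real_le_lsqrt) auto
      qed (use J[OF True, of m] in auto)
      then show "\<forall>\<^sub>F m in sequentially. norm (sqrt (real m) * J m) \<le> (b - a) * (real m * q ^ m)"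
        by (auto simp: abs_mult mult_ac)
    qed
  next
    case False
    then have "X = {}" using X by auto
    with False show ?thesis by (simp add: J_def)
  qed
  have "(\<lambda>m. sqrt (real m) * J m + (\<Sum>x\<in>X. sqrt (real m) * ?I m x - h x ^ m * sqrt (2 * pi / \<alpha> x)))
      \<longlonglongrightarrow> 0 + (\<Sum>x\<in>X. 0)"
    by (intro tendsto_add J0 tendsto_sum main)
  then show ?thesis
    by (simp add: J_def sum_subtractf sum_distrib_left algebra_simps)
qed

section \<open>Comparison of factorials through the Beta integral\<close>

lemma beta_integral_nat:
  "integral {0..1} (\<lambda>x::real. x ^ m * (1 - x) ^ n) = fact m * fact n / fact (m + n + 1)"
proof -
  have "((\<lambda>x::real. x powr (real (Suc m) - 1) * (1 - x) powr (real (Suc n) - 1)) has_integral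
      Beta (real (Suc m)) (real (Suc n))) {0..1}"
    by (rule has_integral_Beta_real) auto
  then have "((\<lambda>x::real. x ^ m * (1 - x) ^ n) has_integral Beta (real (Suc m)) (real (Suc n))) {0..1}"
    by (rule has_integral_spike_finite[of "{0, 1}", rotated 2]) (auto simp: powr_realpow)
  moreover have "Beta (real (Suc m)) (real (Suc n)) = fact m * fact n / fact (m + n + 1)"
  proof -
    have "Gamma (real (Suc m) + real (Suc n)) = fact (m + n + 1)"
      using Gamma_fact[of "m + n + 1", where 'a = real] by (simp add: add_ac)
    then show ?thesis
      using Gamma_fact[of m, where 'a = real] Gamma_fact[of n, where 'a = real] by (simp add: Beta_def)
  qed
  ultimately show ?thesis by (simp add: integral_unique)
qed

text \<open>Takes the place of Stirling's formula. With 2 n = d m the Beta integrand x^m (1 - x)^n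
  is the m-th power of x (1 - x)^(d/2), to which \<open>laplace_method\<close> applies. The witness
  \<tau> is defined for every m, so its limit runs over all m, although the factorial formula only
  makes sense when d m is even.\<close>

lemma beta_asymptotics:
  assumes "d > 0" "k = d + 2"
  obtains \<tau> :: "nat \<Rightarrow> real" where "\<tau> \<longlonglongrightarrow> sqrt (8 * pi * real d / real k ^ 3)"
    "\<And>m n. d * m = 2 * n \<Longrightarrow> \<tau> m = sqrt (real m) * ((real k / 2) ^ m * (real k / real d) ^ n)
        * (fact m * fact n / fact (m + n + 1))"
proof -
  \<comment> \<open>The square root allows odd d. The constants k/2 and k/d normalise the maximal
    value to 1.\<close>
  define h where "h = (\<lambda>x. (real k * x / 2) * sqrt (real k * (1 - x) / real d) ^ d)"
  \<comment> \<open>The maximiser of x (1 - x)^(d/2) on the unit interval, and below it \<alpha> = -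
    h''(x0), obtained from the second derivative of ln h.\<close>
  define x0 where "x0 = 2 / real k"
  define \<alpha> where "\<alpha> = real k ^ 3 / (4 * real d)"
  have pos: "real k > 0" "real d > 0" using assms by auto
  have kd: "real k = real d + 2" using assms by simp
  have x0: "0 < x0" "x0 < 1" "1 - x0 = real d / real k"
    using assms pos by (simp_all add: x0_def field_simps)
  have h1: "h x0 = 1" using pos unfolding h_def x0(3) by (simp add: x0_def)
  have off: "\<bar>h x\<bar> < 1" if "x \<in> {0..1} - {x0}" for x
  proof (cases "0 < x \<and> x < 1")
    case True
    define a b where "a = real k * x / 2" and "b = real k * (1 - x) / real d"
    have ab: "a > 0" "b > 0" using True pos by (auto simp: a_def b_def)
    have "a \<noteq> 1" using that pos by (auto simp: a_def x0_def field_simps)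
    \<comment> \<open>Weighted inequality of arithmetic and geometric means in logarithmic form: the
      bounds ln t \<le> t - 1 with weights 1 and d/2 have right-hand sides adding up to 0, and the
      first is strict away from \<open>x0\<close>.\<close>
    then have "ln a < a - 1" using ln_le_minus_one[OF ab(1)] ln_eq_minus_one[OF ab(1)] by linarith
    moreover have "real d / 2 * ln b \<le> real d / 2 * (b - 1)"
      using ln_le_minus_one[OF ab(2)] by (intro mult_left_mono) auto
    moreover have "a - 1 + real d / 2 * (b - 1) = 0"
      using pos by (simp add: a_def b_def field_simps kd)
    ultimately have "ln a + real d / 2 * ln b < 0" by linarith
    moreover have hx: "h x = a * sqrt b ^ d" by (simp only: h_def a_def b_def)
    moreover have "ln (a * sqrt b ^ d) = ln a + real d / 2 * ln b"
      using ab by (simp add: ln_mult ln_realpow ln_sqrt)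
    moreover have "a * sqrt b ^ d > 0" using ab by simp
    ultimately have "h x > 0" "ln (h x) < 0" by simp_all
    then show ?thesis by (simp only: ln_less_zero_iff abs_of_pos)
  next
    case False
    then have "x = 0 \<or> x = 1" using that by auto
    then show ?thesis using assms(1) by (auto simp: h_def zero_power)
  qed
  have second: "((\<lambda>u. (h (x0 + u) / h x0 - 1) / u\<^sup>2) \<longlongrightarrow> - \<alpha> / 2) (at 0)"
  proof -
    define s where "s = (\<lambda>u. 1 - real k * u / real d)"
    have hs: "h (x0 + u) = (1 + real k * u / 2) * sqrt (s u) ^ d" for u
    proof -
      have "1 - (x0 + u) = real d / real k - u" using x0(3) by simp
      then have "real k * (1 - (x0 + u)) / real d = s u"
        using pos by (simp only:) (simp add: s_def field_simps)
      moreover have "real k * (x0 + u) / 2 = 1 + real k * u / 2"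
        using pos by (simp add: x0_def field_simps)
      ultimately show ?thesis by (simp only: h_def)
    qed
    have near: "\<forall>\<^sub>F u in at 0. s u > 0"
    proof -
      have "(s \<longlongrightarrow> s 0) (at 0)" unfolding s_def by (intro tendsto_intros) (use pos in auto)
      then show ?thesis by (intro order_tendstoD(1)[of s "s 0"]) (auto simp: s_def)
    qed
    \<comment> \<open>The numerator is the derivative of h (x0 + u). Written with its explicit
      factor u it makes a single use of l'Hopital's rule sufficient.\<close>
    have lim: "((\<lambda>u. (- \<alpha> * u * (sqrt (s u) ^ d / s u)) / (2 * u)) \<longlongrightarrow> - \<alpha> / 2) (at 0)"
    proof -
      have "((\<lambda>u. - \<alpha> / 2 * (sqrt (s u) ^ d / s u)) \<longlongrightarrow> - \<alpha> / 2 * (sqrt (s 0) ^ d / s 0)) (at 0)"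
        unfolding s_def by (intro tendsto_intros) (use pos in auto)
      moreover have "\<forall>\<^sub>F u in at 0. - \<alpha> / 2 * (sqrt (s u) ^ d / s u) = (- \<alpha> * u * (sqrt (s u) ^ d / s u)) / (2 * u)"
        by (simp add: eventually_at_filter)
      ultimately show ?thesis by (simp add: s_def Lim_transform_eventually)
    qed
    have "((\<lambda>u. (h (x0 + u) - 1) / u\<^sup>2) \<longlongrightarrow> - \<alpha> / 2) (at 0)"
    proof (rule lhopital[OF _ _ _ _ _ _ lim])
      have "((\<lambda>u. h (x0 + u) - 1) \<longlongrightarrow> (1 + real k * 0 / 2) * sqrt (1 - real k * 0 / real d) ^ d - 1) (at 0)"
        unfolding hs s_def by (intro tendsto_intros) (use pos in auto)
      then show "((\<lambda>u. h (x0 + u) - 1) \<longlongrightarrow> 0) (at 0)" by simp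
      show "((\<lambda>u::real. u\<^sup>2) \<longlongrightarrow> 0) (at 0)" by (auto intro!: tendsto_eq_intros)
      have nz: "\<forall>\<^sub>F u::real in at 0. u \<noteq> 0" by (simp add: eventually_at_filter)
      then show "\<forall>\<^sub>F u in at 0. u\<^sup>2 \<noteq> (0::real)" "\<forall>\<^sub>F u in at 0. 2 * u \<noteq> (0::real)" by simp_all
      show "\<forall>\<^sub>F u in at 0. ((\<lambda>u::real. u\<^sup>2) has_real_derivative 2 * u) (at u)"
        by (auto intro!: derivative_eq_intros always_eventually)
      show "\<forall>\<^sub>F u in at 0. ((\<lambda>u. h (x0 + u) - 1) has_real_derivative - \<alpha> * u * (sqrt (s u) ^ d / s u)) (at u)"
        using near
      proof eventually_elim
        case (elim u)
        have ds: "(s has_real_derivative - (real k / real d)) (at u)"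
          unfolding s_def using pos by (auto intro!: derivative_eq_intros)
        have dq: "((\<lambda>u. sqrt (s u)) has_real_derivative inverse (sqrt (s u)) / 2 * - (real k / real d)) (at u)"
          by (rule DERIV_chain2[OF DERIV_real_sqrt[OF elim] ds])
        have dl: "((\<lambda>u. 1 + real k * u / 2) has_real_derivative real k / 2) (at u)"
          by (auto intro!: derivative_eq_intros)
        have "((\<lambda>u. h (x0 + u) - 1) has_real_derivative
           (real k / 2) * sqrt (s u) ^ d + real d * sqrt (s u) ^ (d - 1) * (- (real k / real d) * (inverse (sqrt (s u)) / 2)) * (1 + real k * u / 2)) (at u)"
          unfolding hs
          by (rule DERIV_cong[OF DERIV_diff[OF DERIV_mult[OF dl DERIV_power[OF dq]] DERIV_const]]) simp
        also have "(real k / 2) * sqrt (s u) ^ d + real d * sqrt (s u) ^ (d - 1) * (- (real k / real d) * (inverse (sqrt (s u)) / 2)) * (1 + real k * u / 2)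
          = - \<alpha> * u * (sqrt (s u) ^ d / s u)"
        proof -
          define q where "q = sqrt (s u)"
          have q: "q > 0" "q * q = s u" using elim by (auto simp: q_def)
          obtain e where e: "d = Suc e" using assms(1) gr0_conv_Suc by blast
          have su: "real d * (q * q) = real d - real k * u" unfolding q(2) s_def using pos by (simp add: field_simps)
          have "(real k / 2) * q ^ d + real d * q ^ (d - 1) * (- (real k / real d) * (inverse q / 2)) * (1 + real k * u / 2)
            = real k / (2 * real d) * (q ^ d / (q * q)) * (real d * (q * q) - real d * (1 + real k * u / 2))"
          proof -
            have "K / 2 * (q * t) + D * t * (- (K / D) * (inverse q / 2)) * W = K / (2 * D) * (q * t / (q * q)) * (D * (q * q) - D * W)"
              if "D \<noteq> 0" for K D t W :: real
              using that q(1) by (simp add: field_simps)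
            from this[of "real d" "real k" "q ^ e" "1 + real k * u / 2"] pos(2) show ?thesis
              by (simp only: e power_Suc diff_Suc_1 less_irrefl)
          qed
          also have "real d * (q * q) - real d * (1 + real k * u / 2) = - (real k * real k / 2 * u)"
            unfolding su by (simp add: kd algebra_simps)
          also have "real k / (2 * real d) * (q ^ d / (q * q)) * - (real k * real k / 2 * u) = - \<alpha> * u * (q ^ d / (q * q))"
            by (simp add: \<alpha>_def power3_eq_cube mult_ac)
          finally show ?thesis unfolding q(2) unfolding q_def .
        qed
        finally show ?case .
      qed
    qed
    then show ?thesis by (simp add: h1)
  qed
  have cont: "continuous_on {0..1} h" unfolding h_def using pos by (intro continuous_intros) auto
  have "(\<lambda>m. sqrt (real m) * integral {0..1} (\<lambda>x. h x ^ m)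
            - (\<Sum>x\<in>{x0}. h x ^ m * sqrt (2 * pi / \<alpha>))) \<longlonglongrightarrow> 0"
  proof (intro laplace_method cont off)
    show "((\<lambda>u. (h (x + u) / h x - 1) / u\<^sup>2) \<longlongrightarrow> - \<alpha> / 2) (at 0)" if "x \<in> {x0}" for x
      using second that by simp
  qed (use x0 h1 pos in \<open>auto simp: \<alpha>_def\<close>)
  then have L: "(\<lambda>m. sqrt (real m) * integral {0..1} (\<lambda>x. h x ^ m)) \<longlonglongrightarrow> sqrt (2 * pi / \<alpha>)"
    using h1 by (simp add: LIM_zero_iff)
  have "2 * pi / \<alpha> = 8 * pi * real d / real k ^ 3" by (simp add: \<alpha>_def)
  moreover have "sqrt (real m) * integral {0..1} (\<lambda>x. h x ^ m) = sqrt (real m) * ((real k / 2) ^ m * (real k / real d) ^ n)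
        * (fact m * fact n / fact (m + n + 1))" if mn: "d * m = 2 * n" for m n
  proof -
    have "h x ^ m = (real k / 2) ^ m * (real k / real d) ^ n * (x ^ m * (1 - x) ^ n)" if "x \<in> {0..1}" for x
    proof -
      have "(sqrt (real k * (1 - x) / real d) ^ d) ^ m = (sqrt (real k * (1 - x) / real d))\<^sup>2 ^ n"
        by (simp only: power_mult[symmetric] mn)
      also have "\<dots> = ((real k / real d) * (1 - x)) ^ n" using that pos by simp
      finally have "h x ^ m = ((real k / 2) * x) ^ m * ((real k / real d) * (1 - x)) ^ n"
        unfolding h_def power_mult_distrib[of "real k * x / 2"] by simp
      then show ?thesis by (simp only: power_mult_distrib mult_ac)
    qed
    then have "integral {0..1} (\<lambda>x. h x ^ m) =
        integral {0..1} (\<lambda>x. (real k / 2) ^ m * (real k / real d) ^ n * (x ^ m * (1 - x) ^ n))"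
      by (intro Henstock_Kurzweil_Integration.integral_cong)
    also have "\<dots> = (real k / 2) ^ m * (real k / real d) ^ n * (fact m * fact n / fact (m + n + 1))"
      by (simp only: integral_mult_right beta_integral_nat)
    finally show ?thesis by (simp only: mult_ac)
  qed
  ultimately show thesis using L by (intro that[of "\<lambda>m. sqrt (real m) * integral {0..1} (\<lambda>x. h x ^ m)"]) auto
qed

section \<open>Homogeneous forms and critical points\<close>

text \<open>If \<open>p\<close> is homogenised to degree \<open>n\<close>, the partial derivatives of the form are the homogenisations
  to degree \<open>n - 1\<close> of \<open>pderiv p\<close> and \<open>pderiv_y n p\<close>.\<close>

definition pderiv_y :: "nat \<Rightarrow> real poly \<Rightarrow> real poly" where
  "pderiv_y n p = smult (real n) p - pCons 0 (pderiv p)"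

lemma coeff_pderiv_y: "coeff (pderiv_y n p) u = (real n - real u) * coeff p u"
  by (cases u) (simp_all add: pderiv_y_def coeff_pderiv algebra_simps)

lemma pderiv_pderiv_y: "pderiv (pderiv_y (Suc n) p) = pderiv_y n (pderiv p)"
  by (rule poly_eqI) (simp add: coeff_pderiv coeff_pderiv_y)

lemma form_pderiv:
  "form n (pderiv p) x y = (\<Sum>u\<le>Suc n. of_real (coeff p u) * (of_nat u * x ^ (u - 1) * y ^ (Suc n - u)))"
  unfolding form_def sum.atMost_Suc_shift by (simp add: coeff_pderiv mult_ac del: of_nat_Suc)

lemma form_pderiv_y:
  "form n (pderiv_y (Suc n) p) x y =
     (\<Sum>u\<le>Suc n. of_real (coeff p u) * (x ^ u * (of_nat (Suc n - u) * y ^ (Suc n - u - 1))))"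
  unfolding form_def sum.atMost_Suc coeff_pderiv_y
  by (auto intro!: sum.cong simp: of_nat_diff Suc_diff_le)

lemma form_has_derivative_x:
  "((\<lambda>t. form (Suc n) p t y) has_field_derivative form n (pderiv p) x y) (at x)"
  unfolding form_pderiv unfolding form_def
  by (rule DERIV_sum) (auto intro!: derivative_eq_intros simp: mult_ac)

lemma form_has_derivative_y:
  "((\<lambda>t. form (Suc n) p x t) has_field_derivative form n (pderiv_y (Suc n) p) x y) (at y)"
  unfolding form_pderiv_y unfolding form_def
  by (rule DERIV_sum) (auto intro!: derivative_eq_intros simp: mult_ac)

lemma form_euler:
  "x * form n (pderiv p) x y + y * form n (pderiv_y (Suc n) p) x y = of_nat (Suc n) * form (Suc n) p x y"
  unfolding form_pderiv form_pderiv_y unfolding form_def sum_distrib_left sum.distrib[symmetric]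
proof (intro sum.cong refl)
  fix u assume "u \<in> {..Suc n}"
  then have u: "u \<le> Suc n" by simp
  have 1: "of_nat u * (x * x ^ (u - 1)) = of_nat u * x ^ u" by (cases u) auto
  have 2: "of_nat (Suc n - u) * (y * y ^ (Suc n - u - 1)) = of_nat (Suc n - u) * y ^ (Suc n - u)"
    by (cases "Suc n - u") auto
  have "x * (of_real (coeff p u) * (of_nat u * x ^ (u - 1) * y ^ (Suc n - u))) +
      y * (of_real (coeff p u) * (x ^ u * (of_nat (Suc n - u) * y ^ (Suc n - u - 1))))
    = of_real (coeff p u) * ((of_nat u * (x * x ^ (u - 1))) * y ^ (Suc n - u)
        + x ^ u * (of_nat (Suc n - u) * (y * y ^ (Suc n - u - 1))))"
    by (simp only: algebra_simps)
  also have "\<dots> = (of_nat u + of_nat (Suc n - u)) * (of_real (coeff p u) * (x ^ u * y ^ (Suc n - u)))"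
    unfolding 1 2 by (simp only: algebra_simps)
  also have "of_nat u + of_nat (Suc n - u) = (of_nat (Suc n) :: 'a)"
    unfolding of_nat_add[symmetric] using u by simp
  finally show "x * (of_real (coeff p u) * (of_nat u * x ^ (u - 1) * y ^ (Suc n - u))) +
      y * (of_real (coeff p u) * (x ^ u * (of_nat (Suc n - u) * y ^ (Suc n - u - 1))))
    = of_nat (Suc n) * (of_real (coeff p u) * (x ^ u * y ^ (Suc n - u)))" .
qed

lemma form_scale: "form n p (r * x) (r * y) = r ^ n * form n p x y"
  unfolding form_def sum_distrib_left
proof (intro sum.cong refl)
  fix u assume "u \<in> {..n}"
  then have "r ^ n = r ^ u * r ^ (n - u)" by (simp flip: power_add)
  then show "of_real (coeff p u) * ((r * x) ^ u * (r * y) ^ (n - u)) =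
      r ^ n * (of_real (coeff p u) * (x ^ u * y ^ (n - u)))"
    by (simp add: power_mult_distrib mult_ac)
qed

lemma form_of_real: "form n p (of_real x) (of_real y) = of_real (form n p x y)"
  by (simp add: form_def)

section \<open>Restriction of forms to the unit circle\<close>

definition ray :: "nat \<Rightarrow> real poly \<Rightarrow> real \<Rightarrow> real" where
  "ray n p \<theta> = form n p (cos \<theta>) (sin \<theta>)"

lemma ray_derivative:
  "(ray (Suc n) p has_real_derivative cos \<theta> * ray n (pderiv_y (Suc n) p) \<theta> - sin \<theta> * ray n (pderiv p) \<theta>) (at \<theta>)"
proof -
  have alg: "a * (u * C * - s * S + W * S' * c * C') = c * (a * (C' * (W * S'))) - s * (a * (u * C * S))"
    for a u C s S W S' c C' :: real
    by (simp add: algebra_simps)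
  have "((\<lambda>\<theta>. form (Suc n) p (cos \<theta>) (sin \<theta>)) has_real_derivative
     (\<Sum>u\<le>Suc n. coeff p u * (real u * cos \<theta> ^ (u - 1) * - sin \<theta> * sin \<theta> ^ (Suc n - u)
        + real (Suc n - u) * sin \<theta> ^ (Suc n - u - 1) * cos \<theta> * cos \<theta> ^ u))) (at \<theta>)"
    unfolding form_def of_real_eq_id id_def
    by (rule DERIV_sum) (auto intro!: derivative_eq_intros simp: mult_ac)
  also have "(\<Sum>u\<le>Suc n. coeff p u * (real u * cos \<theta> ^ (u - 1) * - sin \<theta> * sin \<theta> ^ (Suc n - u)
        + real (Suc n - u) * sin \<theta> ^ (Suc n - u - 1) * cos \<theta> * cos \<theta> ^ u))
      = cos \<theta> * ray n (pderiv_y (Suc n) p) \<theta> - sin \<theta> * ray n (pderiv p) \<theta>"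
    unfolding ray_def form_pderiv form_pderiv_y of_real_eq_id id_def sum_distrib_left sum_subtractf[symmetric]
    by (intro sum.cong refl alg)
  finally show ?thesis by (simp add: ray_def[abs_def])
qed

definition ray1 :: "nat \<Rightarrow> real poly \<Rightarrow> real \<Rightarrow> real" where
  "ray1 n p \<theta> = cos \<theta> * ray (n - 1) (pderiv_y n p) \<theta> - sin \<theta> * ray (n - 1) (pderiv p) \<theta>"

text \<open>Second derivative along the unit circle: the Hessian of the form in the tangent
  direction (- sin \<theta>, cos \<theta>), minus the radial derivative caused by the curvature of
  the circle, which is \<open>n * ray n p \<theta>\<close> by Euler's identity.\<close>

definition ray2 :: "nat \<Rightarrow> real poly \<Rightarrow> real \<Rightarrow> real" where
  "ray2 n p \<theta> = (sin \<theta>)\<^sup>2 * ray (n - 2) (pderiv (pderiv p)) \<theta>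
     - 2 * sin \<theta> * cos \<theta> * ray (n - 2) (pderiv_y (n - 1) (pderiv p)) \<theta>
     + (cos \<theta>)\<^sup>2 * ray (n - 2) (pderiv_y (n - 1) (pderiv_y n p)) \<theta> - real n * ray n p \<theta>"

lemma ray_euler:
  "cos \<theta> * ray n (pderiv p) \<theta> + sin \<theta> * ray n (pderiv_y (Suc n) p) \<theta> = real (Suc n) * ray (Suc n) p \<theta>"
  unfolding ray_def by (rule form_euler)

lemma ray_ray1: "n > 0 \<Longrightarrow> (ray n p has_real_derivative ray1 n p \<theta>) (at \<theta>)"
  using ray_derivative[of "n - 1" p \<theta>] by (simp add: ray1_def)

lemma ray1_ray2:
  assumes "n \<ge> 2"
  shows "(ray1 n p has_real_derivative ray2 n p \<theta>) (at \<theta>)"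
proof -
  obtain d where n: "n = Suc (Suc d)" using that[of "n - 2"] assms by simp
  let ?A = "ray d (pderiv (pderiv p)) \<theta>" and ?B = "ray d (pderiv_y (Suc d) (pderiv p)) \<theta>"
    and ?C = "ray d (pderiv_y (Suc d) (pderiv_y (Suc (Suc d)) p)) \<theta>"
    and ?Y = "ray (Suc d) (pderiv_y (Suc (Suc d)) p) \<theta>" and ?X = "ray (Suc d) (pderiv p) \<theta>"
  let ?c = "cos \<theta>" and ?s = "sin \<theta>"
  have dY: "(ray (Suc d) (pderiv_y (Suc (Suc d)) p) has_real_derivative ?c * ?C - ?s * ?B) (at \<theta>)"
    using ray_derivative[of d "pderiv_y (Suc (Suc d)) p" \<theta>] unfolding pderiv_pderiv_y .
  have dX: "(ray (Suc d) (pderiv p) has_real_derivative ?c * ?B - ?s * ?A) (at \<theta>)"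
    by (rule ray_derivative)
  have "ray1 n p = (\<lambda>\<theta>. cos \<theta> * ray (Suc d) (pderiv_y (Suc (Suc d)) p) \<theta> - sin \<theta> * ray (Suc d) (pderiv p) \<theta>)"
    by (simp add: fun_eq_iff ray1_def n)
  moreover note DERIV_diff[OF DERIV_mult[OF DERIV_cos dY] DERIV_mult[OF DERIV_sin dX]]
  ultimately have "(ray1 n p has_real_derivative
      (- ?s * ?Y + (?c * ?C - ?s * ?B) * ?c) - (?c * ?X + (?c * ?B - ?s * ?A) * ?s)) (at \<theta>)"
    by (simp only:)
  also have "(- ?s * ?Y + (?c * ?C - ?s * ?B) * ?c) - (?c * ?X + (?c * ?B - ?s * ?A) * ?s)
      = ?s\<^sup>2 * ?A - 2 * ?s * ?c * ?B + ?c\<^sup>2 * ?C - (?c * ?X + ?s * ?Y)"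
    by (simp add: algebra_simps power2_eq_square)
  also have "\<dots> = ray2 n p \<theta>"
    unfolding ray_euler by (simp add: ray2_def n)
  finally show ?thesis .
qed

lemma ray_continuous: "continuous_on S (ray n p)"
  unfolding ray_def[abs_def] form_def by (intro continuous_intros)

lemma ray_plus_pi: "ray n p (\<theta> + pi) = (-1) ^ n * ray n p \<theta>"
  using form_scale[of n p "-1" "cos \<theta>" "sin \<theta>"] by (simp add: ray_def)

lemma form_at_ray:
  "form n p (r * of_real (cos \<theta>)) (r * of_real (sin \<theta>)) = r ^ n * of_real (ray n p \<theta>)"
  by (simp add: form_scale form_of_real ray_def)

text \<open>Brings a critical angle into the form that \<open>laplace_method\<close> asks for, with
  \<alpha> = - v''/v. One use of l'Hopital's rule leads to ray1 (x + u) / (2 u), half a difference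
  quotient of the first derivative.\<close>

lemma ray_second_order:
  assumes "n \<ge> 2" "ray1 n p x = 0" "ray n p x \<noteq> 0"
  shows "((\<lambda>u. (ray n p (x + u) / ray n p x - 1) / u\<^sup>2) \<longlongrightarrow> ray2 n p x / (2 * ray n p x)) (at 0)"
proof -
  have d1: "((\<lambda>u. ray n p (x + u) - ray n p x) has_real_derivative ray1 n p (x + u)) (at u)" for u
    using assms(1) by (auto intro!: derivative_eq_intros DERIV_chain'[OF _ ray_ray1])
  have "((\<lambda>u. (ray1 n p (x + u) - ray1 n p x) / u) \<longlongrightarrow> ray2 n p x) (at 0)"
    using ray1_ray2[OF assms(1), of p x] by (simp add: DERIV_def)
  then have "((\<lambda>u. ray1 n p (x + u) / u / 2) \<longlongrightarrow> ray2 n p x / 2) (at 0)"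
    unfolding assms(2) by (intro tendsto_intros) auto
  then have q: "((\<lambda>u. ray1 n p (x + u) / (2 * u)) \<longlongrightarrow> ray2 n p x / 2) (at 0)"
    by (simp add: divide_divide_eq_left mult.commute)
  have L: "((\<lambda>u. (ray n p (x + u) - ray n p x) / u\<^sup>2) \<longlongrightarrow> ray2 n p x / 2) (at 0)"
  proof (rule lhopital[OF _ _ _ _ _ _ q])
    have "isCont (\<lambda>u. ray n p (x + u) - ray n p x) 0" using d1 DERIV_isCont by blast
    then show "((\<lambda>u. ray n p (x + u) - ray n p x) \<longlongrightarrow> 0) (at 0)" by (simp add: isCont_def)
    show "((\<lambda>u::real. u\<^sup>2) \<longlongrightarrow> 0) (at 0)" by (auto intro!: tendsto_eq_intros)
    have nz: "\<forall>\<^sub>F u::real in at 0. u \<noteq> 0" by (simp add: eventually_at_filter)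
    show "\<forall>\<^sub>F u in at 0. u\<^sup>2 \<noteq> (0::real)" "\<forall>\<^sub>F u in at 0. 2 * u \<noteq> (0::real)" using nz by simp_all
    show "\<forall>\<^sub>F u in at 0. ((\<lambda>u. ray n p (x + u) - ray n p x) has_real_derivative ray1 n p (x + u)) (at u)"
      using d1 by simp
    show "\<forall>\<^sub>F u in at 0. ((\<lambda>u::real. u\<^sup>2) has_real_derivative 2 * u) (at u)"
      by (auto intro!: derivative_eq_intros always_eventually)
  qed
  have "((\<lambda>u. (ray n p (x + u) - ray n p x) / u\<^sup>2 / ray n p x) \<longlongrightarrow> ray2 n p x / 2 / ray n p x) (at 0)"
    by (rule tendsto_divide[OF L tendsto_const assms(3)])
  moreover have "(ray n p (x + u) - ray n p x) / u\<^sup>2 / ray n p x = (ray n p (x + u) / ray n p x - 1) / u\<^sup>2" for u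
    using assms(3) by (simp add: field_simps)
  ultimately show ?thesis by simp
qed

section \<open>The action in polar coordinates\<close>

definition vertex_poly :: "nat \<Rightarrow> (nat \<Rightarrow> nat \<Rightarrow> real) \<Rightarrow> real poly" where
  "vertex_poly k \<Lambda> = (\<Sum>u\<le>k. monom (\<Lambda> u (k - u) / (fact u * fact (k - u))) u)"

lemma coeff_vertex_poly:
  "coeff (vertex_poly k \<Lambda>) u = (if u \<le> k then \<Lambda> u (k - u) / (fact u * fact (k - u)) else 0)"
  by (simp add: vertex_poly_def coeff_sum if_distrib cong: if_cong)

lemma degree_vertex_poly: "degree (vertex_poly k \<Lambda>) \<le> k"
  by (rule degree_le) (simp add: coeff_vertex_poly)

text \<open>\<open>vertex_poly\<close> is the polynomial V(x, 1); homogenising it to degree k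
  recovers V, now as a form whose derivatives are forms again.\<close>

lemma action_form: "action k \<Lambda> x y = - (x\<^sup>2 / 2) - y\<^sup>2 / 2 + form k (vertex_poly k \<Lambda>) x y"
proof -
  have "potential k \<Lambda> x y = (\<Sum>u\<le>k. of_real (\<Lambda> u (k - u)) * (x ^ u * y ^ (k - u)) / (fact u * fact (k - u)))"
    unfolding potential_def
    by (rule sum.reindex_bij_witness[where i = "\<lambda>u. (u, k - u)" and j = fst]) auto
  also have "\<dots> = form k (vertex_poly k \<Lambda>) x y"
    unfolding form_def by (intro sum.cong) (auto simp: coeff_vertex_poly)
  finally show ?thesis by (simp add: action_def)
qed

context
  fixes k d :: nat and \<Lambda> :: "nat \<Rightarrow> nat \<Rightarrow> real" and p :: "real poly"
  assumes k: "k = Suc (Suc d)" and p: "p = vertex_poly k \<Lambda>"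
begin

lemma partial_action:
  "partial1 (action k \<Lambda>) = (\<lambda>x y. - x + form (Suc d) (pderiv p) x y)"
  "partial2 (action k \<Lambda>) = (\<lambda>x y. - y + form (Suc d) (pderiv_y k p) x y)"
  unfolding partial1_def partial2_def action_form fun_eq_iff p[symmetric] unfolding k
  by (auto intro!: DERIV_imp_deriv derivative_eq_intros form_has_derivative_x form_has_derivative_y)

lemma det_hessian_action:
  "det (hessian (action k \<Lambda>) x y) =
    (form d (pderiv (pderiv p)) x y - 1) * (form d (pderiv_y (Suc d) (pderiv_y k p)) x y - 1)
      - (form d (pderiv_y (Suc d) (pderiv p)) x y)\<^sup>2"
proof -
  have "partial1 (partial1 (action k \<Lambda>)) x y = -1 + form d (pderiv (pderiv p)) x y"
    "partial1 (partial2 (action k \<Lambda>)) x y = form d (pderiv (pderiv_y k p)) x y"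
    "partial2 (partial1 (action k \<Lambda>)) x y = form d (pderiv_y (Suc d) (pderiv p)) x y"
    "partial2 (partial2 (action k \<Lambda>)) x y = -1 + form d (pderiv_y (Suc d) (pderiv_y k p)) x y"
    unfolding partial_action unfolding partial1_def partial2_def
    by (auto intro!: DERIV_imp_deriv derivative_eq_intros form_has_derivative_x form_has_derivative_y)
  then show ?thesis
    by (simp add: hessian_def det_2 k pderiv_pderiv_y power2_eq_square)
qed

text \<open>With q = r^d the critical equations say that q times the gradient of V at (cos \<theta>,
  sin \<theta>) equals this unit vector. Its tangential component must vanish, which is v'(\<theta>)
  = 0, and its radial component, k v(\<theta>) by Euler's identity, must become 1.\<close>

lemma crit_on_ray:
  assumes "r \<noteq> 0"
  shows "(r * of_real (cos \<theta>), r * of_real (sin \<theta>)) \<in> crit (action k \<Lambda>) \<longleftrightarrow>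
    ray1 k p \<theta> = 0 \<and> r ^ d * of_real (real k * ray k p \<theta>) = 1"
proof -
  define X Y c s q where "X = ray (Suc d) (pderiv p) \<theta>" and "Y = ray (Suc d) (pderiv_y k p) \<theta>"
    and "c = cos \<theta>" and "s = sin \<theta>" and "q = r ^ d"
  have cs: "c * c + s * s = 1" using sin_cos_squared_add[of \<theta>] by (simp add: c_def s_def power2_eq_square)
  have E: "real k * ray k p \<theta> = c * X + s * Y"
    unfolding X_def Y_def c_def s_def k by (rule ray_euler[symmetric])
  have R: "ray1 k p \<theta> = c * Y - s * X" unfolding X_def Y_def c_def s_def ray1_def k by simp
  have "(r * of_real c, r * of_real s) \<in> real_ratio_points"
    using assms by (auto simp: real_ratio_points_def)
  then have "(r * of_real c, r * of_real s) \<in> crit (action k \<Lambda>) \<longleftrightarrow>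
      - (r * of_real c) + r ^ Suc d * of_real X = 0 \<and> - (r * of_real s) + r ^ Suc d * of_real Y = 0"
    unfolding crit_def partial_action by (simp add: form_at_ray X_def Y_def c_def s_def)
  also have "\<dots> \<longleftrightarrow> q * of_real X = of_real c \<and> q * of_real Y = of_real s"
  proof -
    have "- (r * of_real a) + r ^ Suc d * of_real b = r * (q * of_real b - of_real a)" for a b :: real
      by (simp add: q_def algebra_simps)
    then show ?thesis using assms by simp
  qed
  also have "\<dots> \<longleftrightarrow> c * Y - s * X = 0 \<and> q * of_real (c * X + s * Y) = 1"
  proof safe
    assume a: "q * of_real X = of_real c" "q * of_real Y = of_real s"
    have "q * of_real (c * X + s * Y) = of_real c * (q * of_real X) + of_real s * (q * of_real Y)"
      by (simp add: algebra_simps)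
    also have "\<dots> = of_real (c * c + s * s)" unfolding a by simp
    finally show 1: "q * of_real (c * X + s * Y) = 1" by (simp only: cs of_real_1)
    have "q * of_real (c * Y - s * X) = of_real c * (q * of_real Y) - of_real s * (q * of_real X)"
      by (simp add: algebra_simps)
    also have "\<dots> = 0" unfolding a by simp
    finally have "q * of_real (c * Y - s * X) = 0" .
    moreover have "q \<noteq> 0" using 1 by auto
    ultimately show "c * Y - s * X = 0" by (metis mult_eq_0_iff of_real_eq_0_iff)
  next
    assume a: "c * Y - s * X = 0" "q * of_real (c * X + s * Y) = 1"
    have "X = c * (c * X + s * Y) - s * (c * Y - s * X)" using cs by algebra
    then have X: "X = c * (c * X + s * Y)" using a(1) by simp
    have "Y = s * (c * X + s * Y) + c * (c * Y - s * X)" using cs by algebra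
    then have Y: "Y = s * (c * X + s * Y)" using a(1) by simp
    show "q * of_real X = of_real c" using a(2) by (subst X) (simp add: mult.left_commute)
    show "q * of_real Y = of_real s" using a(2) by (subst Y) (simp add: mult.left_commute)
  qed
  finally show ?thesis unfolding E R q_def c_def s_def .
qed

text \<open>The critical equation reduces V = r^k v to r^2 / k, so -g = r^2 (1/2 - 1/k) = r^2 d / (2
  k).\<close>

lemma action_on_ray:
  assumes "r ^ d * of_real (real k * ray k p \<theta>) = 1"
  shows "- action k \<Lambda> (r * of_real (cos \<theta>)) (r * of_real (sin \<theta>)) = r\<^sup>2 * of_real (real d / (2 * real k))"
proof -
  have cs: "(of_real (cos \<theta>))\<^sup>2 + (of_real (sin \<theta>))\<^sup>2 = (1::complex)"
    unfolding of_real_power[symmetric] of_real_add[symmetric] by simp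
  have k0: "of_nat k \<noteq> (0::complex)" by (simp only: k of_nat_eq_0_iff)
  have v: "r ^ d * of_real (ray k p \<theta>) = 1 / of_nat k"
    using assms k0 by (simp add: field_simps)
  have "action k \<Lambda> (r * of_real (cos \<theta>)) (r * of_real (sin \<theta>)) =
      - (r\<^sup>2 * ((of_real (cos \<theta>))\<^sup>2 + (of_real (sin \<theta>))\<^sup>2) / 2) + r\<^sup>2 * (r ^ d * of_real (ray k p \<theta>))"
    unfolding action_form p[symmetric] form_at_ray
    by (simp add: k power_mult_distrib algebra_simps add_divide_distrib power2_eq_square)
  also have "\<dots> = - (r\<^sup>2 * of_real (real d / (2 * real k)))"
    unfolding cs v by (simp add: k field_simps del: of_nat_Suc) (simp add: algebra_simps)
  finally show ?thesis by simp
qed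

text \<open>The Hessian of g is that of V minus the identity, and it is diagonal in the frame of
  radial and tangential directions. Euler's identity for the gradient of V gives the radial
  eigenvalue (d + 1) - 1 = d, and \<open>ray2\<close> gives the tangential one, v''/(k v). The root
  r disappears because only r^d enters.\<close>

lemma det_hessian_on_ray:
  assumes "r ^ d * of_real (real k * ray k p \<theta>) = 1" "ray1 k p \<theta> = 0"
  shows "det (hessian (action k \<Lambda>) (r * of_real (cos \<theta>)) (r * of_real (sin \<theta>)))
    = of_real (real d * ray2 k p \<theta> / (real k * ray k p \<theta>))"
proof -
  define A B C X Y v c s q where "A = ray d (pderiv (pderiv p)) \<theta>" and "B = ray d (pderiv_y (Suc d) (pderiv p)) \<theta>"
    and "C = ray d (pderiv_y (Suc d) (pderiv_y k p)) \<theta>" and "X = ray (Suc d) (pderiv p) \<theta>"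
    and "Y = ray (Suc d) (pderiv_y k p) \<theta>" and "v = real k * ray k p \<theta>" and "c = cos \<theta>" and "s = sin \<theta>" and "q = inverse v"
  have v0: "v \<noteq> 0" using assms(1) unfolding v_def by (metis mult_zero_right of_real_0 zero_neq_one)
  have "r ^ d * of_real v = 1" using assms(1) by (simp only: v_def)
  then have rq: "r ^ d = of_real q" using v0 by (simp add: q_def field_simps)
  have cs: "c * c + s * s = 1" using sin_cos_squared_add[of \<theta>] by (simp add: c_def s_def power2_eq_square)
  have E: "c * X + s * Y = v" unfolding X_def Y_def c_def s_def v_def k by (rule ray_euler)
  have R: "c * Y - s * X = 0" using assms(2) unfolding X_def Y_def c_def s_def ray1_def k by simp
  have EX: "c * A + s * B = (real d + 1) * X"
    using ray_euler[of \<theta> d "pderiv p"] unfolding A_def B_def X_def c_def s_def by simp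
  have EY: "c * B + s * C = (real d + 1) * Y"
    using ray_euler[of \<theta> d "pderiv_y k p"] unfolding B_def C_def Y_def c_def s_def k pderiv_pderiv_y by simp
  have ray2: "ray2 k p \<theta> = s\<^sup>2 * A - 2 * s * c * B + c\<^sup>2 * C - v"
    unfolding ray2_def A_def B_def C_def c_def s_def v_def k by simp
  have "X = X * (c * c + s * s)" unfolding cs by simp
  also have "\<dots> = c * (c * X + s * Y) - s * (c * Y - s * X)" by (simp add: algebra_simps)
  finally have X: "X = c * v" unfolding E R by simp
  have "Y = Y * (c * c + s * s)" unfolding cs by simp
  also have "\<dots> = s * (c * X + s * Y) + c * (c * Y - s * X)" by (simp add: algebra_simps)
  finally have Y: "Y = s * v" unfolding E R by simp
  have qv: "q * v = 1" using v0 by (simp add: q_def)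
  \<comment> \<open>Together with \<open>e2\<close>: the radial vector (c, s) is an eigenvector,
    with eigenvalue d + 1, of q times the Hessian of the form.\<close>
  have e1: "c * (q * A) + s * (q * B) = (real d + 1) * c" using EX X qv by algebra
  have e2: "c * (q * B) + s * (q * C) = (real d + 1) * s" using EY Y qv by algebra
  have "(q * A - 1) * (q * C - 1) - (q * B)\<^sup>2 = real d * (s\<^sup>2 * (q * A) - 2 * s * c * (q * B) + c\<^sup>2 * (q * C) - 1)"
    using e1 e2 cs by algebra
  also have "s\<^sup>2 * (q * A) - 2 * s * c * (q * B) + c\<^sup>2 * (q * C) - 1 = q * ray2 k p \<theta>"
    using qv unfolding ray2 by algebra
  finally have "(q * A - 1) * (q * C - 1) - (q * B)\<^sup>2 = real d * ray2 k p \<theta> / v"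
    by (simp add: q_def field_simps)
  moreover have "det (hessian (action k \<Lambda>) (r * of_real (cos \<theta>)) (r * of_real (sin \<theta>)))
    = of_real ((q * A - 1) * (q * C - 1) - (q * B)\<^sup>2)"
    unfolding det_hessian_action form_at_ray rq A_def B_def C_def by simp
  ultimately show ?thesis by (simp only: v_def)
qed

end

text \<open>A point with real ratio is a complex multiple of a real unit vector. Shifting the angle
  by a multiple of pi changes that vector by a sign only, which the complex factor absorbs, so any
  half-open interval of length pi will do.\<close>

lemma ray_points_exist:
  assumes "(w, z) \<in> real_ratio_points" "(w, z) \<noteq> 0"
  obtains r \<theta> where "r \<noteq> 0" "c0 \<le> \<theta>" "\<theta> < c0 + pi" "w = r * of_real (cos \<theta>)" "z = r * of_real (sin \<theta>)"
proof -
  obtain r' \<phi> where r': "r' \<noteq> 0" "w = r' * of_real (cos \<phi>)" "z = r' * of_real (sin \<phi>)"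
  proof (cases "z = 0")
    case True
    then show thesis using that[of w 0] assms(2) by (simp add: zero_prod_def)
  next
    case False
    then obtain \<rho> where \<rho>: "w / z = of_real \<rho>"
      using assms(1) by (auto simp: real_ratio_points_def elim: Reals_cases)
    define R where "R = sqrt (1 + \<rho>\<^sup>2)"
    have R: "R > 0" "R\<^sup>2 = 1 + \<rho>\<^sup>2" by (auto simp: R_def add_pos_nonneg)
    have "(\<rho> / R)\<^sup>2 + (1 / R)\<^sup>2 = (1 + \<rho>\<^sup>2) / R\<^sup>2" by (simp add: power_divide add_divide_distrib)
    also have "\<dots> = R\<^sup>2 / R\<^sup>2" by (simp only: R(2))
    also have "\<dots> = 1" using R(1) by simp
    finally have "(\<rho> / R)\<^sup>2 + (1 / R)\<^sup>2 = 1" .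
    then obtain \<phi> where "\<rho> / R = cos \<phi>" "1 / R = sin \<phi>" using sincos_total_2pi by metis
    then have "of_real (cos \<phi>) = of_real \<rho> / complex_of_real R" "of_real (sin \<phi>) = 1 / complex_of_real R"
      by (metis of_real_divide of_real_1)+
    with \<rho> False R show thesis
      by (intro that[of "z * of_real R" \<phi>]) (auto simp: field_simps)
  qed
  define m where "m = \<lfloor>(\<phi> - c0) / pi\<rfloor>"
  define \<theta> where "\<theta> = \<phi> - of_int m * pi"
  have "of_int m \<le> (\<phi> - c0) / pi" "(\<phi> - c0) / pi < of_int m + 1"
    unfolding m_def by linarith+
  then have \<theta>: "c0 \<le> \<theta>" "\<theta> < c0 + pi"
    by (simp_all add: \<theta>_def field_simps)
  have "sin (of_int m * pi) = 0" by (auto simp: sin_zero_iff_int2)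
  then have "cos \<phi> = cos (of_int m * pi) * cos \<theta>" "sin \<phi> = cos (of_int m * pi) * sin \<theta>"
    and "cos (of_int m * pi) \<noteq> 0"
    using cos_add[of \<theta> "of_int m * pi"] sin_add[of \<theta> "of_int m * pi"] sin_cos_squared_add[of "of_int m * pi"]
    by (auto simp: \<theta>_def mult.commute)
  with r' \<theta> show thesis
    by (intro that[of "r' * of_real (cos (of_int m * pi))" \<theta>]) (auto simp: mult.assoc)
qed

text \<open>Two angles describing the same complex line differ by a multiple of pi, and the
  hypothesis leaves only the multiple 0.\<close>

lemma ray_points_unique:
  assumes "r \<noteq> 0" "r' \<noteq> 0" "\<bar>\<theta> - \<theta>'\<bar> < pi"
    and eq: "r * of_real (cos \<theta>) = r' * of_real (cos \<theta>')" "r * of_real (sin \<theta>) = r' * complex_of_real (sin \<theta>')"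
  shows "\<theta> = \<theta>'" "r = r'"
proof -
  have "(r * of_real (sin \<theta>)) * (r' * of_real (cos \<theta>')) = (r' * of_real (sin \<theta>')) * (r * of_real (cos \<theta>))"
    unfolding eq by simp
  then have "r * r' * of_real (sin \<theta> * cos \<theta>') = r * r' * of_real (cos \<theta> * sin \<theta>')"
    by (simp add: mult_ac)
  then have "sin \<theta> * cos \<theta>' = cos \<theta> * sin \<theta>'"
    using assms(1,2) by (simp only: mult_cancel_left of_real_eq_iff mult_eq_0_iff) auto
  then have "sin (\<theta> - \<theta>') = 0" by (simp add: sin_diff)
  moreover have "- pi < \<theta> - \<theta>'" "\<theta> - \<theta>' < pi" using assms(3) by auto
  ultimately have "\<theta> - \<theta>' = 0" by (rule sin_eq_0_pi[rotated 2])
  then show [simp]: "\<theta> = \<theta>'" by simp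
  have "cos \<theta>' \<noteq> 0 \<or> sin \<theta>' \<noteq> 0" using sin_zero_abs_cos_one[of \<theta>'] by auto
  then show "r = r'" using eq by auto
qed

section \<open>Minimal critical points\<close>

text \<open>Full rank makes the rows span the space, which gives a left inverse; the determinant is
  multiplicative.\<close>

lemma rank_2_det:
  fixes A :: "complex^2^2"
  assumes "rank A = 2"
  shows "det A \<noteq> 0"
proof -
  have "vec.dim (rows A) = vec.dim (UNIV :: (complex^2) set)"
    using assms unfolding row_rank_def_gen vec_dim_card by simp
  then have "vec.span (rows A) = UNIV"
    by (metis vec.dim_eq_full vec.span_UNIV)
  then obtain B where "B ** A = mat 1" using matrix_left_invertible_span_rows_gen by blast
  then have "det B * det A = 1" by (metis det_mul det_I)
  then show ?thesis by auto
qed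

lemma sum_roots:
  fixes \<zeta> :: complex
  assumes "\<zeta> \<noteq> 0" "d > 0" "d * m = e"
  shows "(\<Sum>r | r ^ d = \<zeta>. inverse (r ^ e)) = of_nat d * inverse \<zeta> ^ m"
    and "(\<Sum>r | r ^ d = \<zeta>. norm (inverse (r ^ e))) = real d * norm (inverse \<zeta>) ^ m"
proof -
  have eq: "inverse (r ^ e) = inverse \<zeta> ^ m" if "r \<in> {r. r ^ d = \<zeta>}" for r
    using that assms(3) by (auto simp: power_mult power_inverse)
  have card: "card {r. r ^ d = \<zeta>} = d" using assms by (intro card_nth_roots)
  show "(\<Sum>r | r ^ d = \<zeta>. inverse (r ^ e)) = of_nat d * inverse \<zeta> ^ m"
    by (subst sum.cong[OF refl eq]) (simp_all add: card)
  show "(\<Sum>r | r ^ d = \<zeta>. norm (inverse (r ^ e))) = real d * norm (inverse \<zeta>) ^ m"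
    by (subst sum.cong[OF refl arg_cong[of _ _ norm, OF eq]]) (simp_all add: card norm_power)
qed

text \<open>Multiplication by a primitive d-th root of unity \<omega> permutes the roots and
  multiplies the sum by \<omega>^(-e) \<noteq> 1.\<close>

lemma sum_roots_eq_0:
  fixes \<zeta> :: complex
  assumes "d > 0" "\<not> d dvd e"
  shows "(\<Sum>r | r ^ d = \<zeta>. inverse (r ^ e)) = 0"
proof -
  define \<omega> where "\<omega> = exp (2 * of_real pi * \<i> * of_nat 1 / of_nat d)"
  have pow: "\<omega> ^ j = exp (2 * of_real pi * \<i> * of_nat j / of_nat d)" for j
    by (simp add: \<omega>_def exp_of_nat_mult[symmetric] mult_ac)
  have 1: "\<omega> ^ d = 1" "\<omega> ^ e \<noteq> 1"
    using assms complex_root_unity_eq_1[of d d] complex_root_unity_eq_1[of d e] unfolding pow by auto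
  have "\<omega> \<noteq> 0" by (simp add: \<omega>_def)
  let ?T = "\<Sum>r | r ^ d = \<zeta>. inverse (r ^ e)"
  have "?T = (\<Sum>r | r ^ d = \<zeta>. inverse ((\<omega> * r) ^ e))"
    by (rule sum.reindex_bij_witness[where i = "\<lambda>r. \<omega> * r" and j = "\<lambda>r. r / \<omega>"])
      (use \<open>\<omega> \<noteq> 0\<close> 1 in \<open>auto simp: power_mult_distrib power_divide\<close>)
  also have "\<dots> = inverse (\<omega> ^ e) * ?T"
    by (simp add: power_mult_distrib sum_distrib_left)
  finally have "?T * (1 - inverse (\<omega> ^ e)) = 0" by (simp add: algebra_simps)
  moreover have "1 - inverse (\<omega> ^ e) \<noteq> 0" using 1(2) by (metis eq_iff_diff_eq_0 inverse_eq_1_iff)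
  ultimately show ?thesis by simp
qed

context
  fixes k d :: nat and \<Lambda> :: "nat \<Rightarrow> nat \<Rightarrow> real" and p :: "real poly" and M :: real
  assumes k: "k = Suc (Suc d)" and d: "d > 0" and p: "p = vertex_poly k \<Lambda>"
    and M: "M > 0" and bound: "\<And>\<theta>. \<bar>ray k p \<theta>\<bar> \<le> M"
begin

lemma ray1_max:
  assumes "\<bar>ray k p \<theta>\<bar> = M"
  shows "ray1 k p \<theta> = 0"
proof -
  have D: "(ray k p has_real_derivative ray1 k p \<theta>) (at \<theta>)" by (rule ray_ray1) (simp add: k)
  consider "ray k p \<theta> = M" | "ray k p \<theta> = - M" using assms by linarith
  then show ?thesis
  proof cases
    case 1
    then show ?thesis using bound by (intro DERIV_local_max[OF D zero_less_one]) (auto simp: abs_le_iff)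
  next
    case 2
    have "- M \<le> ray k p y" for y using bound[of y] by linarith
    with 2 show ?thesis by (intro DERIV_local_min[OF D zero_less_one]) auto
  qed
qed

lemma ray_root_iff:
  fixes r :: complex
  assumes "\<bar>ray k p \<theta>\<bar> = M"
  shows "r ^ d * of_real (real k * ray k p \<theta>) = 1 \<longleftrightarrow> r ^ d = inverse (of_real (real k * ray k p \<theta>))"
proof -
  have "real k > 0" by (simp add: k)
  then have "complex_of_real (real k * ray k p \<theta>) \<noteq> 0" using assms M by auto
  then show ?thesis by (auto simp: field_simps simp del: of_real_mult)
qed

lemma ray_root_exists:
  assumes "\<bar>ray k p \<theta>\<bar> = M"
  obtains r :: complex where "r \<noteq> 0" "r ^ d = inverse (of_real (real k * ray k p \<theta>))"
proof -
  let ?z = "inverse (complex_of_real (real k * ray k p \<theta>))"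
  have "real k > 0" by (simp add: k)
  then have z: "?z \<noteq> 0" using assms M by auto
  then have "card {r. r ^ d = ?z} \<noteq> 0" using card_nth_roots[OF z d] d by simp
  then obtain r where r: "r ^ d = ?z" by (metis (mono_tags, lifting) card.empty empty_Collect_eq)
  then have "r \<noteq> 0" using z d by (auto simp: zero_power)
  then show thesis using r by (rule that)
qed

text \<open>A critical point on a ray has norm |r|, and |r|^d k |v| = 1. The angle \<theta>0
  witnesses that the bound M is attained: it supplies the critical point against which a minimal one
  is compared.\<close>

lemma minimal_crit_on_ray:
  assumes "\<bar>ray k p \<theta>0\<bar> = M" "r \<noteq> 0"
  shows "(r * of_real (cos \<theta>), r * of_real (sin \<theta>)) \<in> minimal_crit (action k \<Lambda>) \<longleftrightarrow>
    \<bar>ray k p \<theta>\<bar> = M \<and> r ^ d = inverse (of_real (real k * ray k p \<theta>))"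
proof -
  have k0: "real k > 0" by (simp add: k)
  have nrm: "norm (r * of_real (cos \<theta>), r * complex_of_real (sin \<theta>)) = norm r" for r \<theta>
    using sin_cos_squared_add[of \<theta>]
    by (simp add: norm_Pair norm_mult power_mult_distrib add.commute flip: distrib_left)
  have nz: "(r * of_real (cos \<theta>), r * complex_of_real (sin \<theta>)) \<noteq> 0" if "r \<noteq> 0" for r \<theta>
    using nrm[of r \<theta>] that by (metis norm_eq_zero norm_zero)
  have pw: "norm r ^ d * (real k * \<bar>ray k p \<theta>\<bar>) = 1" if "r ^ d * of_real (real k * ray k p \<theta>) = 1" for r :: complex and \<theta>
    using arg_cong[OF that, of norm] by (simp add: norm_mult norm_power abs_mult)
  note crit = crit_on_ray[OF k p]
  note ne = ray_root_iff
  show ?thesis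
  proof
    assume min: "(r * of_real (cos \<theta>), r * of_real (sin \<theta>)) \<in> minimal_crit (action k \<Lambda>)"
    then have c: "r ^ d * of_real (real k * ray k p \<theta>) = 1"
      using crit[OF assms(2)] by (auto simp: minimal_crit_def)
    obtain r0 :: complex where "r0 \<noteq> 0" "r0 ^ d = inverse (of_real (real k * ray k p \<theta>0))"
      by (rule ray_root_exists[OF assms(1)])
    then have r0: "r0 ^ d * of_real (real k * ray k p \<theta>0) = 1" "r0 \<noteq> 0" using ne[OF assms(1)] by blast+
    with r0 have "(r0 * of_real (cos \<theta>0), r0 * of_real (sin \<theta>0)) \<in> crit (action k \<Lambda>) - {0}"
      using crit[of r0 \<theta>0] ray1_max[OF assms(1)] nz[of r0 \<theta>0] by auto
    then have "norm (r * of_real (cos \<theta>), r * complex_of_real (sin \<theta>)) \<le> norm (r0 * of_real (cos \<theta>0), r0 * complex_of_real (sin \<theta>0))"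
      using min by (auto simp: minimal_crit_def)
    then have "norm r \<le> norm r0" by (simp only: nrm)
    then have "norm r ^ d \<le> norm r0 ^ d" by (intro power_mono) auto
    then have "norm r ^ d * (real k * M) \<le> norm r0 ^ d * (real k * M)" using M by (intro mult_right_mono) auto
    also have "\<dots> = norm r ^ d * (real k * \<bar>ray k p \<theta>\<bar>)" using pw[OF r0(1)] pw[OF c] assms(1) by simp
    finally have "M \<le> \<bar>ray k p \<theta>\<bar>" using assms(2) k0 by simp
    then have "\<bar>ray k p \<theta>\<bar> = M" using bound[of \<theta>] by simp
    then show "\<bar>ray k p \<theta>\<bar> = M \<and> r ^ d = inverse (of_real (real k * ray k p \<theta>))"
      using ne c by blast
  next
    assume a: "\<bar>ray k p \<theta>\<bar> = M \<and> r ^ d = inverse (of_real (real k * ray k p \<theta>))"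
    then have c: "r ^ d * of_real (real k * ray k p \<theta>) = 1" using ne by blast
    have "norm (r * of_real (cos \<theta>), r * complex_of_real (sin \<theta>)) \<le> norm q"
      if q: "q \<in> crit (action k \<Lambda>) - {0}" for q
    proof -
      obtain w z where wz: "q = (w, z)" by (cases q)
      then have "(w, z) \<in> real_ratio_points" "(w, z) \<noteq> 0" using q by (auto simp: crit_def)
      then obtain r' \<theta>' where r': "r' \<noteq> 0" "w = r' * of_real (cos \<theta>')" "z = r' * of_real (sin \<theta>')"
        by (rule ray_points_exist[of w z 0])
      then have c': "r' ^ d * of_real (real k * ray k p \<theta>') = 1"
        using q crit[OF r'(1)] unfolding wz by auto
      have "norm r ^ d * (real k * M) = 1" using pw[OF c] a by simp
      also have "1 = norm r' ^ d * (real k * \<bar>ray k p \<theta>'\<bar>)" using pw[OF c'] by simp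
      also have "\<dots> \<le> norm r' ^ d * (real k * M)" using bound[of \<theta>'] k0 by (intro mult_left_mono) auto
      finally have "norm r ^ d \<le> norm r' ^ d" using k0 M by simp
      then have "norm r \<le> norm r'" using d power_le_imp_le_base[of "norm r" "d - 1" "norm r'"] by simp
      then show ?thesis unfolding wz r' nrm .
    qed
    then show "(r * of_real (cos \<theta>), r * of_real (sin \<theta>)) \<in> minimal_crit (action k \<Lambda>)"
      using crit[OF assms(2)] c ray1_max[of \<theta>] a nz[OF assms(2)] by (auto simp: minimal_crit_def)
  qed
qed

text \<open>Maximality of |v| makes v''/v nonpositive; it is nonzero because it is a factor of the
  Hessian determinant at a minimal critical point. The non-degeneracy hypothesis is used only
  through this lemma.\<close>

lemma curvature_pos:
  assumes "\<bar>ray k p \<theta>\<bar> = M"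
    and "\<forall>(w, z) \<in> minimal_crit (action k \<Lambda>). rank (hessian (action k \<Lambda>) w z) = 2"
  shows "- ray2 k p \<theta> / ray k p \<theta> > 0"
proof -
  have v: "ray k p \<theta> \<noteq> 0" using assms(1) M by auto
  note r1 = ray1_max[OF assms(1)]
  obtain r :: complex where r: "r \<noteq> 0" "r ^ d = inverse (of_real (real k * ray k p \<theta>))"
    by (rule ray_root_exists[OF assms(1)])
  have c: "r ^ d * of_real (real k * ray k p \<theta>) = 1" using r(2) ray_root_iff[OF assms(1)] by blast
  have "(r * of_real (cos \<theta>), r * of_real (sin \<theta>)) \<in> minimal_crit (action k \<Lambda>)"
    using minimal_crit_on_ray[OF assms(1) r(1)] assms(1) r(2) by blast
  then have "rank (hessian (action k \<Lambda>) (r * of_real (cos \<theta>)) (r * of_real (sin \<theta>))) = 2"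
    using assms(2) by fast
  from rank_2_det[OF this] have "ray2 k p \<theta> \<noteq> 0"
    unfolding det_hessian_on_ray[OF k p c r1] by auto
  moreover have "ray2 k p \<theta> / (2 * ray k p \<theta>) \<le> 0"
  proof (rule tendsto_upperbound[OF ray_second_order[OF _ r1 v]])
    have "ray k p (\<theta> + u) / ray k p \<theta> \<le> 1" for u
    proof -
      have "\<bar>ray k p (\<theta> + u) / ray k p \<theta>\<bar> \<le> 1"
        using bound[of "\<theta> + u"] assms(1) M by (simp add: abs_divide)
      then show ?thesis by linarith
    qed
    then show "\<forall>\<^sub>F u in at 0. (ray k p (\<theta> + u) / ray k p \<theta> - 1) / u\<^sup>2 \<le> 0"
      by (intro always_eventually) (auto intro!: divide_nonpos_nonneg)
  qed (auto simp: k)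
  ultimately show ?thesis using v by (auto simp: field_simps zero_less_mult_iff mult_le_0_iff zero_less_divide_iff divide_le_0_iff)
qed

text \<open>Here - det H is d/k times the positive curvature, so \<open>csqrt\<close> is an ordinary
  positive root. The root r enters only through r^(-2n), which isolates the sum over the d
  roots.\<close>

lemma saddle_term_on_ray:
  assumes "\<bar>ray k p \<theta>\<bar> = M" "r ^ d = inverse (of_real (real k * ray k p \<theta>))"
    and "- ray2 k p \<theta> / ray k p \<theta> > 0"
  shows "saddle_term (action k \<Lambda>) n (r * of_real (cos \<theta>)) (r * of_real (sin \<theta>)) =
    of_real ((2 * real k / real d) ^ n * sqrt (real k / real d) / sqrt (- ray2 k p \<theta> / ray k p \<theta>)) * inverse (r ^ (2 * n))"
proof -
  have v: "ray k p \<theta> \<noteq> 0" using assms(1) M by auto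
  have c: "r ^ d * of_real (real k * ray k p \<theta>) = 1" using assms(2) ray_root_iff[OF assms(1)] by blast
  have "det (hessian (action k \<Lambda>) (r * of_real (cos \<theta>)) (r * of_real (sin \<theta>))) =
      of_real (real d * ray2 k p \<theta> / (real k * ray k p \<theta>))"
    by (rule det_hessian_on_ray[OF k p c ray1_max[OF assms(1)]])
  then have "- det (hessian (action k \<Lambda>) (r * of_real (cos \<theta>)) (r * of_real (sin \<theta>))) =
      of_real (real d / real k * (- ray2 k p \<theta> / ray k p \<theta>))"
    by simp
  then have 1: "csqrt (- det (hessian (action k \<Lambda>) (r * of_real (cos \<theta>)) (r * of_real (sin \<theta>)))) =
      of_real (sqrt (real d / real k * (- ray2 k p \<theta> / ray k p \<theta>)))"
  proof -
    have "real d / real k * (- ray2 k p \<theta> / ray k p \<theta>) \<ge> 0"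
      using assms(3) by (intro mult_nonneg_nonneg) auto
    with \<open>- det _ = _\<close> show ?thesis by (simp only: of_real_sqrt)
  qed
  have "(- action k \<Lambda> (r * of_real (cos \<theta>)) (r * of_real (sin \<theta>))) powi (- int n)
      = inverse ((r\<^sup>2 * of_real (real d / (2 * real k))) ^ n)"
    unfolding action_on_ray[OF k p c] by (simp add: power_int_minus)
  also have "\<dots> = of_real ((2 * real k / real d) ^ n) * inverse (r ^ (2 * n))"
  proof -
    have "2 * real k / real d = inverse (real d / (2 * real k))" by simp
    moreover have "r ^ (2 * n) = (r\<^sup>2) ^ n" by (rule power_mult)
    ultimately show ?thesis
      by (simp only: power_mult_distrib inverse_mult_distrib of_real_power of_real_inverse power_inverse mult.commute)
  qed
  finally have 2: "(- action k \<Lambda> (r * of_real (cos \<theta>)) (r * of_real (sin \<theta>))) powi (- int n)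
      = of_real ((2 * real k / real d) ^ n) * inverse (r ^ (2 * n))" .
  have 3: "sqrt (real k / real d) / sqrt a = inverse (sqrt (real d / real k * a))" for a
    by (simp add: real_sqrt_mult real_sqrt_divide real_sqrt_inverse divide_inverse mult_ac)
  have 4: "x * y / z = x * (y / z)" for x y z :: real by simp
  define a where "a = - ray2 k p \<theta> / ray k p \<theta>"
  show ?thesis
    unfolding saddle_term_def 1 2 unfolding a_def[symmetric] 4 3 of_real_mult of_real_inverse
    by (simp only: divide_inverse mult_ac)
qed

end

section \<open>Comparison of the two asymptotics\<close>

context
  fixes k d :: nat and \<Lambda> :: "nat \<Rightarrow> nat \<Rightarrow> real" and p :: "real poly" and M :: real
  assumes k: "k = Suc (Suc d)" and d: "d > 0" and p: "p = vertex_poly k \<Lambda>"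
    and M: "M > 0" and bound: "\<And>\<theta>. \<bar>ray k p \<theta>\<bar> \<le> M"
    and nondeg: "\<forall>(w, z) \<in> minimal_crit (action k \<Lambda>). rank (hessian (action k \<Lambda>) w z) = 2"
begin

lemma ray_less_near_max:
  assumes "\<bar>ray k p x\<bar> = M"
  shows "\<forall>\<^sub>F u in at 0. \<bar>ray k p (x + u)\<bar> < M"
proof -
  have v: "ray k p x \<noteq> 0" using assms M by auto
  have "- ray2 k p x / ray k p x > 0" by (rule curvature_pos[OF k d p M bound assms nondeg])
  then have "ray2 k p x / (2 * ray k p x) < 0" by (simp add: field_simps)
  then have 1: "\<forall>\<^sub>F u in at 0. (ray k p (x + u) / ray k p x - 1) / u\<^sup>2 < 0"
    using ray_second_order[of k p x] v ray1_max[OF k d p M bound assms]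
    by (intro order_tendstoD(2)[of _ "ray2 k p x / (2 * ray k p x)"]) (auto simp: k)
  have "isCont (ray k p) x" using ray_continuous[of UNIV k p] by (simp add: continuous_on_eq_continuous_at)
  then have "((\<lambda>u. ray k p (x + u)) \<longlongrightarrow> ray k p x) (at 0)" by (simp add: isCont_iff)
  then have "((\<lambda>u. ray k p (x + u) / ray k p x) \<longlongrightarrow> ray k p x / ray k p x) (at 0)"
    using v by (intro tendsto_divide tendsto_const)
  then have 2: "\<forall>\<^sub>F u in at 0. 0 < ray k p (x + u) / ray k p x"
    using v by (intro order_tendstoD(1)[of _ 1]) auto
  have "\<forall>\<^sub>F u::real in at 0. u \<noteq> 0" by (simp add: eventually_at_filter)
  then show ?thesis using 1 2
  proof eventually_elim
    case (elim u)
    then have "\<bar>ray k p (x + u) / ray k p x\<bar> < 1" by (simp add: divide_less_0_iff abs_less_iff)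
    then show ?case using M by (simp add: abs_divide assms)
  qed
qed

text \<open>By continuity an accumulation point of maximisers would be a maximiser, but positive
  curvature makes maximisers isolated.\<close>

lemma finite_max: "finite {\<theta> \<in> {a..b}. \<bar>ray k p \<theta>\<bar> = M}"
proof (rule ccontr)
  let ?X = "{\<theta> \<in> {a..b}. \<bar>ray k p \<theta>\<bar> = M}"
  assume "infinite ?X"
  then obtain x where x: "x islimpt ?X"
    using compact_Icc[of a b] unfolding compact_eq_Bolzano_Weierstrass by (metis (lifting) mem_Collect_eq subsetI)
  have "closed {\<theta>. \<bar>ray k p \<theta>\<bar> = M}"
    by (intro closed_Collect_eq continuous_intros ray_continuous)
  moreover have "x islimpt {\<theta>. \<bar>ray k p \<theta>\<bar> = M}" using x by (rule islimpt_subset) auto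
  ultimately have "\<bar>ray k p x\<bar> = M" by (auto simp: closed_limpt)
  from ray_less_near_max[OF this] have "\<forall>\<^sub>F y in at x. \<bar>ray k p y\<bar> < M"
    by (subst at_to_0) (simp add: eventually_filtermap add.commute)
  then have "\<forall>\<^sub>F y in at x. y \<notin> ?X" by eventually_elim auto
  with x show False by (simp add: islimpt_iff_eventually)
qed

text \<open>Supplies the end point of the half circle: Laplace's method needs all maximisers in the
  interior.\<close>

lemma nonmax_exists: "\<exists>c. \<bar>ray k p c\<bar> \<noteq> M"
proof (rule ccontr)
  assume "\<not> ?thesis"
  then have "{\<theta> \<in> {0..1}. \<bar>ray k p \<theta>\<bar> = M} = {0..1}" by auto
  then show False using finite_max[of 0 1] infinite_Icc[of "0::real" 1] by simp
qed

text \<open>The angles \<open>\<theta>\<close> and \<open>\<theta> + pi\<close> describe the same complex line, so angles range over an interval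
  of length \<open>pi\<close>; its end points are chosen not to be maximisers.\<close>

lemma minimal_crit_eq:
  assumes "\<bar>ray k p \<theta>0\<bar> = M" "\<bar>ray k p c\<bar> \<noteq> M"
  defines "X \<equiv> {\<theta> \<in> {c..c+pi}. \<bar>ray k p \<theta>\<bar> = M}"
    and "\<rho> \<equiv> \<lambda>\<theta>. {r::complex. r ^ d = inverse (of_real (real k * ray k p \<theta>))}"
    and "f \<equiv> \<lambda>(\<theta>, r::complex). (r * of_real (cos \<theta>), r * of_real (sin \<theta>))"
  shows "X \<subseteq> {c<..<c+pi}" "X \<noteq> {}" "minimal_crit (action k \<Lambda>) = f ` Sigma X \<rho>" "inj_on f (Sigma X \<rho>)"
proof -
  have "\<bar>ray k p (c + pi)\<bar> = \<bar>ray k p c\<bar>" by (simp add: ray_plus_pi abs_mult power_abs)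
  then have "\<bar>ray k p (c + pi)\<bar> \<noteq> M" using assms(2) by simp
  then show X: "X \<subseteq> {c<..<c+pi}" using assms(2) by (auto simp: X_def less_le)
  note iff = minimal_crit_on_ray[OF k d p M bound assms(1)]
  have nz: "r \<noteq> 0" if "\<theta> \<in> X" "r \<in> \<rho> \<theta>" for r \<theta>
  proof
    assume "r = 0"
    have "real k > 0" by (simp add: k)
    then have "inverse (complex_of_real (real k * ray k p \<theta>)) \<noteq> 0" using that(1) M by (auto simp: X_def)
    with that(2) d \<open>r = 0\<close> show False by (simp add: \<rho>_def zero_power)
  qed
  have repr: "\<exists>\<theta> r. \<theta> \<in> X \<and> r \<in> \<rho> \<theta> \<and> q = f (\<theta>, r)" if q: "q \<in> minimal_crit (action k \<Lambda>)" for q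
  proof -
    obtain w z where wz: "q = (w, z)" by (cases q)
    then have "(w, z) \<in> real_ratio_points" "(w, z) \<noteq> 0" using q by (auto simp: minimal_crit_def crit_def)
    then obtain r \<theta> where r: "r \<noteq> 0" "c \<le> \<theta>" "\<theta> < c + pi" "w = r * of_real (cos \<theta>)" "z = r * of_real (sin \<theta>)"
      by (rule ray_points_exist)
    then have "\<bar>ray k p \<theta>\<bar> = M \<and> r ^ d = inverse (of_real (real k * ray k p \<theta>))"
      using iff[OF r(1)] q unfolding wz by blast
    then show ?thesis using r wz by (intro exI[of _ \<theta>] exI[of _ r]) (auto simp: X_def \<rho>_def f_def)
  qed
  obtain r0 :: complex where "r0 \<noteq> 0" "r0 ^ d = inverse (of_real (real k * ray k p \<theta>0))"
    by (rule ray_root_exists[OF k d p M bound assms(1)])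
  then have "(r0 * of_real (cos \<theta>0), r0 * of_real (sin \<theta>0)) \<in> minimal_crit (action k \<Lambda>)"
    using iff assms(1) by blast
  then show "X \<noteq> {}" using repr by blast
  show "minimal_crit (action k \<Lambda>) = f ` Sigma X \<rho>"
  proof (intro equalityI subsetI)
    fix q assume "q \<in> minimal_crit (action k \<Lambda>)"
    from repr[OF this] show "q \<in> f ` Sigma X \<rho>" by blast
  next
    fix q assume "q \<in> f ` Sigma X \<rho>"
    then obtain \<theta> r where "\<theta> \<in> X" "r \<in> \<rho> \<theta>" "q = f (\<theta>, r)" by auto
    then show "q \<in> minimal_crit (action k \<Lambda>)"
      using iff[OF nz[of \<theta> r]] by (auto simp: X_def \<rho>_def f_def)
  qed
  show "inj_on f (Sigma X \<rho>)"
  proof (rule inj_onI, clarify)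
    fix \<theta> r \<theta>' r' assume a: "\<theta> \<in> X" "r \<in> \<rho> \<theta>" "\<theta>' \<in> X" "r' \<in> \<rho> \<theta>'" "f (\<theta>, r) = f (\<theta>', r')"
    \<comment> \<open>The end points are excluded from \<open>X\<close>, so the difference is
      strictly less than pi, as uniqueness of the angle requires.\<close>
    have "\<bar>\<theta> - \<theta>'\<bar> < pi" using subsetD[OF X a(1)] subsetD[OF X a(3)] by auto
    with ray_points_unique[OF nz[OF a(1,2)] nz[OF a(3,4)] this] a(5)
    show "\<theta> = \<theta>' \<and> r = r'" by (auto simp: f_def)
  qed
qed

text \<open>After the sum over roots only powers of k v(\<theta>) are left. Pulling out (k M)^m
  reduces v(\<theta>) to its sign, so the saddle sum and its scale share the positive factor
  \<open>C m\<close>, and all cancellation sits in a sum of signed constants.\<close>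

lemma saddle_sums:
  assumes "\<bar>ray k p \<theta>0\<bar> = M" "\<bar>ray k p c\<bar> \<noteq> M" "n > 0"
  defines "X \<equiv> {\<theta> \<in> {c..c+pi}. \<bar>ray k p \<theta>\<bar> = M}"
    and "\<alpha> \<equiv> \<lambda>\<theta>. - ray2 k p \<theta> / ray k p \<theta>"
    and "C \<equiv> \<lambda>m. 1 / (2 * pi) * fact (n - 1) * ((2 * real k / real d) ^ n * sqrt (real k / real d)) * (real d * (real k * M) ^ m)"
  shows "\<not> d dvd 2 * n \<Longrightarrow> saddle_sum (action k \<Lambda>) n = 0"
    and "\<And>m. d * m = 2 * n \<Longrightarrow>
      saddle_sum (action k \<Lambda>) n = of_real (C m * (\<Sum>\<theta>\<in>X. (ray k p \<theta> / M) ^ m / sqrt (\<alpha> \<theta>)))"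
    and "\<And>m. d * m = 2 * n \<Longrightarrow>
      saddle_scale (action k \<Lambda>) n = C m * (\<Sum>\<theta>\<in>X. 1 / sqrt (\<alpha> \<theta>))"
proof -
  define \<rho> where "\<rho> = (\<lambda>\<theta>. {r::complex. r ^ d = inverse (of_real (real k * ray k p \<theta>))})"
  define f where "f = (\<lambda>(\<theta>, r::complex). (r * of_real (cos \<theta>), r * of_real (sin \<theta>)))"
  define K where "K = (2 * real k / real d) ^ n * sqrt (real k / real d)"
  note mc = minimal_crit_eq[OF assms(1,2), folded X_def \<rho>_def f_def]
  have finX: "finite X" unfolding X_def by (rule finite_max)
  have fin\<rho>: "finite (\<rho> \<theta>)" for \<theta> unfolding \<rho>_def using d by (intro finite_nth_roots)
  have sum_mc: "(\<Sum>(w, z)\<in>minimal_crit (action k \<Lambda>). F w z) =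
      (\<Sum>\<theta>\<in>X. \<Sum>r\<in>\<rho> \<theta>. F (r * of_real (cos \<theta>)) (r * of_real (sin \<theta>)))" for F :: "complex \<Rightarrow> complex \<Rightarrow> 'z::comm_monoid_add"
    unfolding mc(3) by (subst sum.reindex[OF mc(4)], subst sum.Sigma)
      (auto simp: f_def finX fin\<rho> intro!: sum.cong)
  have \<alpha>: "\<alpha> \<theta> > 0" if "\<theta> \<in> X" for \<theta>
    unfolding \<alpha>_def using that by (intro curvature_pos[OF k d p M bound _ nondeg]) (auto simp: X_def)
  have st: "saddle_term (action k \<Lambda>) n (r * of_real (cos \<theta>)) (r * of_real (sin \<theta>)) =
      of_real (K / sqrt (\<alpha> \<theta>)) * inverse (r ^ (2 * n))" if "\<theta> \<in> X" "r \<in> \<rho> \<theta>" for \<theta> r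
    unfolding \<alpha>_def K_def using that \<alpha>[OF that(1)]
    by (intro saddle_term_on_ray[OF k d p M bound]) (auto simp: X_def \<rho>_def \<alpha>_def)
  have G: "Gamma (of_nat n) = (fact (n - 1) :: real)" "Gamma (of_nat n) = complex_of_real (fact (n - 1))"
    using Gamma_fact[of "n - 1", where 'a = real] Gamma_fact[of "n - 1", where 'a = complex] \<open>n > 0\<close>
    by (simp_all add: of_nat_diff)
  have \<zeta>: "inverse (complex_of_real (real k * ray k p \<theta>)) \<noteq> 0" if "\<theta> \<in> X" for \<theta>
  proof -
    have "real k > 0" by (simp add: k)
    then show ?thesis using that M by (auto simp: X_def)
  qed
  have ssum: "saddle_sum (action k \<Lambda>) n = of_real (1 / (2 * pi) * fact (n - 1)) *
      (\<Sum>\<theta>\<in>X. of_real (K / sqrt (\<alpha> \<theta>)) * (\<Sum>r\<in>\<rho> \<theta>. inverse (r ^ (2 * n))))"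
    unfolding saddle_sum_def sum_mc G(2) by (simp add: st sum_distrib_left)
  have sscale: "saddle_scale (action k \<Lambda>) n = 1 / (2 * pi) * fact (n - 1) *
      (\<Sum>\<theta>\<in>X. K / sqrt (\<alpha> \<theta>) * (\<Sum>r\<in>\<rho> \<theta>. norm (inverse (r ^ (2 * n)))))"
  proof -
    have "K \<ge> 0" by (simp add: K_def)
    then have "norm (saddle_term (action k \<Lambda>) n (r * of_real (cos \<theta>)) (r * of_real (sin \<theta>))) =
        K / sqrt (\<alpha> \<theta>) * norm (inverse (r ^ (2 * n)))" if "\<theta> \<in> X" "r \<in> \<rho> \<theta>" for \<theta> r
      using \<alpha>[OF that(1)] unfolding st[OF that] norm_mult norm_of_real by simp
    then show ?thesis
      unfolding saddle_scale_def sum_mc G(1) by (simp add: sum_distrib_left)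
  qed
  show "saddle_sum (action k \<Lambda>) n = 0" if "\<not> d dvd 2 * n"
    unfolding ssum \<rho>_def using sum_roots_eq_0[OF d that] by simp
  fix m assume m: "d * m = 2 * n"
  have "saddle_sum (action k \<Lambda>) n = of_real (1 / (2 * pi) * fact (n - 1)) *
      (\<Sum>\<theta>\<in>X. of_real (K / sqrt (\<alpha> \<theta>)) * (of_nat d * of_real (real k * ray k p \<theta>) ^ m))"
    unfolding ssum \<rho>_def using sum_roots(1)[OF \<zeta> d m] by simp
  also have "\<dots> = of_real (1 / (2 * pi) * fact (n - 1) *
      (\<Sum>\<theta>\<in>X. K / sqrt (\<alpha> \<theta>) * (real d * (real k * ray k p \<theta>) ^ m)))"
    by simp
  also have "(\<Sum>\<theta>\<in>X. K / sqrt (\<alpha> \<theta>) * (real d * (real k * ray k p \<theta>) ^ m))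
      = K * (real d * (real k * M) ^ m) * (\<Sum>\<theta>\<in>X. (ray k p \<theta> / M) ^ m / sqrt (\<alpha> \<theta>))"
    unfolding sum_distrib_left using M by (intro sum.cong refl) (simp add: power_mult_distrib power_divide)
  finally show "saddle_sum (action k \<Lambda>) n = of_real (C m * (\<Sum>\<theta>\<in>X. (ray k p \<theta> / M) ^ m / sqrt (\<alpha> \<theta>)))"
    by (simp only: C_def K_def mult.assoc)
  have "saddle_scale (action k \<Lambda>) n = 1 / (2 * pi) * fact (n - 1) *
      (\<Sum>\<theta>\<in>X. K / sqrt (\<alpha> \<theta>) * (real d * (real k * M) ^ m))"
    unfolding sscale \<rho>_def using sum_roots(2)[OF \<zeta> d m]
    by (simp add: norm_inverse norm_mult X_def)
  also have "(\<Sum>\<theta>\<in>X. K / sqrt (\<alpha> \<theta>) * (real d * (real k * M) ^ m)) =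
      K * (real d * (real k * M) ^ m) * (\<Sum>\<theta>\<in>X. 1 / sqrt (\<alpha> \<theta>))"
    unfolding sum_distrib_left by (intro sum.cong refl) simp
  finally show "saddle_scale (action k \<Lambda>) n = C m * (\<Sum>\<theta>\<in>X. 1 / sqrt (\<alpha> \<theta>))"
    by (simp only: C_def K_def mult.assoc)
qed

text \<open>\<open>C\<close> is the factor of \<open>saddle_sums\<close>, so the comparison reduces
  to \<open>e\<close>. The exact prefactor of the integral is C times a quantity tending to 1 / sqrt
  (2 pi), which cancels the sqrt (2 pi) of Laplace's method.\<close>

lemma graph_sum_asymptotics:
  assumes "\<bar>ray k p \<theta>0\<bar> = M" "\<bar>ray k p c\<bar> \<noteq> M"
  defines "X \<equiv> {\<theta> \<in> {c..c+pi}. \<bar>ray k p \<theta>\<bar> = M}"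
    and "\<alpha> \<equiv> \<lambda>\<theta>. - ray2 k p \<theta> / ray k p \<theta>"
    and "C \<equiv> \<lambda>n m. 1 / (2 * pi) * fact (n - 1) * ((2 * real k / real d) ^ n * sqrt (real k / real d)) * (real d * (real k * M) ^ m)"
  obtains e where "e \<longlonglongrightarrow> 0" "\<And>n m. n > 0 \<Longrightarrow> d * m = 2 * n \<Longrightarrow>
     graph_sum k \<Lambda> n = C n m * ((\<Sum>\<theta>\<in>X. (ray k p \<theta> / M) ^ m / sqrt (\<alpha> \<theta>)) + e m)"
proof -
  define S where "S = (\<lambda>m. \<Sum>\<theta>\<in>X. (ray k p \<theta> / M) ^ m / sqrt (\<alpha> \<theta>))"
  define J where "J = (\<lambda>m. sqrt (real m) * integral {c..c+pi} (\<lambda>x. (ray k p x / M) ^ m))"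
  have finX: "finite X" unfolding X_def by (rule finite_max)
  have \<alpha>: "\<alpha> \<theta> > 0" if "\<theta> \<in> X" for \<theta>
    unfolding \<alpha>_def using that by (intro curvature_pos[OF k d p M bound _ nondeg]) (auto simp: X_def)
  have "(\<lambda>m. J m - (\<Sum>\<theta>\<in>X. (ray k p \<theta> / M) ^ m * sqrt (2 * pi / \<alpha> \<theta>))) \<longlonglongrightarrow> 0"
    unfolding J_def
  proof (rule laplace_method[OF _ finX])
    show "continuous_on {c..c+pi} (\<lambda>x. ray k p x / M)"
      using M by (intro continuous_intros ray_continuous) auto
    show "X \<subseteq> {c<..<c+pi}" unfolding X_def by (rule minimal_crit_eq(1)[OF assms(1,2)])
    fix x
    show "\<bar>ray k p x / M\<bar> < 1" if "x \<in> {c..c+pi} - X"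
      using that M bound[of x] by (auto simp: X_def abs_divide less_le)
    assume x: "x \<in> X"
    then have mx: "\<bar>ray k p x\<bar> = M" by (simp add: X_def)
    then show "\<bar>ray k p x / M\<bar> = 1" using M by (simp add: abs_divide)
    show "\<alpha> x > 0" by (rule \<alpha>[OF x])
    have "((\<lambda>u. (ray k p (x + u) / ray k p x - 1) / u\<^sup>2) \<longlongrightarrow> ray2 k p x / (2 * ray k p x)) (at 0)"
      using mx M by (intro ray_second_order ray1_max[OF k d p M bound mx]) (auto simp: k)
    then show "((\<lambda>u. (ray k p (x + u) / M / (ray k p x / M) - 1) / u\<^sup>2) \<longlongrightarrow> - \<alpha> x / 2) (at 0)"
      using M by (simp add: \<alpha>_def mult.commute)
  qed
  also have "(\<lambda>m. J m - (\<Sum>\<theta>\<in>X. (ray k p \<theta> / M) ^ m * sqrt (2 * pi / \<alpha> \<theta>))) = (\<lambda>m. J m - sqrt (2 * pi) * S m)"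
    unfolding S_def sum_distrib_left real_sqrt_divide by (simp add: mult.commute)
  finally have J: "(\<lambda>m. J m - sqrt (2 * pi) * S m) \<longlonglongrightarrow> 0" .
  obtain \<tau> where \<tau>: "\<tau> \<longlonglongrightarrow> sqrt (8 * pi * real d / real k ^ 3)"
    "\<And>m n. d * m = 2 * n \<Longrightarrow> \<tau> m = sqrt (real m) * ((real k / 2) ^ m * (real k / real d) ^ n)
        * (fact m * fact n / fact (m + n + 1))"
    by (rule beta_asymptotics[OF d, of k]) (auto simp: k)
  have k0: "real k > 0" "real d > 0" using d by (simp_all add: k)
  \<comment> \<open>The quotient of the exact prefactor and \<open>C\<close>. For d m = 2 n the
    middle fraction is n / (m + n + 1), which replaces n! and (m + n + 1)! in \<tau> by (n - 1)! and
    (m + n)!; in terms of m alone it has a limit along all m.\<close>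
  define \<sigma> where "\<sigma> = (\<lambda>m. 2 / (real d * sqrt (real k / real d)) * (real d * real m / (real k * real m + 2)) / \<tau> m)"
  have "(\<lambda>m. real d * real m / (real k * real m + 2)) \<longlonglongrightarrow> real d * inverse (real k)"
    using k0 by real_asymp
  then have L: "(\<lambda>m. real d * real m / (real k * real m + 2)) \<longlonglongrightarrow> real d / real k"
    by (simp only: divide_inverse)
  have "\<sigma> \<longlonglongrightarrow> 2 / (real d * sqrt (real k / real d)) * (real d / real k) / sqrt (8 * pi * real d / real k ^ 3)"
    unfolding \<sigma>_def by (rule tendsto_divide[OF tendsto_mult[OF tendsto_const L] \<tau>(1)]) (use k0 in auto)
  also have "2 / (real d * sqrt (real k / real d)) * (real d / real k) / sqrt (8 * pi * real d / real k ^ 3) = 1 / sqrt (2 * pi)"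
  proof -
    have "sqrt (real k / real d) * sqrt (8 * pi * real d / real k ^ 3) = sqrt ((2 / real k)\<^sup>2 * (2 * pi))"
      unfolding real_sqrt_mult[symmetric] using k0 by (simp add: power2_eq_square power3_eq_cube)
    also have "\<dots> = 2 / real k * sqrt (2 * pi)"
      using k0 by (simp only: real_sqrt_mult real_sqrt_abs) simp
    finally have q: "sqrt (real k / real d) * sqrt (8 * pi * real d / real k ^ 3) = 2 / real k * sqrt (2 * pi)" .
    have "2 / (real d * sqrt (real k / real d)) * (real d / real k) / sqrt (8 * pi * real d / real k ^ 3)
        = 2 / real k / (sqrt (real k / real d) * sqrt (8 * pi * real d / real k ^ 3))"
      using k0 by simp
    also have "\<dots> = 1 / sqrt (2 * pi)" unfolding q using k0 by simp
    finally show ?thesis .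
  qed
  finally have \<sigma>: "\<sigma> \<longlonglongrightarrow> 1 / sqrt (2 * pi)" .
  \<comment> \<open>This is \<sigma> J - S, regrouped because S does not converge: the first summand
    is a null sequence times the bounded S, the second a convergent sequence times a null
    sequence.\<close>
  define e where "e = (\<lambda>m. (\<sigma> m * sqrt (2 * pi) - 1) * S m + \<sigma> m * (J m - sqrt (2 * pi) * S m))"
  have "e \<longlonglongrightarrow> 0"
  proof -
    have "\<bar>S m\<bar> \<le> (\<Sum>\<theta>\<in>X. 1 / sqrt (\<alpha> \<theta>))" for m
      unfolding S_def
    proof (rule order_trans[OF sum_abs], intro sum_mono)
      fix \<theta> assume "\<theta> \<in> X"
      then show "\<bar>(ray k p \<theta> / M) ^ m / sqrt (\<alpha> \<theta>)\<bar> \<le> 1 / sqrt (\<alpha> \<theta>)"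
        using M \<alpha>[of \<theta>] by (simp add: X_def abs_divide power_abs)
    qed
    note Sb = this
    have "(\<lambda>m. \<bar>\<sigma> m * sqrt (2 * pi) - 1\<bar> * (\<Sum>\<theta>\<in>X. 1 / sqrt (\<alpha> \<theta>)))
        \<longlonglongrightarrow> \<bar>1 / sqrt (2 * pi) * sqrt (2 * pi) - 1\<bar> * (\<Sum>\<theta>\<in>X. 1 / sqrt (\<alpha> \<theta>))"
      by (intro tendsto_mult tendsto_rabs tendsto_diff tendsto_const \<sigma>)
    then have "(\<lambda>m. \<bar>\<sigma> m * sqrt (2 * pi) - 1\<bar> * (\<Sum>\<theta>\<in>X. 1 / sqrt (\<alpha> \<theta>))) \<longlonglongrightarrow> 0" by simp
    then have 1: "(\<lambda>m. (\<sigma> m * sqrt (2 * pi) - 1) * S m) \<longlonglongrightarrow> 0"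
      by (rule Lim_null_comparison[rotated])
        (auto simp: abs_mult intro!: always_eventually mult_left_mono Sb)
    have "(\<lambda>m. \<sigma> m * (J m - sqrt (2 * pi) * S m)) \<longlonglongrightarrow> 1 / sqrt (2 * pi) * 0"
      by (intro tendsto_mult \<sigma> J)
    from tendsto_add[OF 1 this] show ?thesis unfolding e_def by simp
  qed
  moreover have "graph_sum k \<Lambda> n = C n m * (S m + e m)" if n: "n > 0" and m: "d * m = 2 * n" for n m
  proof -
    have m0: "m > 0" using n m by (cases m) auto
    have kd: "k \<ge> 3" "(k - 2) * m = 2 * n" using d m by (simp_all add: k)
    have "graph_sum k \<Lambda> n = 2 ^ (n + m) * fact (n + m) / (pi * fact m) *
        integral {c..c+pi} (\<lambda>x. ray k p x ^ m)"
      unfolding ray_def p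
      by (rule graph_sum_integral[OF kd degree_vertex_poly]) (simp add: coeff_vertex_poly)
    also have "integral {c..c+pi} (\<lambda>x. ray k p x ^ m) = M ^ m * (J m / sqrt (real m))"
    proof -
      have "integral {c..c+pi} (\<lambda>x. ray k p x ^ m) = integral {c..c+pi} (\<lambda>x. M ^ m * (ray k p x / M) ^ m)"
        using M by (simp add: power_divide)
      then show ?thesis using m0 by (simp only: integral_mult_right J_def) simp
    qed
    also have "2 ^ (n + m) * fact (n + m) / (pi * fact m) * (M ^ m * (J m / sqrt (real m))) = C n m * \<sigma> m * J m"
    proof -
      have nm: "real k * real m + 2 = 2 * (real m + real n + 1)" "real d * real m = 2 * real n"
      proof -
        show 1: "real d * real m = 2 * real n" using arg_cong[OF m, of real] by simp
        show "real k * real m + 2 = 2 * (real m + real n + 1)" using 1 by (simp add: k algebra_simps)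
      qed
      have f1: "fact n = real n * fact (n - 1)" using n by (simp add: fact_reduce)
      have f2: "fact (m + n + 1) = (real m + real n + 1) * fact (n + m)" by (simp add: add_ac)
      have pw: "(2::real) ^ (n + m) * ((real k / 2) ^ m * (real k / real d) ^ n) = real k ^ m * (2 * real k / real d) ^ n"
        using k0 by (simp add: power_add power_divide power_mult_distrib)
      have t: "\<tau> m = sqrt (real m) * ((real k / 2) ^ m * (real k / real d) ^ n) * (fact m * (real n * fact (n - 1)) / ((real m + real n + 1) * fact (n + m)))"
        unfolding \<tau>(2)[OF m] f1 f2 ..
      have "\<tau> m \<noteq> 0" unfolding t using m0 n k0 by (auto simp: add_nonneg_eq_0_iff)
      define q where "q = (real k / 2) ^ m * (real k / real d) ^ n"
      have q0: "q \<noteq> 0" using k0 by (simp add: q_def)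
      define s where "s = sqrt (real k / real d)"
      have s0: "s \<noteq> 0" using k0 by (simp add: s_def)
      have "\<sigma> m = 2 / (real d * s) * (real n / (real m + real n + 1)) / \<tau> m"
      proof -
        have "2 * real n / (2 * (real m + real n + 1)) = real n / (real m + real n + 1)"
          by (rule mult_divide_mult_cancel_left) simp
        then show ?thesis unfolding \<sigma>_def nm s_def by (simp only:)
      qed
      also have "\<dots> = 2 / (real d * s) * fact (n + m) / (sqrt (real m) * q * (fact m * fact (n - 1)))"
      proof -
        have "2 / (D * s) * (r / b) / (Q * (fm * (r * fn) / (b * F))) = 2 / (D * s) * F / (Q * (fm * fn))"
          if "r \<noteq> 0" "b \<noteq> 0" "F \<noteq> 0" for D r b F Q fm fn :: real
          using that by (simp add: field_simps)
        then show ?thesis unfolding t q_def[symmetric] using n by (simp add: add_nonneg_eq_0_iff)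
      qed
      finally have sg: "\<sigma> m = 2 / (real d * s) * fact (n + m) / (sqrt (real m) * q * (fact m * fact (n - 1)))" .
      have "C n m * \<sigma> m = 1 / pi * ((2 * real k / real d) ^ n * real k ^ m) * M ^ m * fact (n + m) / (sqrt (real m) * q * fact m)"
      proof -
        have "1 / (2 * pi) * fn * (Z * s) * (D * (Km * Mm)) * (2 / (D * s) * F / (Q * (fm * fn)))
            = 1 / pi * (Z * Km) * Mm * F / (Q * fm)" if "D \<noteq> 0" "fn \<noteq> 0" for fn Z D Km Mm F Q fm :: real
          using that s0 by simp
        then show ?thesis
          unfolding C_def sg s_def[symmetric] power_mult_distrib[of "real k"] using k0 s0 by simp
      qed
      also have "(2 * real k / real d) ^ n * real k ^ m = 2 ^ (n + m) * q"
        unfolding q_def pw by (rule mult.commute)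
      finally have "C n m * \<sigma> m = 2 ^ (n + m) * fact (n + m) / (pi * fact m) * M ^ m / sqrt (real m)"
        using q0 by (simp add: field_simps)
      then show ?thesis by simp
    qed
    also have "C n m * \<sigma> m * J m = C n m * (S m + e m)" by (simp add: e_def algebra_simps)
    finally show ?thesis .
  qed
  ultimately show thesis by (intro that[of e]) (auto simp: S_def)
qed

end

lemma ray_attains_max:
  obtains \<theta>0 where "\<And>\<theta>. \<bar>ray k p \<theta>\<bar> \<le> \<bar>ray k p \<theta>0\<bar>"
proof -
  have "continuous_on {0..2*pi} (\<lambda>\<theta>. \<bar>ray k p \<theta>\<bar>)"
    by (intro continuous_intros ray_continuous)
  from continuous_attains_sup[OF compact_Icc _ this]
  obtain \<theta>0 where max: "\<And>\<theta>. \<theta> \<in> {0..2*pi} \<Longrightarrow> \<bar>ray k p \<theta>\<bar> \<le> \<bar>ray k p \<theta>0\<bar>" by fastforce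
  have "\<bar>ray k p \<theta>\<bar> \<le> \<bar>ray k p \<theta>0\<bar>" for \<theta>
  proof -
    obtain t where "0 \<le> t" "t < 2 * pi" "cos \<theta> = cos t" "sin \<theta> = sin t"
      using sincos_total_2pi[of "cos \<theta>" "sin \<theta>"] by auto
    then show ?thesis using max[of t] by (simp add: ray_def)
  qed
  then show thesis by (rule that)
qed

text \<open>Every a x is 1 or -1, so the sum depends only on the parity of m and takes at most two
  values.\<close>

lemma power_sum_gap:
  fixes a b :: "'a \<Rightarrow> real"
  assumes "\<And>x. x \<in> X \<Longrightarrow> \<bar>a x\<bar> = 1"
  obtains \<eta> where "\<eta> > 0" "\<And>m. (\<Sum>x\<in>X. a x ^ m * b x) \<noteq> 0 \<Longrightarrow> \<eta> \<le> \<bar>\<Sum>x\<in>X. a x ^ m * b x\<bar>"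
proof -
  define S where "S = (\<lambda>m. \<Sum>x\<in>X. a x ^ m * b x)"
  have S: "S m = S (m mod 2)" for m
    unfolding S_def
  proof (intro sum.cong refl)
    fix x assume "x \<in> X"
    then have "a x = 1 \<or> a x = -1" using assms[of x] by linarith
    then have "(a x)\<^sup>2 = 1" by auto
    moreover have "a x ^ m = ((a x)\<^sup>2) ^ (m div 2) * a x ^ (m mod 2)"
      by (simp flip: power_mult power_add)
    ultimately show "a x ^ m * b x = a x ^ (m mod 2) * b x" by simp
  qed
  \<comment> \<open>The smallest absolute value among the nonzero ones; the default 1 covers the
    case that both vanish.\<close>
  define \<eta> where "\<eta> = (if S 0 = 0 then if S 1 = 0 then 1 else \<bar>S 1\<bar> else if S 1 = 0 then \<bar>S 0\<bar> else min \<bar>S 0\<bar> \<bar>S 1\<bar>)"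
  have "\<eta> > 0" by (simp add: \<eta>_def)
  moreover have "\<eta> \<le> \<bar>S m\<bar>" if "S m \<noteq> 0" for m
  proof -
    have "m mod 2 = 0 \<or> m mod 2 = 1" by auto
    then show ?thesis using that unfolding S[of m] by (auto simp: \<eta>_def)
  qed
  ultimately show thesis using that unfolding S_def by blast
qed

theorem theorem5p4:
  fixes k :: nat and \<Lambda> :: "nat \<Rightarrow> nat \<Rightarrow> real"
  assumes "k \<ge> 3"
    and "\<forall>(w, z) \<in> minimal_crit (action k \<Lambda>). rank (hessian (action k \<Lambda>) w z) = 2"
  shows "(\<lambda>n. complex_of_real (graph_sum k \<Lambda> n))
             \<sim>[nonzero_at_top (saddle_sum (action k \<Lambda>))] saddle_sum (action k \<Lambda>) \<and>
         (\<lambda>n. norm (complex_of_real (graph_sum k \<Lambda> n) - saddle_sum (action k \<Lambda>) n))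
             \<in> o[sequentially](saddle_scale (action k \<Lambda>))"
proof -
  define d where "d = k - 2"
  have d: "d > 0" and k: "k = Suc (Suc d)" using assms(1) by (auto simp: d_def)
  define p where "p = vertex_poly k \<Lambda>"
  let ?G = "\<lambda>n. complex_of_real (graph_sum k \<Lambda> n)" and ?S = "saddle_sum (action k \<Lambda>)"
    and ?C = "saddle_scale (action k \<Lambda>)"
  obtain \<theta>0 where max: "\<And>\<theta>. \<bar>ray k p \<theta>\<bar> \<le> \<bar>ray k p \<theta>0\<bar>"
    using ray_attains_max[of k p] by blast
  define M where "M = \<bar>ray k p \<theta>0\<bar>"
  have small: "\<forall>\<^sub>F n in sequentially. norm (?G n - ?S n) \<le> \<epsilon> * norm (?C n)"
    and small': "\<forall>\<^sub>F n in sequentially. ?S n \<noteq> 0 \<longrightarrow> norm (?G n - ?S n) \<le> \<epsilon> * norm (?S n)" if \<epsilon>: "\<epsilon> > 0" for \<epsilon>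
  proof -
    have "(\<forall>\<^sub>F n in sequentially. norm (?G n - ?S n) \<le> \<epsilon> * norm (?C n)) \<and>
      (\<forall>\<^sub>F n in sequentially. ?S n \<noteq> 0 \<longrightarrow> norm (?G n - ?S n) \<le> \<epsilon> * norm (?S n))"
    \<comment> \<open>For M = 0 the form V vanishes identically and nothing can be normalised by M;
      but then there are no nonzero critical points.\<close>
    proof (cases "M = 0")
      case True
      then have zero: "ray k p \<theta> = 0" for \<theta> using max[of \<theta>] by (simp add: M_def)
      have "minimal_crit (action k \<Lambda>) = {}"
      proof (rule ccontr)
        assume "minimal_crit (action k \<Lambda>) \<noteq> {}"
        then obtain w z where q: "(w, z) \<in> crit (action k \<Lambda>)" "(w, z) \<noteq> 0" by (auto simp: minimal_crit_def)
        then have "(w, z) \<in> real_ratio_points" by (simp add: crit_def)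
        then obtain r \<theta> where r: "r \<noteq> 0" "w = r * of_real (cos \<theta>)" "z = r * of_real (sin \<theta>)"
          using q(2) by (rule ray_points_exist[of w z 0])
        then show False using crit_on_ray[OF k p_def r(1), of \<theta>] q(1) zero by simp
      qed
      then have "?S n = 0" for n by (simp add: saddle_sum_def)
      \<comment> \<open>At n = 0 the empty graph contributes 1.\<close>
      moreover have "graph_sum k \<Lambda> n = 0" if "n > 0" for n
      proof (cases "d dvd 2 * n")
        case True
        then obtain m where m: "2 * n = d * m" by (auto elim: dvdE)
        then have "m > 0" using that by (cases m) auto
        have "(k - 2) * m = 2 * n" using m by (simp add: d_def)
        then have "graph_sum k \<Lambda> n = 2 ^ (n + m) * fact (n + m) / (pi * fact m) *
            integral {0..0+pi} (\<lambda>x. ray k p x ^ m)"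
          unfolding ray_def p_def
          by (intro graph_sum_integral[OF assms(1) _ degree_vertex_poly]) (simp_all add: coeff_vertex_poly)
        then show ?thesis using zero \<open>m > 0\<close> by (simp add: power_0_left)
      qed (use graph_sum_eq_0[OF assms(1)] in \<open>simp add: d_def\<close>)
      ultimately have "\<forall>\<^sub>F n in sequentially. ?G n - ?S n = 0"
        by (auto intro!: eventually_mono[OF eventually_gt_at_top[of 0]])
      then show ?thesis using \<epsilon> by (auto elim!: eventually_mono)
    next
      case False
      then have M: "M > 0" by (simp add: M_def)
      have bound: "\<And>\<theta>. \<bar>ray k p \<theta>\<bar> \<le> M" using max by (simp add: M_def)
      have \<theta>0: "\<bar>ray k p \<theta>0\<bar> = M" by (simp add: M_def)
      note facts = k d p_def M bound assms(2)
      obtain c where c: "\<bar>ray k p c\<bar> \<noteq> M" using nonmax_exists[OF facts] by blast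
      define X where "X = {\<theta> \<in> {c..c+pi}. \<bar>ray k p \<theta>\<bar> = M}"
      define \<alpha> where "\<alpha> = (\<lambda>\<theta>. - ray2 k p \<theta> / ray k p \<theta>)"
      define C where "C = (\<lambda>n m. 1 / (2 * pi) * fact (n - 1) * ((2 * real k / real d) ^ n * sqrt (real k / real d)) * (real d * (real k * M) ^ m))"
      define S where "S = (\<lambda>m. \<Sum>\<theta>\<in>X. (ray k p \<theta> / M) ^ m / sqrt (\<alpha> \<theta>))"
      define T where "T = (\<Sum>\<theta>\<in>X. 1 / sqrt (\<alpha> \<theta>))"
      note ss = saddle_sums[OF facts \<theta>0 c, folded X_def]
      obtain e where e: "e \<longlonglongrightarrow> 0" "\<And>n m. n > 0 \<Longrightarrow> d * m = 2 * n \<Longrightarrow> graph_sum k \<Lambda> n = C n m * (S m + e m)"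
        using graph_sum_asymptotics[OF facts \<theta>0 c] unfolding X_def \<alpha>_def C_def S_def by blast
      have Cpos: "C n m > 0" for n m using d M unfolding C_def by (simp add: k)
      have \<alpha>: "\<alpha> \<theta> > 0" if "\<theta> \<in> X" for \<theta>
        unfolding \<alpha>_def using that by (intro curvature_pos[OF k d p_def M bound _ assms(2)]) (auto simp: X_def)
      have "T > 0"
        unfolding T_def using finite_max[OF facts] minimal_crit_eq(2)[OF facts \<theta>0 c] \<alpha>
        by (intro sum_pos) (auto simp: X_def)
      obtain \<eta> where \<eta>: "\<eta> > 0" "\<And>m. S m \<noteq> 0 \<Longrightarrow> \<eta> \<le> \<bar>S m\<bar>"
        using power_sum_gap[of X "\<lambda>\<theta>. ray k p \<theta> / M" "\<lambda>\<theta>. 1 / sqrt (\<alpha> \<theta>)"] M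
        unfolding S_def by (auto simp: X_def abs_divide)
      \<comment> \<open>One threshold for both estimates: T measures the error against the scale,
        \<eta> against the saddle sum where that is nonzero.\<close>
      have "\<epsilon> * min T \<eta> > 0" using \<epsilon> \<open>T > 0\<close> \<eta>(1) by simp
      then have "\<forall>\<^sub>F m in sequentially. \<bar>e m\<bar> < \<epsilon> * min T \<eta>"
        using tendsto_rabs[OF e(1)] by (intro order_tendstoD(2)[of _ 0]) auto
      then obtain m0 where m0: "\<And>m. m \<ge> m0 \<Longrightarrow> \<bar>e m\<bar> < \<epsilon> * min T \<eta>"
        by (auto simp: eventually_sequentially)
      \<comment> \<open>For n > d m0 the vertex number m = 2 n / d, when it is an integer, exceeds
        m0. Otherwise both sums are 0.\<close>
      have "norm (?G n - ?S n) \<le> \<epsilon> * norm (?C n) \<and> (?S n \<noteq> 0 \<longrightarrow> norm (?G n - ?S n) \<le> \<epsilon> * norm (?S n))"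
        if n: "n > d * m0" for n
      proof (cases "d dvd 2 * n")
        case True
        then obtain m where "2 * n = d * m" by (auto elim: dvdE)
        then have m: "d * m = 2 * n" by simp
        have "n > 0" using n by simp
        have "d * m0 < d * m" unfolding m using n by simp
        then have "m \<ge> m0" by simp
        have S: "?S n = of_real (C n m * S m)" and T: "?C n = C n m * T"
          using ss(2,3)[OF \<open>n > 0\<close> m] unfolding C_def S_def T_def \<alpha>_def by simp_all
        have "?G n - ?S n = of_real (C n m * e m)"
          unfolding e(2)[OF \<open>n > 0\<close> m] S of_real_diff[symmetric] by (simp only: distrib_left add_diff_cancel_left')
        then have D: "norm (?G n - ?S n) = C n m * \<bar>e m\<bar>"
          using Cpos[of n m] by (simp only: norm_of_real abs_mult abs_of_pos)
        have "C n m * \<bar>e m\<bar> \<le> C n m * (\<epsilon> * min T \<eta>)"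
          using m0[OF \<open>m \<ge> m0\<close>] Cpos[of n m] by (intro mult_left_mono) auto
        also have "\<dots> \<le> C n m * (\<epsilon> * T)"
          using \<epsilon> Cpos[of n m] by (intro mult_left_mono) auto
        finally have 1: "norm (?G n - ?S n) \<le> \<epsilon> * norm (?C n)"
          unfolding D T using Cpos[of n m] \<open>T > 0\<close> by (simp add: abs_mult mult_ac)
        have "norm (?G n - ?S n) \<le> \<epsilon> * norm (?S n)" if "?S n \<noteq> 0"
        proof -
          have "S m \<noteq> 0" using that unfolding S by auto
          have "C n m * \<bar>e m\<bar> \<le> C n m * (\<epsilon> * min T \<eta>)"
            using m0[OF \<open>m \<ge> m0\<close>] Cpos[of n m] by (intro mult_left_mono) auto
          also have "\<dots> \<le> C n m * (\<epsilon> * \<bar>S m\<bar>)"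
            using \<epsilon> Cpos[of n m] \<eta>(2)[OF \<open>S m \<noteq> 0\<close>] by (intro mult_left_mono) auto
          finally show ?thesis
            unfolding D unfolding S norm_of_real using Cpos[of n m] by (simp add: abs_mult mult_ac)
        qed
        with 1 show ?thesis by blast
      next
        case False
        have "n > 0" using n by simp
        then have "?S n = 0" "graph_sum k \<Lambda> n = 0"
          using ss(1) False graph_sum_eq_0[OF assms(1), of n \<Lambda>] by (simp_all add: d_def)
        then show ?thesis using \<epsilon> by simp
      qed
      then show ?thesis
        by (auto intro!: eventually_mono[OF eventually_gt_at_top[of "d * m0"]])
    qed
    then show "\<forall>\<^sub>F n in sequentially. norm (?G n - ?S n) \<le> \<epsilon> * norm (?C n)"
      "\<forall>\<^sub>F n in sequentially. ?S n \<noteq> 0 \<longrightarrow> norm (?G n - ?S n) \<le> \<epsilon> * norm (?S n)" by blast+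
  qed
  have "(\<lambda>n. ?G n - ?S n) \<in> o[nonzero_at_top ?S](?S)"
    unfolding nonzero_at_top_def
    by (rule landau_o.smallI) (use small' in \<open>simp add: eventually_inf_principal\<close>)
  moreover have "(\<lambda>n. norm (?G n - ?S n)) \<in> o[sequentially](?C)"
    by (rule landau_o.smallI) (use small in simp)
  ultimately show ?thesis by (blast intro: smallo_imp_asymp_equiv)
qed

end
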